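(* Let $0\le q\le d$, and let $\boldsymbol b,\boldsymbol d\in\mathcal S$ with $\boldsymbol b\le\boldsymbol d$. Assume that the stationary marked point process $X=\{(X_i,M_i)\}_{i\ge1}$ is ergodic and that $\mathbb E[X([0,1]^d)^p]<\infty$ for all $p\ge1$. Then there exists a deterministic number $\bar\beta_q^{\boldsymbol b,\boldsymbol d}$ such that $$\lim_{n\to\infty}\frac1{n^d}\,\mathbb E\big[\beta_{q,n}^{\boldsymbol b,\boldsymbol d}\big]=\bar\beta_q^{\boldsymbol b,\boldsymbol d},$$ and, almost surely, $$\lim_{n\to\infty}\frac1{n^d}\,\beta_{q,n}^{\boldsymbol b,\boldsymbol d}=\bar\beta_q^{\boldsymbol b,\boldsymbol d}.$$
   Context: **Marked point process.** Fix $d\ge1$ and a positive integer $T$. $X=\{(X_i,M_i)\}_{i\ge1}$ is a marked point process with locations $X_i\in\mathbb R^d$ and marks $M_i\in[0,T]$. It is stationary: the distribution of $\{(X_i+x,M_i)\}_{i\ge1}$ is the same for every $x\in\mathbb R^d$. For $B\subseteq\mathbb R^d$ put $X(B):=\#\{i\ge1: X_i\in B\}$. The intensity $\lambda:=\mathbb E[X([0,1]^d)]$ is assumed positive and finite. Ergodic means ergodic with respect to the spatial shifts $\{(X_i,M_i)\}\mapsto\{(X_i+x,M_i)\}$, $x\in\mathbb R^d$. **Čech complex.** For a nonempty finite set $\sigma=\{x_0,\dots,x_p\}\subseteq\mathbb R^d$ let $r(\sigma):=\min\{t\ge0: B_t(x_0)\cap\cdots\cap B_t(x_p)\ne\varnothing\}$,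 where $B_t(y)$ is the closed Euclidean ball of radius $t$ around $y$. For $P\subseteq\mathbb R^d$, $\mathrm{Cech}_r(P)$ is the simplicial complex of all nonempty finite $\sigma\subseteq P$ with $r(\sigma)\le r$. **Multicover complex.** For $P\subseteq\mathbb R^d$, $r\ge0$ and an integer $k\ge1$, $\mathrm{Mult}_{(r,k)}(P)$ is the simplicial complex whose vertices are $k$-element subsets of $P$, and in which distinct $k$-element subsets $\varphi_0,\dots,\varphi_p\subseteq P$ form a $p$-simplex ($p\ge0$) if and only if $\varphi_0\cup\cdots\cup\varphi_p\in\mathrm{Cech}_r(P)$. **Multifiltration.** The index set is $\mathcal S:=[0,T]\times[0,T]\times\{1,\dots,T\}$, with $(r_1,r_2,k)\le(r_1',r_2',k')$ if and only if $r_1\le r_1'$, $r_2\le r_2'$ and $k\ge k'$ (reversed order in the last coordinate). For an integer $n\ge1$ and $(r_1,r_2,k)\in\mathcal S$ put $$\mathbb K_{(r_1,r_2,k),n}:=\mathrm{Mult}_{(r_1,k)}\big(\{X_i\in[0,n]^d: M_i\le r_2\}\big).$$ For $\boldsymbol a=(r_1,r_2,k)\le\boldsymbol a'=(r_1',r_2',k')$ the simplicial map $\mathbb K_{\boldsymbol a,n}\to\mathbb K_{\boldsymbol a',n}$ sends a vertex $\varphi$ (a $k$-element set) to the set of its $k'$ smallest elements in the lexicographic order of $\mathbb R^d$. **Persistent Betti numbers.** For $\boldsymbol b\le\boldsymbol d$ in $\mathcal S$, $$\beta_{q,n}^{\boldsymbol b,\boldsymbol d}:=\dim\,\mathrm{Im}\big(H_q(\mathbb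 K_{\boldsymbol b,n})\to H_q(\mathbb K_{\boldsymbol d,n})\big),$$ where $H_q$ is simplicial homology with $\mathbb Z/2$-coefficients. *)

theory Defs
  imports
    "HOL-Probability.Probability"
    "HOL-Library.Z2"
    "HOL-Algebra.AbelCoset"
    "Jordan_Normal_Form.Missing_VectorSpace"
begin

section \<open>Simplicial homology with coefficients in the field with two elements\<close>

definition Z2 :: "bit ring" where
  "Z2 = \<lparr>carrier = UNIV, mult = (*), one = 1, zero = 0, add = (+)\<rparr>"

text \<open>
  A simplicial complex is the set of its simplices, each a nonempty finite set of vertices.
  A \<open>q\<close>-chain is a finitely supported \<open>bit\<close>-valued function on the \<open>q\<close>-simplices, extended by
  zero to all sets. The ring operations of the \<open>module\<close> record are irrelevant.
\<close>

definition chain_space :: "'v set set \<Rightarrow> nat \<Rightarrow> (bit, 'v set \<Rightarrow> bit) module" where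
  "chain_space K q =
     \<lparr>carrier = {c. finite {\<sigma>. c \<sigma> \<noteq> 0} \<and> (\<forall>\<sigma>. c \<sigma> \<noteq> 0 \<longrightarrow> \<sigma> \<in> K \<and> card \<sigma> = Suc q)},
      mult = undefined, one = undefined,
      zero = (\<lambda>_. 0), add = (\<lambda>c c' \<sigma>. c \<sigma> + c' \<sigma>), smult = (\<lambda>a c \<sigma>. a * c \<sigma>)\<rparr>"

text \<open>Homology is not reduced, so the boundary of a vertex is zero.\<close>

definition boundary_map :: "('v set \<Rightarrow> bit) \<Rightarrow> 'v set \<Rightarrow> bit" where
  "boundary_map c = (\<lambda>\<tau>. if \<tau> = {} then 0
     else (\<Sum>\<sigma> | c \<sigma> \<noteq> 0 \<and> (\<exists>v\<in>\<sigma>. \<tau> = \<sigma> - {v}). c \<sigma>))"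

definition cycles :: "'v set set \<Rightarrow> nat \<Rightarrow> ('v set \<Rightarrow> bit) set" where
  "cycles K q = {c \<in> carrier (chain_space K q). boundary_map c = (\<lambda>_. 0)}"

definition boundaries :: "'v set set \<Rightarrow> nat \<Rightarrow> ('v set \<Rightarrow> bit) set" where
  "boundaries K q = boundary_map ` carrier (chain_space K (Suc q))"

definition quotient_module :: "('a, 'b, 'c) module_scheme \<Rightarrow> 'b set \<Rightarrow> ('a, 'b set) module" where
  "quotient_module V W =
     \<lparr>carrier = A_RCOSETS V W, mult = undefined, one = undefined,
      zero = W, add = set_add V, smult = (\<lambda>a A. \<Union>x\<in>A. W +>\<^bsub>V\<^esub> (a \<odot>\<^bsub>V\<^esub> x))\<rparr>"

definition homology :: "'v set set \<Rightarrow> nat \<Rightarrow> (bit, ('v set \<Rightarrow> bit) set) module" where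
  "homology K q = quotient_module ((chain_space K q)\<lparr>carrier := cycles K q\<rparr>) (boundaries K q)"

text \<open>
  The chain map of a simplicial map given by the vertex map \<open>f\<close>: a simplex on which \<open>f\<close> is not
  injective is sent to zero.
\<close>

definition chain_map :: "('v \<Rightarrow> 'u) \<Rightarrow> ('v set \<Rightarrow> bit) \<Rightarrow> 'u set \<Rightarrow> bit" where
  "chain_map f c = (\<lambda>\<tau>. \<Sum>\<sigma> | c \<sigma> \<noteq> 0 \<and> inj_on f \<sigma> \<and> f ` \<sigma> = \<tau>. c \<sigma>)"

definition homology_map ::
    "('v \<Rightarrow> 'u) \<Rightarrow> 'u set set \<Rightarrow> nat \<Rightarrow> ('v set \<Rightarrow> bit) set \<Rightarrow> ('u set \<Rightarrow> bit) set" where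
  "homology_map f L q A = (\<Union>c\<in>A. boundaries L q +>\<^bsub>chain_space L q\<^esub> chain_map f c)"

definition homology_image_dim :: "('v \<Rightarrow> 'u) \<Rightarrow> 'v set set \<Rightarrow> 'u set set \<Rightarrow> nat \<Rightarrow> nat" where
  "homology_image_dim f K L q =
     vectorspace.dim Z2
       ((homology L q)\<lparr>carrier := homology_map f L q ` carrier (homology K q)\<rparr>)"


section \<open>Cech and multicover complexes\<close>

definition cech_radius :: "(real ^ 'n::finite) set \<Rightarrow> real" where
  "cech_radius \<sigma> = (LEAST t. 0 \<le> t \<and> (\<Inter>x\<in>\<sigma>. cball x t) \<noteq> {})"

definition Cech :: "real \<Rightarrow> (real ^ 'n::finite) set \<Rightarrow> (real ^ 'n) set set" where
  "Cech r P = {\<sigma>. finite \<sigma> \<and> \<sigma> \<noteq> {} \<and> \<sigma> \<subseteq> P \<and> cech_radius \<sigma> \<le> r}"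

text \<open>
  The conjunct \<open>finite \<phi>\<close> is needed only for \<open>k = 0\<close>, where \<open>card\<close> would also count infinite
  sets.
\<close>

definition Mult :: "real \<Rightarrow> nat \<Rightarrow> (real ^ 'n::finite) set \<Rightarrow> (real ^ 'n) set set set" where
  "Mult r k P = {\<Phi>. finite \<Phi> \<and> \<Phi> \<noteq> {} \<and>
     (\<forall>\<phi>\<in>\<Phi>. \<phi> \<subseteq> P \<and> finite \<phi> \<and> card \<phi> = k) \<and> \<Union>\<Phi> \<in> Cech r P}"

text \<open>The lexicographic order compares the coordinates along the linear order of the index type.\<close>

definition lex_less :: "real ^ 'n::{finite,linorder} \<Rightarrow> real ^ 'n::{finite,linorder} \<Rightarrow> bool" where
  "lex_less x y \<longleftrightarrow> (\<exists>i. x $ i < y $ i \<and> (\<forall>j<i. x $ j = y $ j))"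

definition lex_smallest ::
    "nat \<Rightarrow> (real ^ 'n::{finite,linorder}) set \<Rightarrow> (real ^ 'n::{finite,linorder}) set" where
  "lex_smallest k \<phi> = {x \<in> \<phi>. card {y \<in> \<phi>. lex_less y x} < k}"


section \<open>Marked point processes\<close>

text \<open>
  The locations and marks are given by an enumeration; the points need not be distinct. Being
  locally finite is part of being a point process.
\<close>

locale marked_point_process = prob_space \<Omega>
  for \<Omega> :: "'w measure" +
  fixes T :: nat and X :: "nat \<Rightarrow> 'w \<Rightarrow> real ^ 'n::finite" and M :: "nat \<Rightarrow> 'w \<Rightarrow> real"
  assumes location_measurable: "X i \<in> borel_measurable \<Omega>"
    and mark_measurable: "M i \<in> borel_measurable \<Omega>"
    and mark_range: "\<omega> \<in> space \<Omega> \<Longrightarrow> M i \<omega> \<in> {0..real T}"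
    and locally_finite: "\<omega> \<in> space \<Omega> \<Longrightarrow> bounded B \<Longrightarrow> finite {i. X i \<omega> \<in> B}"

definition point_count ::
    "(nat \<Rightarrow> 'w \<Rightarrow> real ^ 'n::finite) \<Rightarrow> (real ^ 'n) set \<Rightarrow> 'w \<Rightarrow> ennreal" where
  "point_count X B \<omega> = emeasure (count_space UNIV) {i. X i \<omega> \<in> B}"

definition cube :: "nat \<Rightarrow> (real ^ 'n::finite) set" where
  "cube n = cbox 0 (\<chi> i. real n)"

definition intensity :: "'w measure \<Rightarrow> (nat \<Rightarrow> 'w \<Rightarrow> real ^ 'n::finite) \<Rightarrow> ennreal" where
  "intensity \<Omega> X = (\<integral>\<^sup>+ \<omega>. point_count X (cube 1) \<omega> \<partial>\<Omega>)"

text \<open>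
  The distribution of the process does not depend on the enumeration of its points: it is the
  law of the counting measure of the points, with respect to the sigma-algebra generated by the
  evaluations on Borel sets (compare \<open>subprob_algebra\<close>).
\<close>

definition configuration_space :: "((real ^ 'n::finite) \<times> real) measure measure" where
  "configuration_space =
     (SUP A \<in> sets borel. vimage_algebra {\<mu>. sets \<mu> = sets borel} (\<lambda>\<mu>. emeasure \<mu> A) borel)"

definition configuration ::
    "(nat \<Rightarrow> 'w \<Rightarrow> real ^ 'n::finite) \<Rightarrow> (nat \<Rightarrow> 'w \<Rightarrow> real) \<Rightarrow> 'w
      \<Rightarrow> ((real ^ 'n) \<times> real) measure" where
  "configuration X M \<omega> = distr (count_space UNIV) borel (\<lambda>i. (X i \<omega>, M i \<omega>))"

definition process_law ::
    "'w measure \<Rightarrow> (nat \<Rightarrow> 'w \<Rightarrow> real ^ 'n::finite) \<Rightarrow> (nat \<Rightarrow> 'w \<Rightarrow> real)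
      \<Rightarrow> ((real ^ 'n) \<times> real) measure measure" where
  "process_law \<Omega> X M = distr \<Omega> configuration_space (configuration X M)"

definition stationary_process ::
    "'w measure \<Rightarrow> (nat \<Rightarrow> 'w \<Rightarrow> real ^ 'n::finite) \<Rightarrow> (nat \<Rightarrow> 'w \<Rightarrow> real) \<Rightarrow> bool" where
  "stationary_process \<Omega> X M \<longleftrightarrow>
     (\<forall>x. process_law \<Omega> (\<lambda>i \<omega>. X i \<omega> + x) M = process_law \<Omega> X M)"

definition shift_configuration ::
    "real ^ 'n::finite \<Rightarrow> ((real ^ 'n) \<times> real) measure \<Rightarrow> ((real ^ 'n) \<times> real) measure" where
  "shift_configuration x \<mu> = distr \<mu> borel (\<lambda>(y, m). (y + x, m))"

definition ergodic_process ::
    "'w measure \<Rightarrow> (nat \<Rightarrow> 'w \<Rightarrow> real ^ 'n::finite) \<Rightarrow> (nat \<Rightarrow> 'w \<Rightarrow> real) \<Rightarrow> bool" where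
  "ergodic_process \<Omega> X M \<longleftrightarrow>
     (\<forall>A \<in> sets configuration_space.
        (\<forall>x. shift_configuration x -` A \<inter> space configuration_space = A) \<longrightarrow>
        measure (process_law \<Omega> X M) A \<in> {0, 1})"


section \<open>The multifiltration and its persistent Betti numbers\<close>

type_synonym filtration_index = "real \<times> real \<times> nat"

definition filtration_indices :: "nat \<Rightarrow> filtration_index set" where
  "filtration_indices T = {0..real T} \<times> {0..real T} \<times> {1..T}"

definition index_le :: "filtration_index \<Rightarrow> filtration_index \<Rightarrow> bool" where
  "index_le = (\<lambda>(r1, r2, k) (r1', r2', k'). r1 \<le> r1' \<and> r2 \<le> r2' \<and> k \<ge> k')"

definition filtration_complex ::
    "(nat \<Rightarrow> 'w \<Rightarrow> real ^ 'n::finite) \<Rightarrow> (nat \<Rightarrow> 'w \<Rightarrow> real) \<Rightarrow> filtration_index \<Rightarrow> nat \<Rightarrow> 'w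
      \<Rightarrow> (real ^ 'n) set set set" where
  "filtration_complex X M = (\<lambda>(r1, r2, k) n \<omega>.
     Mult r1 k {X i \<omega> | i. X i \<omega> \<in> cube n \<and> M i \<omega> \<le> r2})"

definition persistent_betti ::
    "(nat \<Rightarrow> 'w \<Rightarrow> real ^ 'n::{finite,linorder}) \<Rightarrow> (nat \<Rightarrow> 'w \<Rightarrow> real) \<Rightarrow> nat
      \<Rightarrow> filtration_index \<Rightarrow> filtration_index \<Rightarrow> nat \<Rightarrow> 'w \<Rightarrow> nat" where
  "persistent_betti X M q b d n \<omega> =
     homology_image_dim (lex_smallest (snd (snd d)))
       (filtration_complex X M b n \<omega>) (filtration_complex X M d n \<omega>) q"

end

theory Submission
  imports Defs "HOL-Library.Function_Algebras"
begin

text \<open>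
  The persistent Betti number of the cube of side \<open>n\<close> is, up to a boundary effect, a
  sum of contributions of bounded tiles of the cube, so that its quotient by the volume of the
  cube is a spatial average of a local functional of the process and converges by a multiparameter
  ergodic theorem.

  Locality. Over the field with two elements the dimension of a finite space is the binary
  logarithm of its cardinality, so the rank of a map in homology can be controlled by counting
  chains (\<open>homology_image_dim_card\<close>). Deleting simplices changes that rank by at most
  the number of deleted \<open>q\<close>-simplices of the source plus the number of deleted
  \<open>(q + 1)\<close>-simplices of the target (\<open>homology_image_dim_subcomplex\<close>),
  and the rank is additive over disjoint subcomplexes (\<open>homology_image_dim_UNION\<close>).
  All points that occur in one simplex of a multicover complex lie in a ball of the filtration
  radius. If the points are distributed over disjoint regions, the simplices that are lost
  therefore consist of points near the borders of the regions, and their number is at most a sum,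
  over the unit lattice cells near the borders, of a power of the number of points in a window
  around the cell (\<open>multicover_betti_localisation\<close>).

  Convergence. Cut the cube of side \<open>n\<close> into tiles of a fixed side \<open>m\<close>.
  The Betti number differs from the sum of those of the tiles by at most the sum of the border
  weights of the tiles plus the weight of a shell along the boundary of the cube
  (\<open>tiling_estimate\<close>). Divided by the volume of the cube, both sums over tiles are
  averages over a box of shifts and converge almost surely
  (\<open>multiparameter_ergodic_theorem\<close>). The shell is negligible: its second moment,
  after normalisation, is of order \<open>1 / n\<^sup>2\<close>, which is summable
  (\<open>shell_sum_negligible\<close>). The expected border weight per unit volume is of order
  \<open>1 / m\<close>, and by Fatou's lemma the limits of the border averages per unit volume
  are, almost surely, arbitrarily small for suitable \<open>m\<close>. Hence the sequence is
  Cauchy (\<open>betti_density_convergent\<close>). The ergodic theorem also yields a majorant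
  with moments of all orders, so the expectations converge to the expectation of the limit
  (\<open>betti_density_dominated\<close>).

  Constancy. Shifting the configuration is shifting the cube the other way, which changes the
  Betti number by at most twice the weight of a shell. On the set of configurations for which the
  densities converge and all shells are negligible the limit is thus invariant under every shift,
  and that set is itself mapped into itself by every shift (\<open>regular_configs_shift\<close>).
  Ergodicity, applied to the event that the limit does not exceed its mean, makes the limit
  constant.

  Measurability. The law of the process lives on a space of measures that contains measures which
  are not counting measures at all, and ergodicity is a statement about measurable sets that are
  exactly invariant. The points are therefore recovered from a measure as its atoms, on a class of
  measures that is measurable and visibly invariant (\<open>hard_atomic\<close>). The Betti number
  of the atoms is a measurable function because it does not change when the points are rounded to
  a sufficiently fine grid and the radii are enlarged by the rounding error
  (\<open>multicover_betti_grid_round\<close>), and after rounding only finitely many point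
  patterns are possible in a bounded region.
\<close>

section \<open>Averages along a measure preserving map\<close>

text \<open>
  The natural class here: it is stable under sums, powers and passage to the maximal function of a
  measure preserving map, so that the ergodic theorem can be iterated within it.
\<close>

definition all_moments :: "'a measure \<Rightarrow> ('a \<Rightarrow> real) \<Rightarrow> bool" where
  "all_moments M f \<longleftrightarrow> f \<in> borel_measurable M \<and> (\<forall>p::nat. integrable M (\<lambda>x. \<bar>f x\<bar> ^ p))"

definition measure_preserving :: "'a measure \<Rightarrow> ('a \<Rightarrow> 'a) \<Rightarrow> bool" where
  "measure_preserving M T \<longleftrightarrow> T \<in> measurable M M \<and> distr M M T = M"

definition birkhoff_sum :: "('a \<Rightarrow> 'a) \<Rightarrow> ('a \<Rightarrow> real) \<Rightarrow> nat \<Rightarrow> 'a \<Rightarrow> real" where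
  "birkhoff_sum T f n x = (\<Sum>i<n. f ((T ^^ i) x))"

definition birkhoff_avg :: "('a \<Rightarrow> 'a) \<Rightarrow> nat \<Rightarrow> ('a \<Rightarrow> real) \<Rightarrow> 'a \<Rightarrow> real" where
  "birkhoff_avg T n f x = birkhoff_sum T f n x / real n"

lemma birkhoff_sum_0 [simp]: "birkhoff_sum T f 0 x = 0"
  by (simp add: birkhoff_sum_def)

lemma birkhoff_sum_Suc: "birkhoff_sum T f (Suc n) x = f x + birkhoff_sum T f n (T x)"
  unfolding birkhoff_sum_def
  by (subst sum.lessThan_Suc_shift) (simp add: funpow_swap1)

lemma measure_preserving_measurable:
  "measure_preserving M T \<Longrightarrow> T \<in> measurable M M"
  by (simp add: measure_preserving_def)

lemma measurable_funpow:
  assumes "T \<in> measurable M M"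
  shows "T ^^ i \<in> measurable M M"
proof (induction i)
  case 0
  show ?case by (simp add: id_def)
next
  case (Suc i)
  then show ?case using assms by (simp add: measurable_comp)
qed

lemma birkhoff_sum_measurable:
  assumes "T \<in> measurable M M" "f \<in> borel_measurable M"
  shows "birkhoff_sum T f n \<in> borel_measurable M"
proof -
  have "(\<lambda>x. f ((T ^^ i) x)) \<in> borel_measurable M" for i
    using measurable_compose[OF measurable_funpow[OF assms(1)] assms(2)] .
  then show ?thesis unfolding birkhoff_sum_def by measurable
qed

lemma birkhoff_avg_measurable:
  assumes "T \<in> measurable M M" "f \<in> borel_measurable M"
  shows "birkhoff_avg T n f \<in> borel_measurable M"
  using birkhoff_sum_measurable[OF assms] unfolding birkhoff_avg_def by measurable

lemma measure_preserving_funpow: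
  assumes "measure_preserving M T"
  shows "measure_preserving M (T ^^ i)"
proof (induction i)
  case 0
  show ?case by (simp add: measure_preserving_def id_def distr_id)
next
  case (Suc i)
  have T: "T \<in> measurable M M" "distr M M T = M"
    and Ti: "T ^^ i \<in> measurable M M" "distr M M (T ^^ i) = M"
    using assms Suc by (auto simp: measure_preserving_def)
  have "distr M M (T \<circ> T ^^ i) = distr (distr M M (T ^^ i)) M T"
    by (rule distr_distr[OF T(1) Ti(1), symmetric])
  also have "\<dots> = M" by (simp only: T(2) Ti(2))
  finally show ?case
    using measurable_comp[OF Ti(1) T(1)] by (simp add: measure_preserving_def o_def)
qed

lemma measure_preserving_integral:
  fixes f :: "'a \<Rightarrow> real"
  assumes "measure_preserving M T" "f \<in> borel_measurable M"
  shows "(\<integral>x. f (T x) \<partial>M) = (\<integral>x. f x \<partial>M)"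
  using assms integral_distr[of T M M f] by (simp add: measure_preserving_def)

lemma measure_preserving_integrable:
  fixes f :: "'a \<Rightarrow> real"
  assumes "measure_preserving M T" "integrable M f"
  shows "integrable M (\<lambda>x. f (T x))"
  using assms integrable_distr[of T M M f] by (simp add: measure_preserving_def)

lemma measure_preserving_AE:
  assumes "measure_preserving M T" "AE x in M. P x"
  shows "AE x in M. P (T x)"
proof -
  have T: "T \<in> measurable M M" "distr M M T = M"
    using assms(1) by (auto simp: measure_preserving_def)
  show ?thesis by (rule AE_distrD[OF T(1)]) (subst T(2), rule assms(2))
qed

lemma measure_preserving_AE_orbit:
  assumes "measure_preserving M T" "AE x in M. P x"
  shows "AE x in M. \<forall>i. P ((T ^^ i) x)"
  unfolding AE_all_countable
  using measure_preserving_AE[OF measure_preserving_funpow[OF assms(1)] assms(2)] by blast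

lemma birkhoff_sum_integrable:
  assumes "measure_preserving M T" "integrable M f"
  shows "integrable M (birkhoff_sum T f n)"
  unfolding birkhoff_sum_def
  using measure_preserving_integrable[OF measure_preserving_funpow[OF assms(1)] assms(2)]
  by (intro Bochner_Integration.integrable_sum) auto

lemma birkhoff_avg_integral:
  assumes "measure_preserving M T" "integrable M f" "n \<ge> 1"
  shows "(\<integral>x. birkhoff_avg T n f x \<partial>M) = (\<integral>x. f x \<partial>M)"
proof -
  note mp = measure_preserving_funpow[OF assms(1)]
  have "(\<integral>x. birkhoff_sum T f n x \<partial>M) = (\<Sum>i<n. \<integral>x. f ((T ^^ i) x) \<partial>M)"
    unfolding birkhoff_sum_def
    by (rule Bochner_Integration.integral_sum) (rule measure_preserving_integrable[OF mp assms(2)])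
  also have "\<dots> = real n * (\<integral>x. f x \<partial>M)"
    using measure_preserving_integral[OF mp] assms(2) by simp
  finally show ?thesis using assms(3) by (simp add: birkhoff_avg_def)
qed

section \<open>The maximal inequality and oscillation of averages\<close>

text \<open>
  The maximum of the first \<open>n + 1\<close> partial sums along the orbit, including the empty
  sum. The recursion is the identity on which Garsia's proof of the maximal inequality rests.
\<close>

fun max_partial_sum :: "('a \<Rightarrow> 'a) \<Rightarrow> ('a \<Rightarrow> real) \<Rightarrow> nat \<Rightarrow> 'a \<Rightarrow> real" where
  "max_partial_sum T f 0 x = 0"
| "max_partial_sum T f (Suc n) x = max 0 (f x + max_partial_sum T f n (T x))"

lemma max_partial_sum_nonneg: "0 \<le> max_partial_sum T f n x"
  by (cases n) auto

lemma max_partial_sum_mono: "max_partial_sum T f n x \<le> max_partial_sum T f (Suc n) x"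
proof (induction n arbitrary: x)
  case 0
  show ?case by simp
next
  case (Suc n)
  show ?case using Suc[of "T x"] by (simp add: max_def)
qed

lemma birkhoff_sum_le_max_partial_sum:
  "k \<le> n \<Longrightarrow> birkhoff_sum T f k x \<le> max_partial_sum T f n x"
proof (induction n arbitrary: k x)
  case 0
  then show ?case by simp
next
  case (Suc n)
  show ?case
  proof (cases k)
    case 0
    then show ?thesis by (simp add: max_partial_sum_nonneg del: max_partial_sum.simps(2))
  next
    case (Suc k')
    then show ?thesis
      using Suc.IH[of k' "T x"] Suc.prems by (simp add: birkhoff_sum_Suc max_def)
  qed
qed

lemma max_partial_sum_attained: "\<exists>k\<le>n. max_partial_sum T f n x = birkhoff_sum T f k x"
proof (induction n arbitrary: x)
  case 0
  then show ?case by simp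
next
  case (Suc n)
  obtain k where k: "k \<le> n" "max_partial_sum T f n (T x) = birkhoff_sum T f k (T x)"
    using Suc by blast
  show ?case
  proof (cases "f x + max_partial_sum T f n (T x) \<le> 0")
    case True
    then show ?thesis by (intro exI[of _ 0]) (simp add: max_def)
  next
    case False
    then show ?thesis
      using k by (intro exI[of _ "Suc k"]) (simp add: birkhoff_sum_Suc)
  qed
qed

lemma max_partial_sum_integrable:
  assumes "measure_preserving M T" "integrable M f"
  shows "integrable M (max_partial_sum T f n)"
proof (induction n)
  case 0
  show ?case by simp
next
  case (Suc n)
  then have "integrable M (\<lambda>x. max_partial_sum T f n (T x))"
    by (rule measure_preserving_integrable[OF assms(1)])
  then show ?case using assms(2) by simp
qed

text \<open>
  Garsia's argument. Let \<open>m\<close> be the maximum of finitely many partial sums. Where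
  \<open>m\<close> is positive the recursion gives \<open>m x - m (T x) \<le> f x\<close>, and
  elsewhere the left side is not positive. Since the integral of \<open>m - m \<circ> T\<close>
  vanishes, \<open>f\<close> has a nonnegative integral over the set where \<open>m\<close> is
  positive.
\<close>

lemma maximal_ergodic_inequality:
  assumes T: "measure_preserving M T" and f: "integrable M f"
  shows "0 \<le> (\<integral>x. indicator {x \<in> space M. \<exists>k. birkhoff_sum T f k x > 0} x * f x \<partial>M)"
proof -
  let ?m = "max_partial_sum T f"
  define E where "E n = {x \<in> space M. ?m n x > 0}" for n
  define E' where "E' = {x \<in> space M. \<exists>k. birkhoff_sum T f k x > 0}"
  note [measurable] = borel_measurable_integrable[OF max_partial_sum_integrable[OF T f]]
    borel_measurable_integrable[OF f]
  have [measurable]: "E n \<in> sets M" for n unfolding E_def by measurable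
  have E'_eq: "E' = (\<Union>n. E n)"
  proof -
    have "(\<exists>k. birkhoff_sum T f k x > 0) \<longleftrightarrow> (\<exists>n. ?m n x > 0)" for x
      by (metis birkhoff_sum_le_max_partial_sum max_partial_sum_attained order_less_le_trans order_refl)
    then show ?thesis by (auto simp: E'_def E_def)
  qed
  then have [measurable]: "E' \<in> sets M" by simp
  have incE: "E n \<subseteq> E (Suc n)" for n
    unfolding E_def using max_partial_sum_mono[of T f n]
    by (auto simp del: max_partial_sum.simps intro: less_le_trans)
  have nonneg: "0 \<le> (\<integral>x. indicator (E (Suc n)) x * f x \<partial>M)" for n
  proof -
    have int: "integrable M (?m (Suc n))" "integrable M (\<lambda>x. ?m (Suc n) (T x))"
      using max_partial_sum_integrable[OF T f] measure_preserving_integrable[OF T] by blast+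
    have "0 = (\<integral>x. ?m (Suc n) x - ?m (Suc n) (T x) \<partial>M)"
      using int measure_preserving_integral[OF T, of "?m (Suc n)"]
      by (simp del: max_partial_sum.simps)
    also have "\<dots> \<le> (\<integral>x. indicator (E (Suc n)) x * f x \<partial>M)"
    proof (rule integral_mono)
      show "integrable M (\<lambda>x. ?m (Suc n) x - ?m (Suc n) (T x))"
        using int by (rule Bochner_Integration.integrable_diff)
      show "integrable M (\<lambda>x. indicator (E (Suc n)) x * f x)"
        using integrable_mult_indicator[of "E (Suc n)" M f] f by simp
    next
      fix x assume x: "x \<in> space M"
      show "?m (Suc n) x - ?m (Suc n) (T x) \<le> indicator (E (Suc n)) x * f x"
      proof (cases "x \<in> E (Suc n)")
        case True
        then have "?m (Suc n) x = f x + ?m n (T x)"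
          by (auto simp: E_def max_def split: if_splits)
        then show ?thesis
          using True max_partial_sum_mono[of T f n "T x"]
          by (simp del: max_partial_sum.simps)
      next
        case False
        then have "?m (Suc n) x = 0"
          using x max_partial_sum_nonneg[of T f "Suc n" x]
          by (simp add: E_def del: max_partial_sum.simps)
        then show ?thesis
          using False max_partial_sum_nonneg[of T f "Suc n" "T x"]
          by (simp del: max_partial_sum.simps)
      qed
    qed
    finally show ?thesis .
  qed
  have "(\<lambda>n. \<integral>x. indicator (E (Suc n)) x * f x \<partial>M) \<longlonglongrightarrow> (\<integral>x. indicator E' x * f x \<partial>M)"
  proof (rule integral_dominated_convergence[where w = "\<lambda>x. \<bar>f x\<bar>"])
    show "AE x in M. (\<lambda>n. indicator (E (Suc n)) x * f x) \<longlonglongrightarrow> indicator E' x * f x"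
    proof (rule AE_I2)
      fix x
      have "(\<lambda>n. indicator (E n) x :: real) \<longlonglongrightarrow> indicator (\<Union>n. E n) x"
        by (rule LIMSEQ_indicator_incseq) (rule incseq_SucI, rule incE)
      then have "(\<lambda>n. indicator (E (Suc n)) x :: real) \<longlonglongrightarrow> indicator E' x"
        unfolding E'_eq by (rule LIMSEQ_Suc)
      then show "(\<lambda>n. indicator (E (Suc n)) x * f x) \<longlonglongrightarrow> indicator E' x * f x"
        by (intro tendsto_intros)
    qed
    show "AE x in M. norm (indicator (E (Suc n)) x * f x) \<le> \<bar>f x\<bar>" for n
      by (rule AE_I2) (simp add: indicator_def)
  qed (use f in auto)
  then show ?thesis
    unfolding E'_def[symmetric] by (rule LIMSEQ_le_const) (use nonneg in blast)
qed

text \<open>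
  On an invariant set the partial sums of the truncated function are the truncated partial sums,
  so the maximal inequality localises to the set.
\<close>

lemma maximal_inequality_invariant_set:
  assumes T: "measure_preserving M T" and g: "integrable M g"
    and E: "E \<in> sets M" "\<And>x. x \<in> space M \<Longrightarrow> T x \<in> E \<longleftrightarrow> x \<in> E"
    and pos: "\<And>x. x \<in> E \<Longrightarrow> \<exists>k. birkhoff_sum T g k x > 0"
  shows "0 \<le> (\<integral>x. indicator E x * g x \<partial>M)"
proof -
  let ?g = "\<lambda>x. indicator E x * g x"
  have int: "integrable M ?g"
    using integrable_mult_indicator[of E M g] E(1) g by simp
  have sum: "birkhoff_sum T ?g k x = indicator E x * birkhoff_sum T g k x"
    if "x \<in> space M" for x k
    using that
  proof (induction k arbitrary: x)
    case 0
    show ?case by simp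
  next
    case (Suc k)
    have "T x \<in> space M"
      using Suc.prems T by (auto simp: measure_preserving_def dest: measurable_space)
    then show ?case
      using Suc.IH[of "T x"] E(2)[OF Suc.prems]
      by (simp add: birkhoff_sum_Suc indicator_def algebra_simps)
  qed
  have "{x \<in> space M. \<exists>k. birkhoff_sum T ?g k x > 0} = E"
  proof (intro subset_antisym subsetI)
    fix x assume "x \<in> {x \<in> space M. \<exists>k. birkhoff_sum T ?g k x > 0}"
    then show "x \<in> E"
      by (cases "x \<in> E") (auto simp: sum)
  next
    fix x assume x: "x \<in> E"
    then have sp: "x \<in> space M" using sets.sets_into_space[OF E(1)] by blast
    then show "x \<in> {x \<in> space M. \<exists>k. birkhoff_sum T ?g k x > 0}"
      using pos[OF x] x by (auto simp: sum[OF sp])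
  qed
  then have "0 \<le> (\<integral>x. indicator E x * ?g x \<partial>M)"
    using maximal_ergodic_inequality[OF T int] by simp
  also have "(\<lambda>x. indicator E x * ?g x) = ?g"
    by (auto simp: indicator_def)
  finally show ?thesis .
qed

text \<open>
  Chosen because its invariance under \<open>T\<close> is immediate, without exceptional null
  sets: passing from \<open>x\<close> to \<open>T x\<close> changes the partial sums by a single
  term. The event \<open>unbounded_sums T (\<lambda>x. f x - b)\<close> contains every point at
  which the averages of \<open>f\<close> frequently exceed a number larger than \<open>b\<close>.
\<close>

definition unbounded_sums :: "('a \<Rightarrow> 'a) \<Rightarrow> ('a \<Rightarrow> real) \<Rightarrow> 'a \<Rightarrow> bool" where
  "unbounded_sums T g x \<longleftrightarrow> (\<forall>K::nat. \<exists>n. birkhoff_sum T g n x > real K)"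

lemma unbounded_sums_invariant: "unbounded_sums T g (T x) \<longleftrightarrow> unbounded_sums T g x"
proof
  assume L: "unbounded_sums T g (T x)"
  show "unbounded_sums T g x"
    unfolding unbounded_sums_def
  proof
    fix K :: nat
    obtain n where "birkhoff_sum T g n (T x) > real (nat \<lceil>real K + \<bar>g x\<bar>\<rceil>)"
      using L unfolding unbounded_sums_def by blast
    then have "birkhoff_sum T g (Suc n) x > real K"
      unfolding birkhoff_sum_Suc by linarith
    then show "\<exists>n. birkhoff_sum T g n x > real K" ..
  qed
next
  assume R: "unbounded_sums T g x"
  show "unbounded_sums T g (T x)"
    unfolding unbounded_sums_def
  proof
    fix K :: nat
    obtain n where n: "birkhoff_sum T g n x > real (nat \<lceil>real K + \<bar>g x\<bar>\<rceil>)"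
      using R unfolding unbounded_sums_def by blast
    then have "n \<noteq> 0"
      by (intro notI) simp
    then obtain n' where "n = Suc n'" by (cases n) auto
    then have "g x + birkhoff_sum T g n' (T x) > real (nat \<lceil>real K + \<bar>g x\<bar>\<rceil>)"
      using n by (simp only: birkhoff_sum_Suc)
    then have "birkhoff_sum T g n' (T x) > real K"
      by linarith
    then show "\<exists>n. birkhoff_sum T g n (T x) > real K" ..
  qed
qed

lemma unbounded_sums_pos: "unbounded_sums T g x \<Longrightarrow> \<exists>k. birkhoff_sum T g k x > 0"
  unfolding unbounded_sums_def by (metis of_nat_0)

text \<open>
  The set where both sums are unbounded is invariant. The maximal inequality on it, applied to
  \<open>f - b\<close> and to \<open>a - f\<close>, shows after addition that \<open>a - b\<close>
  times its probability is not negative.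
\<close>

lemma (in prob_space) no_oscillation:
  assumes T: "measure_preserving M T" and f: "integrable M f" and ab: "a < b"
  shows "AE x in M. \<not> (unbounded_sums T (\<lambda>x. f x - b) x \<and> unbounded_sums T (\<lambda>x. a - f x) x)"
proof -
  let ?g1 = "\<lambda>x. f x - b" and ?g2 = "\<lambda>x. a - f x"
  define E where "E = {x \<in> space M. unbounded_sums T ?g1 x \<and> unbounded_sums T ?g2 x}"
  have int: "integrable M ?g1" "integrable M ?g2" using f by auto
  note [measurable] = borel_measurable_integrable[OF birkhoff_sum_integrable[OF T int(1)]]
    borel_measurable_integrable[OF birkhoff_sum_integrable[OF T int(2)]]
  have E: "E \<in> sets M" unfolding E_def unbounded_sums_def by measurable
  have inv: "T x \<in> E \<longleftrightarrow> x \<in> E" if "x \<in> space M" for x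
    using that measurable_space[OF measure_preserving_measurable[OF T] that]
    by (simp add: E_def unbounded_sums_invariant)
  have "0 \<le> (\<integral>x. indicator E x * ?g1 x \<partial>M)"
    by (rule maximal_inequality_invariant_set[OF T int(1) E inv])
       (auto simp: E_def intro: unbounded_sums_pos)
  moreover have "0 \<le> (\<integral>x. indicator E x * ?g2 x \<partial>M)"
    by (rule maximal_inequality_invariant_set[OF T int(2) E inv])
       (auto simp: E_def intro: unbounded_sums_pos)
  ultimately have "0 \<le> (\<integral>x. indicator E x * ?g1 x \<partial>M) + (\<integral>x. indicator E x * ?g2 x \<partial>M)"
    by simp
  also have "\<dots> = (\<integral>x. indicator E x * ?g1 x + indicator E x * ?g2 x \<partial>M)"
    using integrable_mult_indicator[OF E int(1)] integrable_mult_indicator[OF E int(2)]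
    by (simp add: Bochner_Integration.integral_add)
  also have "\<dots> = (\<integral>x. (a - b) * indicator E x \<partial>M)"
    by (rule Bochner_Integration.integral_cong) (auto simp: algebra_simps)
  also have "\<dots> = (a - b) * prob E"
    using E by simp
  finally have "prob E \<le> 0" using ab
    by (simp add: zero_le_mult_iff)
  then have "prob E = 0"
    using measure_nonneg[of M E] by linarith
  then have "E \<in> null_sets M" using E
    by (auto simp: emeasure_eq_measure)
  then show ?thesis
    by (rule AE_I'[OF _ subsetI]) (auto simp: E_def)
qed

lemma unbounded_sums_if_frequently_avg:
  assumes "\<exists>\<^sub>F n in sequentially. birkhoff_avg T n f x > c" "b < c"
  shows "unbounded_sums T (\<lambda>x. f x - b) x"
  unfolding unbounded_sums_def
proof
  fix K :: nat
  have "eventually (\<lambda>n. n \<ge> 1 \<and> real n * (c - b) > real K) sequentially"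
  proof -
    have "filterlim (\<lambda>n. (c - b) * real n) at_top sequentially"
      by (rule filterlim_tendsto_pos_mult_at_top[OF tendsto_const _ filterlim_real_sequentially])
         (use assms(2) in simp)
    then have "eventually (\<lambda>n. real n * (c - b) > real K) sequentially"
      unfolding filterlim_at_top_dense by (simp add: mult.commute)
    then show ?thesis using eventually_ge_at_top[of 1] by eventually_elim auto
  qed
  then have "\<exists>\<^sub>F n in sequentially. birkhoff_avg T n f x > c \<and> n \<ge> 1 \<and> real n * (c - b) > real K"
    using assms(1) frequently_eventually_frequently by fast
  then obtain n where n: "birkhoff_avg T n f x > c" "n \<ge> 1" "real n * (c - b) > real K"
    by (auto dest: frequently_ex)
  have "birkhoff_sum T (\<lambda>x. f x - b) n x = birkhoff_sum T f n x - real n * b"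
    by (simp add: birkhoff_sum_def sum_subtractf)
  moreover have "birkhoff_sum T f n x > c * real n"
    using n(1,2) by (simp add: birkhoff_avg_def field_simps)
  ultimately have "birkhoff_sum T (\<lambda>x. f x - b) n x > real K"
    using n(3) by (simp add: algebra_simps)
  then show "\<exists>n. birkhoff_sum T (\<lambda>x. f x - b) n x > real K" ..
qed

lemma convergent_if_no_oscillation:
  fixes u :: "nat \<Rightarrow> real"
  assumes bdd: "\<And>n. \<bar>u n\<bar> \<le> B"
    and osc: "\<And>a b. a \<in> \<rat> \<Longrightarrow> b \<in> \<rat> \<Longrightarrow> a < b \<Longrightarrow>
      \<not> ((\<exists>\<^sub>F n in sequentially. u n > b) \<and> (\<exists>\<^sub>F n in sequentially. u n < a))"
  shows "convergent u"
proof (rule ccontr)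
  assume nc: "\<not> convergent u"
  let ?U = "limsup (\<lambda>n. ereal (u n))" and ?L = "liminf (\<lambda>n. ereal (u n))"
  have le: "?L \<le> ?U" by (rule Liminf_le_Limsup) simp
  have "?L \<noteq> ?U"
  proof
    assume eq: "?L = ?U"
    have "?U \<le> ereal B" "ereal (- B) \<le> ?L"
    proof -
      have "u n \<le> B" "- B \<le> u n" for n
        using bdd[of n] by linarith+
      then show "?U \<le> ereal B" "ereal (- B) \<le> ?L"
        by (auto intro!: Limsup_bounded Liminf_bounded always_eventually)
    qed
    then obtain l where l: "?U = ereal l"
      using eq by (cases ?U) auto
    have "(\<lambda>n. ereal (u n)) \<longlonglongrightarrow> ereal l"
      unfolding tendsto_iff_Liminf_eq_Limsup[OF sequentially_bot] using eq l by simp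
    then show False using nc by (auto simp: convergent_def)
  qed
  with le have "?L < ?U" by simp
  then obtain r where r: "?L < ereal r" "ereal r < ?U"
    using ereal_dense2 by blast
  obtain s where s: "ereal r < ereal s" "ereal s < ?U"
    using ereal_dense2[OF r(2)] by blast
  obtain a where a: "a \<in> \<rat>" "r < a" "a < (r + s) / 2"
    using Rats_dense_in_real[of r "(r + s) / 2"] s(1) by auto
  obtain b where b: "b \<in> \<rat>" "(r + s) / 2 < b" "b < s"
    using Rats_dense_in_real[of "(r + s) / 2" s] s(1) by auto
  have "\<exists>\<^sub>F n in sequentially. u n > b"
  proof (rule ccontr)
    assume "\<not> ?thesis"
    then have "eventually (\<lambda>n. ereal (u n) \<le> ereal b) sequentially"
      by (simp add: not_frequently not_less)
    then have "?U \<le> ereal b" by (rule Limsup_bounded)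
    moreover have "ereal b < ereal s" using b(3) by simp
    ultimately show False using s(2) by (meson leD order.strict_trans1 less_trans)
  qed
  moreover have "\<exists>\<^sub>F n in sequentially. u n < a"
  proof (rule ccontr)
    assume "\<not> ?thesis"
    then have "eventually (\<lambda>n. ereal a \<le> ereal (u n)) sequentially"
      by (simp add: not_frequently not_less)
    then have "ereal a \<le> ?L" by (rule Liminf_bounded)
    moreover have "ereal r < ereal a" using a(2) by simp
    ultimately show False using r(1) by (meson leD order.strict_trans2 less_trans)
  qed
  ultimately show False using osc[OF a(1) b(1)] a(3) b(2) by auto
qed

section \<open>Variables with moments of all orders and the ergodic theorem\<close>

lemma all_momentsD:
  assumes "all_moments M f"
  shows "f \<in> borel_measurable M" "integrable M (\<lambda>x. \<bar>f x\<bar> ^ p)"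
  using assms by (auto simp: all_moments_def)

lemma all_moments_integrable:
  assumes "all_moments M f" shows "integrable M f"
  using all_momentsD(2)[OF assms, of 1] all_momentsD(1)[OF assms] by (simp add: integrable_abs_iff)

lemma all_moments_bound:
  assumes "all_moments M h" "g \<in> borel_measurable M" "AE x in M. \<bar>g x\<bar> \<le> h x"
  shows "all_moments M g"
  unfolding all_moments_def
proof (intro conjI allI assms(2))
  fix p :: nat
  note [measurable] = assms(2)
  show "integrable M (\<lambda>x. \<bar>g x\<bar> ^ p)"
  proof (rule Bochner_Integration.integrable_bound[OF all_momentsD(2)[OF assms(1), of p]])
    show "AE x in M. norm (\<bar>g x\<bar> ^ p) \<le> norm (\<bar>h x\<bar> ^ p)"
      using assms(3) by eventually_elim (auto intro!: power_mono)
  qed measurable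
qed

lemma power_add_le:
  fixes a b :: real
  assumes "0 \<le> a" "0 \<le> b"
  shows "(a + b) ^ p \<le> 2 ^ p * (a ^ p + b ^ p)"
proof -
  have "(a + b) ^ p \<le> (2 * max a b) ^ p"
    using assms by (intro power_mono) auto
  also have "\<dots> = 2 ^ p * max a b ^ p" by (simp add: power_mult_distrib)
  also have "max a b ^ p \<le> a ^ p + b ^ p"
    using assms by (auto simp: max_def)
  finally show ?thesis by simp
qed

lemma all_moments_add:
  assumes "all_moments M f" "all_moments M g"
  shows "all_moments M (\<lambda>x. f x + g x)"
  unfolding all_moments_def
proof (intro conjI allI)
  note [measurable] = all_momentsD(1)[OF assms(1)] all_momentsD(1)[OF assms(2)]
  show "(\<lambda>x. f x + g x) \<in> borel_measurable M" by measurable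
  fix p :: nat
  show "integrable M (\<lambda>x. \<bar>f x + g x\<bar> ^ p)"
  proof (rule Bochner_Integration.integrable_bound)
    show "integrable M (\<lambda>x. 2 ^ p * (\<bar>f x\<bar> ^ p + \<bar>g x\<bar> ^ p))"
      using all_momentsD(2)[OF assms(1)] all_momentsD(2)[OF assms(2)] by auto
    have "\<bar>f x + g x\<bar> ^ p \<le> 2 ^ p * (\<bar>f x\<bar> ^ p + \<bar>g x\<bar> ^ p)" for x
    proof -
      have "\<bar>f x + g x\<bar> ^ p \<le> (\<bar>f x\<bar> + \<bar>g x\<bar>) ^ p"
        by (intro power_mono) auto
      also have "\<dots> \<le> 2 ^ p * (\<bar>f x\<bar> ^ p + \<bar>g x\<bar> ^ p)"
        by (rule power_add_le) auto
      finally show ?thesis .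
    qed
    then show "AE x in M. norm (\<bar>f x + g x\<bar> ^ p) \<le> norm (2 ^ p * (\<bar>f x\<bar> ^ p + \<bar>g x\<bar> ^ p))"
      by (intro AE_I2) simp
  qed measurable
qed

lemma all_moments_abs:
  assumes "all_moments M f" shows "all_moments M (\<lambda>x. \<bar>f x\<bar>)"
  using assms by (auto simp: all_moments_def)

lemma all_moments_power:
  assumes "all_moments M f" shows "all_moments M (\<lambda>x. f x ^ k)"
  using assms unfolding all_moments_def
  by (auto simp: power_abs[symmetric] power_mult[symmetric])

lemma all_moments_cmult:
  assumes "all_moments M f" shows "all_moments M (\<lambda>x. c * f x)"
  using assms unfolding all_moments_def
  by (auto simp: abs_mult power_mult_distrib)

lemma (in prob_space) all_moments_const: "all_moments M (\<lambda>x. c)"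
  by (auto simp: all_moments_def)

lemma (in prob_space) all_moments_sum:
  assumes "\<And>i. i \<in> I \<Longrightarrow> all_moments M (f i)"
  shows "all_moments M (\<lambda>x. \<Sum>i\<in>I. f i x)"
  using assms
proof (induction I rule: infinite_finite_induct)
  case (insert i I)
  then show ?case by (simp add: all_moments_add)
qed (auto intro: all_moments_const)

lemma all_moments_measure_preserving:
  assumes "measure_preserving M T" "all_moments M f"
  shows "all_moments M (\<lambda>x. f (T x))"
  using measure_preserving_integrable[OF assms(1)] assms(2)
    measurable_compose[OF measure_preserving_measurable[OF assms(1)]]
  by (auto simp: all_moments_def)

lemma birkhoff_avg_mono:
  assumes "\<And>i. f ((T ^^ i) x) \<le> g ((T ^^ i) x)"
  shows "birkhoff_avg T n f x \<le> birkhoff_avg T n g x"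
  unfolding birkhoff_avg_def birkhoff_sum_def using assms
  by (intro divide_right_mono sum_mono) auto

lemma birkhoff_avg_abs_le:
  "\<bar>birkhoff_avg T n f x\<bar> \<le> birkhoff_avg T n (\<lambda>x. \<bar>f x\<bar>) x"
  unfolding birkhoff_avg_def birkhoff_sum_def
  by (simp add: abs_divide divide_right_mono sum_abs)

lemma birkhoff_avg_nonneg:
  "(\<And>x. 0 \<le> f x) \<Longrightarrow> 0 \<le> birkhoff_avg T n f x"
  unfolding birkhoff_avg_def birkhoff_sum_def by (simp add: sum_nonneg)

text \<open>
  Jensen's inequality for a finite average.
\<close>

lemma birkhoff_avg_power_le:
  assumes "\<And>x. 0 \<le> f x" "n \<ge> 1"
  shows "birkhoff_avg T n f x ^ p \<le> birkhoff_avg T n (\<lambda>x. f x ^ p) x"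
proof -
  have conv: "convex_on {0..} (\<lambda>x::real. x ^ p)"
    by (cases "even p") (auto intro: convex_on_subset[OF convex_power_even] convex_power_odd)
  have "(\<Sum>i\<in>{..<n}. (1 / real n) *\<^sub>R f ((T ^^ i) x)) ^ p
      \<le> (\<Sum>i\<in>{..<n}. (1 / real n) * f ((T ^^ i) x) ^ p)"
    using assms by (intro convex_on_sum[OF _ _ conv]) (auto simp: lessThan_empty_iff)
  then show ?thesis
    by (simp add: birkhoff_avg_def birkhoff_sum_def sum_divide_distrib)
qed

text \<open>
  The maximal inequality for \<open>f - c\<close>.
\<close>

lemma (in prob_space) weak_type_inequality:
  assumes T: "measure_preserving M T" and f: "integrable M f" "\<And>x. 0 \<le> f x" and c: "c > 0"
  shows "prob {x \<in> space M. \<exists>n. birkhoff_avg T n f x > c} \<le> expectation f / c"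
proof -
  let ?g = "\<lambda>x. f x - c"
  define E where "E = {x \<in> space M. \<exists>n. birkhoff_sum T ?g n x > 0}"
  have g: "integrable M ?g" using f by auto
  note [measurable] = borel_measurable_integrable[OF birkhoff_sum_integrable[OF T g]]
  have E: "E \<in> sets M" unfolding E_def by measurable
  have iE: "integrable M (\<lambda>x. c * indicat_real E x)"
    using E by (intro integrable_mult_right) (auto simp: less_top[symmetric])
  have E_eq: "{x \<in> space M. \<exists>n. birkhoff_avg T n f x > c} \<subseteq> E"
  proof -
    have "birkhoff_sum T ?g n x > 0" if "birkhoff_avg T n f x > c" for n x
    proof -
      have "n \<noteq> 0" using that c by (intro notI) (simp add: birkhoff_avg_def)
      then show ?thesis
        using that by (simp add: birkhoff_avg_def birkhoff_sum_def sum_subtractf field_simps)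
    qed
    then show ?thesis by (auto simp: E_def)
  qed
  have "0 \<le> (\<integral>x. indicator E x * ?g x \<partial>M)"
    unfolding E_def by (rule maximal_ergodic_inequality[OF T g])
  also have "\<dots> \<le> (\<integral>x. f x - c * indicator E x \<partial>M)"
  proof (rule integral_mono)
    show "integrable M (\<lambda>x. indicator E x * ?g x)"
      using integrable_mult_indicator[OF E g] by simp
    show "integrable M (\<lambda>x. f x - c * indicator E x)"
      using f(1) iE by (rule Bochner_Integration.integrable_diff)
    show "indicator E x * ?g x \<le> f x - c * indicator E x" for x
      using f(2)[of x] by (simp add: indicator_def)
  qed
  also have "\<dots> = expectation f - c * prob E"
    using E by (subst Bochner_Integration.integral_diff[OF f(1) iE]) simp
  finally have "prob E \<le> expectation f / c"
    using c by (simp add: field_simps)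
  then show ?thesis
    using finite_measure_mono[OF E_eq E] by linarith
qed

text \<open>
  Absolute values are averaged, so that the maximal function also bounds the averages of every
  function dominated by \<open>f\<close>.
\<close>

definition maximal_fun :: "('a \<Rightarrow> 'a) \<Rightarrow> ('a \<Rightarrow> real) \<Rightarrow> 'a \<Rightarrow> ennreal" where
  "maximal_fun T f x = (SUP n. ennreal (birkhoff_avg T n (\<lambda>x. \<bar>f x\<bar>) x))"

lemma maximal_fun_measurable:
  assumes "T \<in> measurable M M" "f \<in> borel_measurable M"
  shows "maximal_fun T f \<in> borel_measurable M"
proof -
  have [measurable]: "birkhoff_avg T n (\<lambda>x. \<bar>f x\<bar>) \<in> borel_measurable M" for n
    using assms by (intro birkhoff_avg_measurable) auto
  show ?thesis unfolding maximal_fun_def by measurable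
qed

text \<open>
  Bounds the mean of a variable by the sum of its tail probabilities at the natural numbers.
\<close>

lemma ennreal_le_count_levels:
  "(x::ennreal) \<le> (\<Sum>k. if of_nat k < x then 1 else 0)"
proof (cases x)
  case top
  have "\<not> (\<Sum>k. if of_nat k < x then 1 else 0 :: ennreal) < \<top>"
  proof
    assume "(\<Sum>k. if of_nat k < x then 1 else 0 :: ennreal) < \<top>"
    then obtain n where "(\<Sum>k. if of_nat k < x then 1 else 0 :: ennreal) < of_nat n"
      using ennreal_Ex_less_of_nat by auto
    moreover have "(of_nat n :: ennreal) = (\<Sum>k<n. if of_nat k < x then 1 else 0)"
      using top by (simp add: of_nat_less_top)
    moreover have "(\<Sum>k<n. if of_nat k < x then 1 else 0 :: ennreal)
        \<le> (\<Sum>k. if of_nat k < x then 1 else 0)"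
      by (rule sum_le_suminf) auto
    ultimately show False by simp
  qed
  then show ?thesis by (simp add: not_less top_unique)
next
  case (real r)
  have "x \<le> of_nat (nat \<lceil>r\<rceil>)"
    using real by (simp add: ennreal_of_nat_eq_real_of_nat)
  also have "\<dots> = (\<Sum>k<nat \<lceil>r\<rceil>. if of_nat k < x then 1 else 0)"
  proof -
    have "of_nat k < x" if "k < nat \<lceil>r\<rceil>" for k
      using that real by (simp add: ennreal_of_nat_eq_real_of_nat ennreal_less_iff) linarith
    then show ?thesis by simp
  qed
  also have "\<dots> \<le> (\<Sum>k. if of_nat k < x then 1 else 0)"
    by (rule sum_le_suminf) auto
  finally show ?thesis .
qed

text \<open>
  If the average of \<open>\<bar>f\<bar>\<close> exceeds \<open>k\<close>, the average of
  \<open>f\<^sup>2\<close> exceeds \<open>k\<^sup>2\<close> by Jensen's inequality. The weak type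
  inequality for \<open>f\<^sup>2\<close> thus gives tail probabilities of order \<open>1 /
  k\<^sup>2\<close>, which are summable.
\<close>

lemma (in prob_space) maximal_fun_nn_integral_finite:
  assumes T: "measure_preserving M T" and f: "all_moments M f"
  shows "(\<integral>\<^sup>+x. maximal_fun T f x \<partial>M) < \<infinity>"
proof -
  note [measurable] = maximal_fun_measurable[OF measure_preserving_measurable[OF T] all_momentsD(1)[OF f]]
  let ?C = "expectation (\<lambda>x. \<bar>f x\<bar> ^ 2)"
  have C: "0 \<le> ?C" by (rule Bochner_Integration.integral_nonneg) simp
  define P where "P k = emeasure M {x \<in> space M. of_nat k < maximal_fun T f x}" for k :: nat
  have P_le: "P (Suc k) \<le> ennreal (?C / (real (Suc k))\<^sup>2)" for k
  proof -
    let ?A = "{x \<in> space M. of_nat (Suc k) < maximal_fun T f x}"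
    let ?B = "{x \<in> space M. \<exists>n. birkhoff_avg T n (\<lambda>x. \<bar>f x\<bar> ^ 2) x > (real (Suc k))\<^sup>2}"
    have [measurable]: "birkhoff_avg T n (\<lambda>x. \<bar>f x\<bar> ^ 2) \<in> borel_measurable M" for n
      using T f by (intro birkhoff_avg_measurable measure_preserving_measurable)
        (auto simp: all_moments_def)
    have "?A \<subseteq> ?B"
    proof
      fix x assume "x \<in> ?A"
      then obtain n where x: "x \<in> space M"
        and n: "of_nat (Suc k) < ennreal (birkhoff_avg T n (\<lambda>x. \<bar>f x\<bar>) x)"
        by (auto simp: maximal_fun_def less_SUP_iff)
      then have n': "real (Suc k) < birkhoff_avg T n (\<lambda>x. \<bar>f x\<bar>) x"
        unfolding ennreal_of_nat_eq_real_of_nat by (subst (asm) ennreal_less_iff) auto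
      then have "n \<ge> 1" by (cases n) (auto simp: birkhoff_avg_def)
      have "(real (Suc k))\<^sup>2 < birkhoff_avg T n (\<lambda>x. \<bar>f x\<bar>) x ^ 2"
        using n' by (intro power_strict_mono) auto
      also have "\<dots> \<le> birkhoff_avg T n (\<lambda>x. \<bar>f x\<bar> ^ 2) x"
        using \<open>n \<ge> 1\<close> by (intro birkhoff_avg_power_le) auto
      finally show "x \<in> ?B" using x by blast
    qed
    then have "P (Suc k) \<le> emeasure M ?B"
      unfolding P_def by (rule emeasure_mono) measurable
    also have "\<dots> = ennreal (prob ?B)" by (simp add: emeasure_eq_measure)
    also have "\<dots> \<le> ennreal (?C / (real (Suc k))\<^sup>2)"
      by (intro ennreal_leI weak_type_inequality[OF T] all_momentsD(2)[OF f]) auto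
    finally show ?thesis .
  qed
  have "(\<integral>\<^sup>+x. maximal_fun T f x \<partial>M)
      \<le> (\<integral>\<^sup>+x. (\<Sum>k. if of_nat k < maximal_fun T f x then 1 else 0) \<partial>M)"
    by (intro nn_integral_mono ennreal_le_count_levels)
  also have "\<dots> = (\<Sum>k. \<integral>\<^sup>+x. (if of_nat k < maximal_fun T f x then 1 else 0) \<partial>M)"
    by (rule nn_integral_suminf) measurable
  also have "\<dots> = (\<Sum>k. P k)"
  proof (rule suminf_cong)
    fix k :: nat
    have "(\<integral>\<^sup>+x. (if of_nat k < maximal_fun T f x then 1 else 0) \<partial>M)
        = (\<integral>\<^sup>+x. indicator {x \<in> space M. of_nat k < maximal_fun T f x} x \<partial>M)"
      by (rule nn_integral_cong) (auto simp: indicator_def)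
    also have "\<dots> = P k" unfolding P_def by (rule nn_integral_indicator) measurable
    finally show "(\<integral>\<^sup>+x. (if of_nat k < maximal_fun T f x then 1 else 0) \<partial>M) = P k" .
  qed
  also have "\<dots> = P 0 + (\<Sum>k. P (Suc k))"
    using suminf_offset[of P 1] by simp
  also have "\<dots> \<le> 1 + (\<Sum>k. ennreal (?C / (real (Suc k))\<^sup>2))"
    by (intro add_mono suminf_le P_le) (auto simp: P_def emeasure_le_1)
  also have "\<dots> < \<infinity>"
  proof -
    have "summable (\<lambda>k. ?C / (real (Suc k))\<^sup>2)"
      using summable_mult[OF inverse_power_summable[of 2, where 'a = real], of ?C]
      by (subst summable_Suc_iff) (simp add: divide_inverse)
    then show ?thesis using C by (subst suminf_ennreal2) auto
  qed
  finally show ?thesis .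
qed

text \<open>
  Jensen's inequality, passed to the supremum. It reduces the higher moments of the maximal
  function to the first moment of the maximal function of a power.
\<close>

lemma maximal_fun_power_le:
  assumes "p \<ge> 1"
  shows "ennreal (enn2real (maximal_fun T f x) ^ p) \<le> maximal_fun T (\<lambda>x. \<bar>f x\<bar> ^ p) x"
proof (cases "maximal_fun T (\<lambda>x. \<bar>f x\<bar> ^ p) x")
  case (real c)
  have le: "birkhoff_avg T n (\<lambda>x. \<bar>f x\<bar>) x \<le> root p c" for n
  proof (cases "n = 0")
    case True
    then show ?thesis using real by (simp add: birkhoff_avg_def real_root_ge_zero)
  next
    case False
    have "ennreal (birkhoff_avg T n (\<lambda>x. \<bar>f x\<bar> ^ p) x) \<le> ennreal c"
      unfolding real(2)[symmetric] maximal_fun_def by (rule SUP_upper2[of n]) auto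
    then have "birkhoff_avg T n (\<lambda>x. \<bar>f x\<bar> ^ p) x \<le> c"
      using real(1) by (simp add: ennreal_le_iff)
    moreover have "birkhoff_avg T n (\<lambda>x. \<bar>f x\<bar>) x ^ p \<le> birkhoff_avg T n (\<lambda>x. \<bar>f x\<bar> ^ p) x"
      using False by (intro birkhoff_avg_power_le) auto
    ultimately have "birkhoff_avg T n (\<lambda>x. \<bar>f x\<bar>) x ^ p \<le> c" by linarith
    then have "root p (birkhoff_avg T n (\<lambda>x. \<bar>f x\<bar>) x ^ p) \<le> root p c"
      using assms by (intro real_root_le_mono) auto
    then show ?thesis
      using assms by (simp add: real_root_power_cancel birkhoff_avg_nonneg)
  qed
  have "maximal_fun T f x \<le> ennreal (root p c)"
    unfolding maximal_fun_def by (intro SUP_least ennreal_leI le)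
  then have "enn2real (maximal_fun T f x) \<le> root p c"
    using real(1) by (intro enn2real_leI) (auto simp: real_root_ge_zero)
  then have "enn2real (maximal_fun T f x) ^ p \<le> root p c ^ p"
    by (intro power_mono) auto
  also have "\<dots> = c" using assms real(1) by simp
  finally show ?thesis using real by (simp add: ennreal_leI)
qed simp

lemma (in prob_space) maximal_fun_all_moments:
  assumes T: "measure_preserving M T" and f: "all_moments M f"
  shows "all_moments M (\<lambda>x. enn2real (maximal_fun T f x))"
    and "AE x in M. \<forall>n. \<bar>birkhoff_avg T n f x\<bar> \<le> enn2real (maximal_fun T f x)"
proof -
  have m: "maximal_fun T g \<in> borel_measurable M" if "all_moments M g" for g
    using maximal_fun_measurable[OF measure_preserving_measurable[OF T] all_momentsD(1)[OF that]] .
  note [measurable] = m[OF f]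
  show "all_moments M (\<lambda>x. enn2real (maximal_fun T f x))"
    unfolding all_moments_def
  proof (intro conjI allI)
    fix p :: nat
    show "integrable M (\<lambda>x. \<bar>enn2real (maximal_fun T f x)\<bar> ^ p)"
    proof (cases "p = 0")
      case False
      have "(\<integral>\<^sup>+x. ennreal (enn2real (maximal_fun T f x) ^ p) \<partial>M)
          \<le> (\<integral>\<^sup>+x. maximal_fun T (\<lambda>x. \<bar>f x\<bar> ^ p) x \<partial>M)"
        using False by (intro nn_integral_mono maximal_fun_power_le) auto
      also have "\<dots> < \<infinity>"
        by (intro maximal_fun_nn_integral_finite T all_moments_power all_moments_abs f)
      finally show ?thesis
        by (intro integrableI_bounded) auto
    qed simp
  qed measurable
  have "AE x in M. maximal_fun T f x \<noteq> \<infinity>"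
    using maximal_fun_nn_integral_finite[OF T f] by (intro nn_integral_noteq_infinite) auto
  then show "AE x in M. \<forall>n. \<bar>birkhoff_avg T n f x\<bar> \<le> enn2real (maximal_fun T f x)"
  proof eventually_elim
    case (elim x)
    show ?case
    proof
      fix n
      have "ennreal (birkhoff_avg T n (\<lambda>x. \<bar>f x\<bar>) x) \<le> maximal_fun T f x"
        unfolding maximal_fun_def by (rule SUP_upper) simp
      then have "birkhoff_avg T n (\<lambda>x. \<bar>f x\<bar>) x \<le> enn2real (maximal_fun T f x)"
        using elim by (cases "maximal_fun T f x") (auto simp: ennreal_le_iff)
      then show "\<bar>birkhoff_avg T n f x\<bar> \<le> enn2real (maximal_fun T f x)"
        using birkhoff_avg_abs_le[of T n f x] by linarith
    qed
  qed
qed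

text \<open>
  The mode of convergence that survives averaging over one more direction: almost sure convergence
  together with a majorant that has all moments.
\<close>

definition dominated_limit :: "'a measure \<Rightarrow> (nat \<Rightarrow> 'a \<Rightarrow> real) \<Rightarrow> ('a \<Rightarrow> real) \<Rightarrow> bool" where
  "dominated_limit M G g \<longleftrightarrow> (\<forall>n. G n \<in> borel_measurable M) \<and> all_moments M g \<and>
     (\<exists>h. all_moments M h \<and> (AE x in M. \<forall>n. \<bar>G n x\<bar> \<le> h x)) \<and>
     (AE x in M. (\<lambda>n. G n x) \<longlonglongrightarrow> g x)"

lemma dominated_limit_integral:
  assumes "dominated_limit M G g"
  shows "(\<lambda>n. \<integral>x. G n x \<partial>M) \<longlonglongrightarrow> (\<integral>x. g x \<partial>M)"
proof -
  obtain h where h: "all_moments M h" "AE x in M. \<forall>n. \<bar>G n x\<bar> \<le> h x"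
    using assms by (auto simp: dominated_limit_def)
  show ?thesis
    using assms h
    by (intro integral_dominated_convergence[where w = h])
       (auto simp: dominated_limit_def all_moments_integrable all_momentsD(1) AE_all_countable)
qed

text \<open>
  The averages are bounded by the maximal function, and for rational \<open>a < b\<close> they do
  not oscillate across \<open>[a, b]\<close>; hence they converge. The maximal function also
  dominates, which identifies the mean.
\<close>

lemma (in prob_space) birkhoff_theorem:
  assumes T: "measure_preserving M T" and f: "all_moments M f"
  shows "\<exists>g. dominated_limit M (\<lambda>n. birkhoff_avg T n f) g \<and> expectation g = expectation f"
proof -
  define h where "h x = enn2real (maximal_fun T f x)" for x
  have h: "all_moments M h" "AE x in M. \<forall>n. \<bar>birkhoff_avg T n f x\<bar> \<le> h x"
    unfolding h_def using maximal_fun_all_moments[OF T f] by auto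
  have [measurable]: "birkhoff_avg T n f \<in> borel_measurable M" for n
    by (rule birkhoff_avg_measurable[OF measure_preserving_measurable[OF T] all_momentsD(1)[OF f]])
  note fi = all_moments_integrable[OF f]
  have osc: "AE x in M. \<forall>a\<in>\<rat>. \<forall>b\<in>\<rat>. a < b \<longrightarrow>
      \<not> (unbounded_sums T (\<lambda>x. f x - b) x \<and> unbounded_sums T (\<lambda>x. a - f x) x)"
    using no_oscillation[OF T fi]
    by (intro AE_ball_countable[THEN iffD2] ballI countable_rat) (auto intro: AE_I2)
  have conv: "AE x in M. convergent (\<lambda>n. birkhoff_avg T n f x)"
    using h(2) osc
  proof eventually_elim
    case (elim x)
    show ?case
    proof (rule convergent_if_no_oscillation[where B = "h x"])
      show "\<bar>birkhoff_avg T n f x\<bar> \<le> h x" for n using elim by blast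
    next
      fix a b :: real assume ab: "a \<in> \<rat>" "b \<in> \<rat>" "a < b"
      obtain a' where a': "a' \<in> \<rat>" "a < a'" "a' < (a + b) / 2"
        using Rats_dense_in_real[of a "(a + b) / 2"] ab by auto
      obtain b' where b': "b' \<in> \<rat>" "(a + b) / 2 < b'" "b' < b"
        using Rats_dense_in_real[of "(a + b) / 2" b] ab by auto
      show "\<not> ((\<exists>\<^sub>F n in sequentially. b < birkhoff_avg T n f x) \<and>
               (\<exists>\<^sub>F n in sequentially. birkhoff_avg T n f x < a))"
      proof
        assume A: "(\<exists>\<^sub>F n in sequentially. b < birkhoff_avg T n f x) \<and>
               (\<exists>\<^sub>F n in sequentially. birkhoff_avg T n f x < a)"
        have "unbounded_sums T (\<lambda>x. f x - b') x"
          using A b' by (intro unbounded_sums_if_frequently_avg[of b]) auto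
        moreover have "unbounded_sums T (\<lambda>x. - f x - (- a')) x"
        proof (rule unbounded_sums_if_frequently_avg[of "- a"])
          have "birkhoff_avg T n (\<lambda>x. - f x) x = - birkhoff_avg T n f x" for n
            by (simp add: birkhoff_avg_def birkhoff_sum_def sum_negf)
          then show "\<exists>\<^sub>F n in sequentially. - a < birkhoff_avg T n (\<lambda>x. - f x) x"
            using A by simp
        qed (use a' in auto)
        then have "unbounded_sums T (\<lambda>x. a' - f x) x" by (simp add: add.commute)
        moreover have "a' < b'" using a' b' by linarith
        ultimately show False using elim(2) a'(1) b'(1) by blast
      qed
    qed
  qed
  define g where "g x = lim (\<lambda>n. birkhoff_avg T n f x)" for x
  have [measurable]: "g \<in> borel_measurable M"
    unfolding g_def by measurable
  have lim: "AE x in M. (\<lambda>n. birkhoff_avg T n f x) \<longlonglongrightarrow> g x"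
    using conv by eventually_elim (simp add: g_def convergent_LIMSEQ_iff)
  have "AE x in M. \<bar>g x\<bar> \<le> h x"
    using lim h(2)
  proof eventually_elim
    case (elim x)
    then show ?case
      by (intro LIMSEQ_le_const2[OF tendsto_rabs[OF elim(1)]]) auto
  qed
  then have g: "all_moments M g"
    by (intro all_moments_bound[OF h(1)]) auto
  have dom: "dominated_limit M (\<lambda>n. birkhoff_avg T n f) g"
    using h lim g by (auto simp: dominated_limit_def)
  have "(\<lambda>n. expectation (birkhoff_avg T n f)) \<longlonglongrightarrow> expectation g"
    by (rule dominated_limit_integral[OF dom])
  moreover have "(\<lambda>n. expectation (birkhoff_avg T n f)) \<longlonglongrightarrow> expectation f"
    by (rule tendsto_eventually, rule eventually_sequentiallyI[of 1])
       (rule birkhoff_avg_integral[OF T fi])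
  ultimately have "expectation g = expectation f"
    by (rule LIMSEQ_unique)
  with dom show ?thesis by blast
qed

text \<open>
  Fatou's lemma: the lower limit of the sequence has integral zero.
\<close>

lemma AE_arbitrarily_small:
  fixes b :: "nat \<Rightarrow> 'a \<Rightarrow> real"
  assumes int: "\<And>K. integrable M (b K)" and nn: "\<And>K. AE x in M. 0 \<le> b K x"
    and lim: "(\<lambda>K. \<integral>x. b K x \<partial>M) \<longlonglongrightarrow> 0"
  shows "AE x in M. \<forall>e>0. \<forall>N. \<exists>K\<ge>N. b K x < e"
proof -
  have [measurable]: "b K \<in> borel_measurable M" for K using int by auto
  have "(\<integral>\<^sup>+x. liminf (\<lambda>K. ennreal (b K x)) \<partial>M) \<le> liminf (\<lambda>K. \<integral>\<^sup>+x. ennreal (b K x) \<partial>M)"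
    by (rule nn_integral_liminf) measurable
  also have "(\<lambda>K. \<integral>\<^sup>+x. ennreal (b K x) \<partial>M) = (\<lambda>K. ennreal (\<integral>x. b K x \<partial>M))"
    using nn_integral_eq_integral[OF int nn] by simp
  also have "liminf \<dots> = 0"
    using tendsto_ennrealI[OF lim] by (simp add: lim_imp_Liminf)
  finally have "(\<integral>\<^sup>+x. liminf (\<lambda>K. ennreal (b K x)) \<partial>M) = 0" by simp
  then have "AE x in M. liminf (\<lambda>K. ennreal (b K x)) = 0"
    by (subst (asm) nn_integral_0_iff_AE) auto
  then show ?thesis
  proof eventually_elim
    case (elim x)
    show ?case
    proof (intro allI impI)
      fix e :: real and N assume e: "e > 0"
      show "\<exists>K\<ge>N. b K x < e"
      proof (rule ccontr)
        assume "\<not> ?thesis"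
        then have "eventually (\<lambda>K. ennreal e \<le> ennreal (b K x)) sequentially"
          by (intro eventually_sequentiallyI[of N] ennreal_leI) (auto simp: not_less)
        then have "ennreal e \<le> liminf (\<lambda>K. ennreal (b K x))" by (rule Liminf_bounded)
        then show False using elim e by simp
      qed
    qed
  qed
qed

lemma AE_measure_preserving_all_orbit:
  assumes "measure_preserving M T" "AE x in M. \<forall>n. P n x"
  shows "AE x in M. \<forall>i n. P n ((T ^^ i) x)"
  using measure_preserving_AE_orbit[OF assms] by simp

text \<open>
  Replace \<open>G n\<close> by its limit \<open>g\<close>. The error is at most the average of
  \<open>d K\<close>, the supremum of the distances of \<open>G m\<close> to \<open>g\<close> over
  all \<open>m \<ge> K\<close>. For fixed \<open>K\<close> these averages converge, with a limit
  that has the same mean as \<open>d K\<close>. These means tend to zero, so almost every point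
  admits a \<open>K\<close> for which the limit is as small as desired.
\<close>

lemma (in prob_space) birkhoff_theorem_varying:
  assumes T: "measure_preserving M T" and G: "dominated_limit M G g"
  shows "\<exists>g'. dominated_limit M (\<lambda>n. birkhoff_avg T n (G n)) g' \<and> expectation g' = expectation g"
proof -
  note Tm = measure_preserving_measurable[OF T]
  have Gm [measurable]: "G n \<in> borel_measurable M" for n
    using G by (auto simp: dominated_limit_def)
  have g: "all_moments M g" and Glim: "AE x in M. (\<lambda>n. G n x) \<longlonglongrightarrow> g x"
    using G by (auto simp: dominated_limit_def)
  obtain h where h: "all_moments M h" and Gh: "AE x in M. \<forall>n. \<bar>G n x\<bar> \<le> h x"
    using G by (auto simp: dominated_limit_def)
  note [measurable] = all_momentsD(1)[OF g] all_momentsD(1)[OF h]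
  obtain g' where g': "dominated_limit M (\<lambda>n. birkhoff_avg T n g) g'" "expectation g' = expectation g"
    using birkhoff_theorem[OF T g] by blast
  obtain h' H where "dominated_limit M (\<lambda>n. birkhoff_avg T n h) h'"
    and H: "all_moments M H" "AE x in M. \<forall>n. \<bar>birkhoff_avg T n h x\<bar> \<le> H x"
    using birkhoff_theorem[OF T h] by (auto simp: dominated_limit_def)
  \<comment> \<open>The supremum is formed in \<open>ennreal\<close> because it may be infinite on a null set.\<close>
  define d where "d K x = enn2real (SUP m\<in>{K..}. ennreal \<bar>G m x - g x\<bar>)" for K x
  have [measurable]: "d K \<in> borel_measurable M" for K unfolding d_def by measurable
  have good: "AE x in M. (\<forall>n. \<bar>G n x\<bar> \<le> h x) \<and> (\<lambda>n. G n x) \<longlonglongrightarrow> g x"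
    using Gh Glim by eventually_elim auto
  have d_le: "d K x \<le> c" if "\<And>m. m \<ge> K \<Longrightarrow> \<bar>G m x - g x\<bar> \<le> c" "0 \<le> c" for K x c
    unfolding d_def using that
    by (intro enn2real_leI SUP_least ennreal_leI) auto
  have d_ge: "\<bar>G m x - g x\<bar> \<le> d K x" if "\<forall>n. \<bar>G n x\<bar> \<le> h x" "m \<ge> K" for K m x
  proof -
    have "(SUP m\<in>{K..}. ennreal \<bar>G m x - g x\<bar>) \<le> ennreal (h x + \<bar>g x\<bar>)"
    proof (intro SUP_least ennreal_leI)
      fix m show "\<bar>G m x - g x\<bar> \<le> h x + \<bar>g x\<bar>" using that(1)[rule_format, of m] by linarith
    qed
    then have "(SUP m\<in>{K..}. ennreal \<bar>G m x - g x\<bar>) < \<top>"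
      using le_less_trans by fastforce
    moreover have "ennreal \<bar>G m x - g x\<bar> \<le> (SUP m\<in>{K..}. ennreal \<bar>G m x - g x\<bar>)"
      using that(2) by (intro SUP_upper) auto
    ultimately show ?thesis
      unfolding d_def by (metis abs_ge_zero enn2real_ennreal enn2real_mono)
  qed
  have d_nn: "0 \<le> d K x" for K x unfolding d_def by simp
  have d_bd: "AE x in M. \<bar>d K x\<bar> \<le> h x + \<bar>g x\<bar>" for K
    using good
  proof eventually_elim
    case (elim x)
    have "d K x \<le> h x + \<bar>g x\<bar>"
    proof (rule d_le)
      fix m show "\<bar>G m x - g x\<bar> \<le> h x + \<bar>g x\<bar>" using elim[THEN conjunct1, rule_format, of m] by linarith
    next
      show "0 \<le> h x + \<bar>g x\<bar>" using elim[THEN conjunct1, rule_format, of 0] by linarith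
    qed
    then show ?case using d_nn[of K x] by simp
  qed
  have dm: "all_moments M (d K)" for K
    by (rule all_moments_bound[OF all_moments_add[OF h all_moments_abs[OF g]] _ d_bd]) measurable
  have "\<forall>K. \<exists>b. dominated_limit M (\<lambda>n. birkhoff_avg T n (d K)) b \<and> expectation b = expectation (d K)"
    using birkhoff_theorem[OF T dm] by blast
  then obtain b where b: "\<And>K. dominated_limit M (\<lambda>n. birkhoff_avg T n (d K)) (b K)"
      "\<And>K. expectation (b K) = expectation (d K)"
    by metis
  have blim: "AE x in M. (\<lambda>n. birkhoff_avg T n (d K) x) \<longlonglongrightarrow> b K x" for K
    using b(1) by (auto simp: dominated_limit_def)
  have dlim: "(\<lambda>K. expectation (d K)) \<longlonglongrightarrow> expectation (\<lambda>x. 0)"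
  proof (rule integral_dominated_convergence[where w = "\<lambda>x. h x + \<bar>g x\<bar>"])
    show "integrable M (\<lambda>x. h x + \<bar>g x\<bar>)"
      by (intro all_moments_integrable all_moments_add h all_moments_abs g)
    show "AE x in M. (\<lambda>K. d K x) \<longlonglongrightarrow> 0"
      using good
    proof eventually_elim
      case (elim x)
      show ?case
      proof (rule LIMSEQ_I)
        fix r :: real assume "0 < r"
        then obtain K0 where K0: "\<forall>n\<ge>K0. norm (G n x - g x) < r / 2"
          using LIMSEQ_D[OF elim[THEN conjunct2], of "r / 2"] by auto
        have "d K x \<le> r / 2" if "K \<ge> K0" for K
          using K0 that \<open>0 < r\<close> by (intro d_le) (auto intro: less_imp_le)
        then show "\<exists>no. \<forall>n\<ge>no. norm (d n x - 0) < r"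
        proof (intro exI allI impI)
          fix n assume "n \<ge> K0"
          then have "d n x \<le> r / 2" "0 \<le> d n x"
            using \<open>\<And>K. K \<ge> K0 \<Longrightarrow> d K x \<le> r / 2\<close> d_nn by auto
          then show "norm (d n x - 0) < r" using \<open>0 < r\<close> by simp
        qed
      qed
    qed
    show "AE x in M. norm (d K x) \<le> h x + \<bar>g x\<bar>" for K
      using d_bd[of K] by simp
  qed auto
  have small: "AE x in M. \<forall>e>0. \<forall>N. \<exists>K\<ge>N. b K x < e"
  proof (rule AE_arbitrarily_small)
    show "integrable M (b K)" for K
      using b(1)[of K] by (auto simp: dominated_limit_def intro: all_moments_integrable)
    show "AE x in M. 0 \<le> b K x" for K
      using blim[of K]
    proof eventually_elim
      case (elim x)
      then show ?case
        by (rule LIMSEQ_le_const) (auto intro: birkhoff_avg_nonneg d_nn)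
    qed
    show "(\<lambda>K. expectation (b K)) \<longlonglongrightarrow> 0" using dlim b(2) by simp
  qed
  have orbit: "AE x in M. \<forall>i n. \<bar>G n ((T ^^ i) x)\<bar> \<le> h ((T ^^ i) x)"
    by (rule AE_measure_preserving_all_orbit[OF T Gh])
  have "AE x in M. (\<lambda>n. birkhoff_avg T n g x) \<longlonglongrightarrow> g' x"
    using g'(1) by (auto simp: dominated_limit_def)
  moreover have "AE x in M. \<forall>K. (\<lambda>n. birkhoff_avg T n (d K) x) \<longlonglongrightarrow> b K x"
    unfolding AE_all_countable using blim by blast
  ultimately have lim: "AE x in M. (\<lambda>n. birkhoff_avg T n (G n) x) \<longlonglongrightarrow> g' x"
    using small orbit
  proof eventually_elim
    case (elim x)
    show ?case
    proof (rule LIMSEQ_I)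
      fix r :: real assume r: "0 < r"
      then obtain K where K: "b K x < r / 4"
        using elim(3)[rule_format, of "r/4" 0] by auto
      obtain N1 where N1: "\<forall>n\<ge>N1. norm (birkhoff_avg T n (d K) x - b K x) < r / 4"
        using LIMSEQ_D[OF elim(2)[rule_format, of K], of "r/4"] r by auto
      obtain N2 where N2: "\<forall>n\<ge>N2. norm (birkhoff_avg T n g x - g' x) < r / 4"
        using LIMSEQ_D[OF elim(1), of "r/4"] r by auto
      show "\<exists>no. \<forall>n\<ge>no. norm (birkhoff_avg T n (G n) x - g' x) < r"
      proof (intro exI allI impI)
        fix n assume n: "n \<ge> max K (max N1 N2)"
        have "\<bar>birkhoff_avg T n (G n) x - birkhoff_avg T n g x\<bar>
            = \<bar>birkhoff_avg T n (\<lambda>x. G n x - g x) x\<bar>"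
          by (simp add: birkhoff_avg_def birkhoff_sum_def sum_subtractf diff_divide_distrib)
        also have "\<dots> \<le> birkhoff_avg T n (\<lambda>x. \<bar>G n x - g x\<bar>) x"
          by (rule birkhoff_avg_abs_le)
        also have "\<dots> \<le> birkhoff_avg T n (d K) x"
          using n elim(4) by (intro birkhoff_avg_mono d_ge) auto
        finally have A: "\<bar>birkhoff_avg T n (G n) x - birkhoff_avg T n g x\<bar> \<le> birkhoff_avg T n (d K) x" .
        have B: "\<bar>birkhoff_avg T n (d K) x - b K x\<bar> < r / 4"
          and C: "\<bar>birkhoff_avg T n g x - g' x\<bar> < r / 4"
          using N1 N2 n by auto
        show "norm (birkhoff_avg T n (G n) x - g' x) < r"
          using A B C K by (simp add: abs_if split: if_splits)
      qed
    qed
  qed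
  have dom: "AE x in M. \<forall>n. \<bar>birkhoff_avg T n (G n) x\<bar> \<le> H x"
    using orbit H(2)
  proof eventually_elim
    case (elim x)
    show ?case
    proof
      fix n
      have "\<bar>birkhoff_avg T n (G n) x\<bar> \<le> birkhoff_avg T n (\<lambda>x. \<bar>G n x\<bar>) x"
        by (rule birkhoff_avg_abs_le)
      also have "\<dots> \<le> birkhoff_avg T n h x"
        using elim(1) by (intro birkhoff_avg_mono) auto
      also have "\<dots> \<le> H x" using elim(2) by (meson abs_le_D1)
      finally show "\<bar>birkhoff_avg T n (G n) x\<bar> \<le> H x" .
    qed
  qed
  have "dominated_limit M (\<lambda>n. birkhoff_avg T n (G n)) g'"
    unfolding dominated_limit_def
    using g'(1) H(1) dom lim birkhoff_avg_measurable[OF Tm Gm]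
    by (auto simp: dominated_limit_def)
  with g'(2) show ?thesis by blast
qed

fun multi_avg :: "('a \<Rightarrow> 'a) list \<Rightarrow> nat \<Rightarrow> ('a \<Rightarrow> real) \<Rightarrow> 'a \<Rightarrow> real" where
  "multi_avg [] n f = f"
| "multi_avg (T # Ts) n f = birkhoff_avg T n (multi_avg Ts n f)"

text \<open>
  Induction on the list of maps: the averages over the remaining maps form a dominated convergent
  sequence, which is averaged over one more map.
\<close>

theorem (in prob_space) multiparameter_ergodic_theorem:
  assumes "\<And>T. T \<in> set Ts \<Longrightarrow> measure_preserving M T" and f: "all_moments M f"
  shows "\<exists>g. dominated_limit M (\<lambda>n. multi_avg Ts n f) g \<and> expectation g = expectation f"
  using assms(1)
proof (induction Ts)
  case Nil
  have "dominated_limit M (\<lambda>n. f) f"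
    using f all_moments_abs[OF f] by (auto simp: dominated_limit_def all_momentsD(1))
  then show ?case by auto
next
  case (Cons T Ts)
  then obtain g where g: "dominated_limit M (\<lambda>n. multi_avg Ts n f) g" "expectation g = expectation f"
    by auto
  then show ?case
    using birkhoff_theorem_varying[OF _ g(1), of T] Cons.prems by auto
qed

section \<open>Counting dimensions over the field with two elements\<close>

text \<open>
  By default arithmetic in \<open>bit\<close> is rewritten to Boolean operations, which obscures sums of chains. What
  is wanted instead is that every chain is its own inverse.
\<close>

declare add_bit_eq_xor [simp del] mult_bit_eq_and [simp del]

lemma bit_add_self [simp]: "(a::bit) + a = 0"
  by (cases a) auto

lemma chain_add_self [simp]: "(c::'a \<Rightarrow> bit) + c = 0"
  by (rule ext) simp

lemma chain_add_self2 [simp]: "(c::'a \<Rightarrow> bit) + (c + x) = x"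
  by (simp add: add.assoc[symmetric])

lemma field_Z2: "field Z2"
proof (rule cring.cring_fieldI2)
  show "cring Z2"
  proof (rule cringI)
    show "abelian_group Z2"
      by (rule abelian_groupI) (auto simp: Z2_def ac_simps intro: bit_add_self)
    show "Group.comm_monoid Z2"
      by (rule comm_monoidI) (auto simp: Z2_def ac_simps)
  qed (auto simp: Z2_def algebra_simps)
  show "\<zero>\<^bsub>Z2\<^esub> \<noteq> \<one>\<^bsub>Z2\<^esub>" by (simp add: Z2_def)
  show "\<exists>b\<in>carrier Z2. a \<otimes>\<^bsub>Z2\<^esub> b = \<one>\<^bsub>Z2\<^esub>"
    if "a \<in> carrier Z2" "a \<noteq> \<zero>\<^bsub>Z2\<^esub>" for a
    using that by (cases a) (auto simp: Z2_def)
qed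

text \<open>
  A basis identifies the space with the coefficient functions on the basis, each of which takes
  two values at every basis element.
\<close>

lemma card_eq_two_power_dim:
  assumes "vectorspace Z2 V" and "finite (carrier V)"
  shows "card (carrier V) = 2 ^ vectorspace.dim Z2 V"
proof -
  interpret vectorspace Z2 V by fact
  have "carrier V \<subseteq> span (carrier V)"
    by (rule in_own_span) simp
  then have "gen_set (carrier V)"
    using span_is_subset2[of "carrier V"] by blast
  then have "\<exists>A. finite A \<and> A \<subseteq> carrier V \<and> gen_set A"
    using assms(2) by (intro exI[of _ "carrier V"]) simp
  then have "fin_dim" by (simp only: fin_dim_def)
  from finite_basis_exists[OF this] obtain B where B: "finite B" "basis B" by (elim exE conjE)
  then have BV: "B \<subseteq> carrier V" by (simp add: basis_def)
  have *: "\<exists>!a. a \<in> B \<rightarrow>\<^sub>E carrier Z2 \<and> lincomb a B = v" if "v \<in> carrier V" for v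
    using basis_criterion[OF B(1) BV] B(2) that by blast
  have "bij_betw (\<lambda>a. lincomb a B) (B \<rightarrow>\<^sub>E carrier Z2) (carrier V)"
  proof (rule bij_betwI')
    fix a assume a: "a \<in> B \<rightarrow>\<^sub>E carrier Z2"
    show V: "lincomb a B \<in> carrier V"
      using a BV by (intro lincomb_closed) auto
    fix a' assume a': "a' \<in> B \<rightarrow>\<^sub>E carrier Z2"
    show "lincomb a B = lincomb a' B \<longleftrightarrow> a = a'"
      using *[OF V] a a' by auto
  next
    fix v assume "v \<in> carrier V"
    then show "\<exists>a\<in>B \<rightarrow>\<^sub>E carrier Z2. v = lincomb a B" using *[of v] by blast
  qed
  then have "card (carrier V) = card (B \<rightarrow>\<^sub>E carrier Z2)"
    by (simp add: bij_betw_same_card)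
  also have "\<dots> = 2 ^ card B"
  proof -
    have "(UNIV :: bit set) = {0, 1}" by (auto intro: bit.exhaust)
    then have "card (UNIV :: bit set) = card {0 :: bit, 1}" by (rule arg_cong)
    then have "card (UNIV :: bit set) = 2" by simp
    then show ?thesis using B(1) by (simp add: card_PiE Z2_def)
  qed
  also have "card B = dim" using dim_basis[OF B] by simp
  finally show ?thesis .
qed

text \<open>
  A subspace: over the field with two elements, closure under addition suffices.
\<close>

definition chain_group :: "('a \<Rightarrow> bit) set \<Rightarrow> bool" where
  "chain_group S \<longleftrightarrow> 0 \<in> S \<and> (\<forall>c\<in>S. \<forall>c'\<in>S. c + c' \<in> S)"

definition chain_coset :: "('a \<Rightarrow> bit) set \<Rightarrow> ('a \<Rightarrow> bit) \<Rightarrow> ('a \<Rightarrow> bit) set" where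
  "chain_coset B z = (\<lambda>b. b + z) ` B"

definition sumset :: "('a \<Rightarrow> bit) set \<Rightarrow> ('a \<Rightarrow> bit) set \<Rightarrow> ('a \<Rightarrow> bit) set" where
  "sumset S T = (\<lambda>(s, t). s + t) ` (S \<times> T)"

lemma chain_groupD:
  assumes "chain_group S"
  shows "0 \<in> S" "c \<in> S \<Longrightarrow> c' \<in> S \<Longrightarrow> c + c' \<in> S"
  using assms by (auto simp: chain_group_def)

lemma chain_coset_eq_iff:
  assumes B: "chain_group B"
  shows "chain_coset B z = chain_coset B z' \<longleftrightarrow> z + z' \<in> B"
proof
  assume eq: "chain_coset B z = chain_coset B z'"
  have "z \<in> chain_coset B z"
    using chain_groupD(1)[OF B] by (auto simp: chain_coset_def image_iff intro!: bexI[of _ 0])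
  then obtain b where b: "b \<in> B" "z = b + z'" using eq by (auto simp: chain_coset_def)
  then show "z + z' \<in> B" by (simp add: add.assoc)
next
  have *: "chain_coset B z \<subseteq> chain_coset B z'" if "z + z' \<in> B" for z z'
  proof
    fix x assume "x \<in> chain_coset B z"
    then obtain b where b: "b \<in> B" "x = b + z" by (auto simp: chain_coset_def)
    then have "x = (b + (z + z')) + z'" by (simp add: add.assoc)
    then show "x \<in> chain_coset B z'"
      using chain_groupD(2)[OF B b(1) that] unfolding chain_coset_def by (rule image_eqI)
  qed
  assume "z + z' \<in> B"
  then show "chain_coset B z = chain_coset B z'"
    using *[of z z'] *[of z' z] by (auto simp: add.commute)
qed

lemma chain_coset_zero: "chain_coset B 0 = B"
  by (simp add: chain_coset_def)

lemma chain_coset_add: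
  assumes B: "chain_group B"
  shows "(\<Union>h\<in>chain_coset B z. \<Union>k\<in>chain_coset B z'. {h + k}) = chain_coset B (z + z')"
proof (intro subset_antisym subsetI)
  fix x assume "x \<in> (\<Union>h\<in>chain_coset B z. \<Union>k\<in>chain_coset B z'. {h + k})"
  then obtain b b' where b: "b \<in> B" "b' \<in> B" "x = (b + z) + (b' + z')"
    by (auto simp: chain_coset_def)
  then have "x = (b + b') + (z + z')" by (simp add: algebra_simps)
  then show "x \<in> chain_coset B (z + z')"
    using chain_groupD(2)[OF B b(1,2)] by (auto simp: chain_coset_def)
next
  fix x assume "x \<in> chain_coset B (z + z')"
  then obtain b where b: "b \<in> B" "x = (b + z) + (0 + z')" by (auto simp: chain_coset_def add.assoc)
  then show "x \<in> (\<Union>h\<in>chain_coset B z. \<Union>k\<in>chain_coset B z'. {h + k})"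
    using chain_groupD(1)[OF B] unfolding chain_coset_def by blast
qed

text \<open>
  Scalar multiplication in the quotient is a union over representatives; this shows that the
  choice of representative is immaterial and that the union is a single coset.
\<close>

lemma chain_coset_smult:
  assumes B: "chain_group B"
  shows "(\<Union>x\<in>chain_coset B z. chain_coset B (\<lambda>\<sigma>. a * x \<sigma>)) = chain_coset B (\<lambda>\<sigma>. a * z \<sigma>)"
proof -
  have ne: "chain_coset B z \<noteq> {}" using chain_groupD(1)[OF B] by (auto simp: chain_coset_def)
  have "chain_coset B (\<lambda>\<sigma>. a * x \<sigma>) = chain_coset B (\<lambda>\<sigma>. a * z \<sigma>)" if "x \<in> chain_coset B z" for x
  proof -
    obtain b where b: "b \<in> B" "x = b + z" using \<open>x \<in> chain_coset B z\<close> by (auto simp: chain_coset_def)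
    have "(\<lambda>\<sigma>. a * x \<sigma>) + (\<lambda>\<sigma>. a * z \<sigma>) = (\<lambda>\<sigma>. a * b \<sigma>)"
      unfolding b(2) by (rule ext) (simp add: algebra_simps)
    also have "\<dots> \<in> B"
      using b(1) chain_groupD(1)[OF B] by (cases a) (auto simp: zero_fun_def)
    finally show ?thesis by (simp add: chain_coset_eq_iff[OF B])
  qed
  then show ?thesis using ne by auto
qed

text \<open>
  Stated for an arbitrary record \<open>V\<close> whose operations are the usual ones on cosets,
  so as to apply to the homology of a complex with its carrier replaced by the image of a map.
\<close>

lemma cosets_vectorspace:
  fixes V :: "(bit, ('a \<Rightarrow> bit) set) module"
  assumes B: "chain_group B" and S: "chain_group S"
    and carrier: "carrier V = chain_coset B ` S" and zero: "zero V = B"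
    and add: "\<And>A A'. add V A A' = (\<Union>h\<in>A. \<Union>k\<in>A'. {h + k})"
    and smult: "\<And>a A. smult V a A = (\<Union>x\<in>A. chain_coset B (\<lambda>\<sigma>. a * x \<sigma>))"
  shows "vectorspace Z2 V"
proof -
  note add' = chain_coset_add[OF B] and smult' = chain_coset_smult[OF B]
  have ag: "abelian_group V"
  proof (rule abelian_groupI)
    show "\<exists>y\<in>carrier V. y \<oplus>\<^bsub>V\<^esub> x = \<zero>\<^bsub>V\<^esub>" if x: "x \<in> carrier V" for x
    proof -
      obtain z where z: "z \<in> S" "x = chain_coset B z" using x by (auto simp: carrier)
      have "x \<oplus>\<^bsub>V\<^esub> x = \<zero>\<^bsub>V\<^esub>"
        unfolding add z(2) add' by (simp add: zero chain_coset_zero)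
      then show ?thesis using x by blast
    qed
    show "\<zero>\<^bsub>V\<^esub> \<in> carrier V"
      using chain_groupD(1)[OF S] chain_coset_zero[of B] unfolding carrier zero by (metis imageI)
    show "\<zero>\<^bsub>V\<^esub> \<oplus>\<^bsub>V\<^esub> x = x" if x: "x \<in> carrier V" for x
    proof -
      obtain z where z: "z \<in> S" "x = chain_coset B z" using x by (auto simp: carrier)
      show ?thesis unfolding add z(2) zero
        using add'[where z = 0 and z' = z, unfolded chain_coset_zero add_0_left] .
    qed
  qed (use S in \<open>auto simp: carrier add add' ac_simps chain_groupD\<close>)
  have smult_mem: "(\<lambda>\<sigma>. a * z \<sigma>) \<in> S" if "z \<in> S" for a z
    using that chain_groupD(1)[OF S] by (cases a) (auto simp: zero_fun_def)
  have "module Z2 V"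
  proof (rule moduleI)
    show "cring Z2" using field_Z2 by (simp add: field_def domain_def)
    show "abelian_group V" by fact
    fix a x assume "x \<in> carrier V"
    then obtain z where z: "z \<in> S" and x: "x = chain_coset B z" by (auto simp: carrier)
    show "a \<odot>\<^bsub>V\<^esub> x \<in> carrier V"
      unfolding x smult smult' carrier using smult_mem[OF z] by (rule imageI)
    fix b
    have "(\<lambda>\<sigma>. (a + b) * z \<sigma>) = (\<lambda>\<sigma>. a * z \<sigma>) + (\<lambda>\<sigma>. b * z \<sigma>)"
      by (rule ext) (simp add: distrib_right)
    then show "(a \<oplus>\<^bsub>Z2\<^esub> b) \<odot>\<^bsub>V\<^esub> x = a \<odot>\<^bsub>V\<^esub> x \<oplus>\<^bsub>V\<^esub> b \<odot>\<^bsub>V\<^esub> x"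
      unfolding x smult smult' add add' by (simp add: Z2_def)
    show "(a \<otimes>\<^bsub>Z2\<^esub> b) \<odot>\<^bsub>V\<^esub> x = a \<odot>\<^bsub>V\<^esub> (b \<odot>\<^bsub>V\<^esub> x)"
      unfolding x smult smult' by (simp add: Z2_def mult.assoc)
    fix y assume "y \<in> carrier V"
    then obtain w where y: "y = chain_coset B w" by (auto simp: carrier)
    have "(\<lambda>\<sigma>. a * (z + w) \<sigma>) = (\<lambda>\<sigma>. a * z \<sigma>) + (\<lambda>\<sigma>. a * w \<sigma>)"
      by (rule ext) (simp add: distrib_left)
    then show "a \<odot>\<^bsub>V\<^esub> (x \<oplus>\<^bsub>V\<^esub> y) = a \<odot>\<^bsub>V\<^esub> x \<oplus>\<^bsub>V\<^esub> a \<odot>\<^bsub>V\<^esub> y"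
      unfolding x y smult add add' smult' by simp
  next
    fix x assume "x \<in> carrier V"
    then obtain z where x: "x = chain_coset B z" by (auto simp: carrier)
    show "\<one>\<^bsub>Z2\<^esub> \<odot>\<^bsub>V\<^esub> x = x"
      unfolding x smult smult' by (simp add: Z2_def)
  qed
  then show ?thesis using field_Z2 by (simp add: vectorspace_def)
qed

text \<open>
  The sum of \<open>S\<close> and \<open>B\<close> is the disjoint union of these cosets, and each
  of them has as many elements as \<open>B\<close>.
\<close>

lemma card_sumset_cosets:
  assumes B: "chain_group B" and fin: "finite B" "finite S"
  shows "card (chain_coset B ` S) * card B = card (sumset B S)"
proof -
  have cB: "card C = card B" if "C \<in> chain_coset B ` S" for C
    using that by (auto simp: chain_coset_def card_image inj_on_def)
  have "card B * card (chain_coset B ` S) = card (\<Union> (chain_coset B ` S))"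
  proof (rule card_partition)
    show "finite (\<Union> (chain_coset B ` S))"
      using fin by (auto simp: chain_coset_def)
    fix C C' assume "C \<in> chain_coset B ` S" "C' \<in> chain_coset B ` S" "C \<noteq> C'"
    then obtain z z' where C: "C = chain_coset B z" "C' = chain_coset B z'" by auto
    show "C \<inter> C' = {}"
    proof (rule ccontr)
      assume "C \<inter> C' \<noteq> {}"
      then obtain b b' where b: "b \<in> B" "b' \<in> B" "b + z = b' + z'"
        by (auto simp: C chain_coset_def)
      have "z + z' = b + (b + z) + z'" by simp
      also have "\<dots> = b + b'" unfolding b(3) by (simp add: add.assoc)
      finally have "z + z' \<in> B" using chain_groupD(2)[OF B b(1,2)] by simp
      then show False using \<open>C \<noteq> C'\<close> by (simp add: C chain_coset_eq_iff[OF B])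
    qed
  qed (use fin cB in auto)
  also have "\<Union> (chain_coset B ` S) = sumset B S"
    by (auto simp: chain_coset_def sumset_def)
  finally show ?thesis by (simp add: mult.commute)
qed

section \<open>Boundaries and chain maps as incidence sums\<close>

text \<open>
  Both the boundary operator and the chain map of a simplicial map are sums over an incidence
  relation between simplices; a composition of two such maps counts intermediate simplices modulo
  two.
\<close>

definition incidence_map :: "('a \<Rightarrow> 'b \<Rightarrow> bool) \<Rightarrow> ('a \<Rightarrow> bit) \<Rightarrow> 'b \<Rightarrow> bit" where
  "incidence_map P c \<tau> = (\<Sum>\<sigma> | c \<sigma> \<noteq> 0 \<and> P \<sigma> \<tau>. c \<sigma>)"

definition is_face :: "'v set \<Rightarrow> 'v set \<Rightarrow> bool" where
  "is_face \<sigma> \<tau> \<longleftrightarrow> \<tau> \<noteq> {} \<and> (\<exists>v\<in>\<sigma>. \<tau> = \<sigma> - {v})"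

definition maps_onto :: "('v \<Rightarrow> 'u) \<Rightarrow> 'v set \<Rightarrow> 'u set \<Rightarrow> bool" where
  "maps_onto f \<sigma> \<tau> \<longleftrightarrow> inj_on f \<sigma> \<and> f ` \<sigma> = \<tau>"

lemma boundary_map_eq: "boundary_map = incidence_map is_face"
  by (auto simp: fun_eq_iff boundary_map_def incidence_map_def is_face_def)

lemma chain_map_eq: "chain_map f = incidence_map (maps_onto f)"
  by (auto simp: fun_eq_iff chain_map_def incidence_map_def maps_onto_def)

lemma incidence_map_superset:
  assumes "finite F" "{\<sigma>. c \<sigma> \<noteq> 0} \<subseteq> F"
  shows "incidence_map P c \<tau> = (\<Sum>\<sigma>\<in>F. if P \<sigma> \<tau> then c \<sigma> else 0)"
proof -
  have "(\<Sum>\<sigma>\<in>F. if P \<sigma> \<tau> then c \<sigma> else 0) = (\<Sum>\<sigma>\<in>{\<sigma>\<in>F. P \<sigma> \<tau>}. c \<sigma>)"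
    using assms(1) by (simp add: sum.inter_filter)
  also have "\<dots> = incidence_map P c \<tau>"
    unfolding incidence_map_def using assms
    by (intro sum.mono_neutral_right) auto
  finally show ?thesis ..
qed

lemma incidence_map_add:
  assumes "finite {\<sigma>. c \<sigma> \<noteq> 0}" "finite {\<sigma>. c' \<sigma> \<noteq> 0}"
  shows "incidence_map P (c + c') = incidence_map P c + incidence_map P c'"
proof
  fix \<tau>
  let ?F = "{\<sigma>. c \<sigma> \<noteq> 0} \<union> {\<sigma>. c' \<sigma> \<noteq> 0}"
  have "finite ?F" using assms by simp
  note eq = incidence_map_superset[OF this]
  have "{\<sigma>. (c + c') \<sigma> \<noteq> 0} \<subseteq> ?F" by auto
  then show "incidence_map P (c + c') \<tau> = (incidence_map P c + incidence_map P c') \<tau>"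
    by (simp add: eq sum.distrib[symmetric] if_distrib cong: if_cong)
qed

lemma incidence_map_zero [simp]: "incidence_map P 0 = 0"
  by (auto simp: fun_eq_iff incidence_map_def)

lemma incidence_map_nonzero:
  assumes "incidence_map P c \<tau> \<noteq> 0"
  obtains \<sigma> where "c \<sigma> \<noteq> 0" "P \<sigma> \<tau>"
proof -
  have "{\<sigma>. c \<sigma> \<noteq> 0 \<and> P \<sigma> \<tau>} \<noteq> {}"
    using assms unfolding incidence_map_def by (metis sum.empty)
  then show ?thesis using that by blast
qed

lemma incidence_map_cong:
  assumes "\<And>\<sigma> \<tau>. c \<sigma> \<noteq> 0 \<Longrightarrow> P \<sigma> \<tau> \<longleftrightarrow> Q \<sigma> \<tau>"
  shows "incidence_map P c = incidence_map Q c"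
  unfolding incidence_map_def using assms by (intro ext sum.cong) auto

lemma incidence_map_comp:
  assumes fin: "finite {\<sigma>. c \<sigma> \<noteq> 0}" and finP: "\<And>\<sigma>. c \<sigma> \<noteq> 0 \<Longrightarrow> finite {\<tau>. P \<sigma> \<tau>}"
  shows "incidence_map Q (incidence_map P c) \<rho>
    = (\<Sum>\<sigma> | c \<sigma> \<noteq> 0. c \<sigma> * of_nat (card {\<tau>. P \<sigma> \<tau> \<and> Q \<tau> \<rho>}))"
proof -
  let ?S = "{\<sigma>. c \<sigma> \<noteq> 0}"
  define G where "G = (\<Union>\<sigma>\<in>?S. {\<tau>. P \<sigma> \<tau>})"
  have G: "finite G" unfolding G_def using fin finP by auto
  have supp: "{\<tau>. incidence_map P c \<tau> \<noteq> 0} \<subseteq> G"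
    unfolding G_def using incidence_map_nonzero[of P c] by blast
  have "incidence_map Q (incidence_map P c) \<rho> = (\<Sum>\<tau>\<in>G. if Q \<tau> \<rho> then incidence_map P c \<tau> else 0)"
    by (rule incidence_map_superset[OF G supp])
  also have "\<dots> = (\<Sum>\<tau>\<in>G. \<Sum>\<sigma>\<in>?S. if P \<sigma> \<tau> \<and> Q \<tau> \<rho> then c \<sigma> else 0)"
    by (intro sum.cong refl)
       (simp add: incidence_map_superset[OF fin order_refl] if_distrib cong: if_cong)
  also have "\<dots> = (\<Sum>\<sigma>\<in>?S. \<Sum>\<tau>\<in>G. if P \<sigma> \<tau> \<and> Q \<tau> \<rho> then c \<sigma> else 0)"
    by (rule sum.swap)
  also have "\<dots> = (\<Sum>\<sigma>\<in>?S. c \<sigma> * of_nat (card {\<tau>. P \<sigma> \<tau> \<and> Q \<tau> \<rho>}))"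
  proof (rule sum.cong)
    fix \<sigma> assume "\<sigma> \<in> ?S"
    then have "{\<tau>\<in>G. P \<sigma> \<tau> \<and> Q \<tau> \<rho>} = {\<tau>. P \<sigma> \<tau> \<and> Q \<tau> \<rho>}" by (auto simp: G_def)
    then show "(\<Sum>\<tau>\<in>G. if P \<sigma> \<tau> \<and> Q \<tau> \<rho> then c \<sigma> else 0) = c \<sigma> * of_nat (card {\<tau>. P \<sigma> \<tau> \<and> Q \<tau> \<rho>})"
      using G by (simp add: sum.inter_filter[symmetric] mult.commute)
  qed simp
  finally show ?thesis .
qed

lemma of_nat_bit: "(of_nat n :: bit) = (if even n then 0 else 1)"
  by (induction n) auto

lemma chain_map_comp:
  assumes "finite {\<sigma>. c \<sigma> \<noteq> 0}"
  shows "chain_map g (chain_map f c) = chain_map (g \<circ> f) c"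
proof
  fix \<rho>
  have fin: "finite {\<tau>. maps_onto f \<sigma> \<tau>}" for \<sigma>
    by (rule finite_subset[of _ "{f ` \<sigma>}"]) (auto simp: maps_onto_def)
  have c: "card {\<tau>. maps_onto f \<sigma> \<tau> \<and> maps_onto g \<tau> \<rho>} = (if maps_onto (g \<circ> f) \<sigma> \<rho> then 1 else 0)" for \<sigma>
  proof -
    have "{\<tau>. maps_onto f \<sigma> \<tau> \<and> maps_onto g \<tau> \<rho>} = (if maps_onto (g \<circ> f) \<sigma> \<rho> then {f ` \<sigma>} else {})"
    proof -
      have "inj_on (g \<circ> f) \<sigma> \<longleftrightarrow> inj_on f \<sigma> \<and> inj_on g (f ` \<sigma>)"
        using comp_inj_on_iff[of f \<sigma> g] inj_on_imageI2[of g f \<sigma>] by blast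
      then show ?thesis by (auto simp: maps_onto_def image_comp)
    qed
    then show ?thesis by simp
  qed
  show "chain_map g (chain_map f c) \<rho> = chain_map (g \<circ> f) c \<rho>"
    unfolding chain_map_eq incidence_map_comp[OF assms fin] incidence_map_superset[OF assms order_refl]
    by (simp add: c if_distrib cong: if_cong)
qed

text \<open>
  Compare coefficients at a fixed simplex. If \<open>f\<close> is injective on a simplex
  \<open>\<sigma>\<close>, its faces correspond to those of the image. If \<open>f\<close>
  identifies two vertices \<open>u\<close> and \<open>w\<close> of \<open>\<sigma>\<close>, only
  the faces opposite \<open>u\<close> and \<open>w\<close> can be mapped injectively; they have
  the same image and cancel.
\<close>

lemma chain_map_boundary:
  assumes fin: "finite {\<sigma>. c \<sigma> \<noteq> 0}" and fin': "\<And>\<sigma>. c \<sigma> \<noteq> 0 \<Longrightarrow> finite \<sigma>"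
  shows "chain_map f (boundary_map c) = boundary_map (chain_map f c)"
proof
  fix \<rho>
  have finf: "finite {\<tau>. maps_onto f \<sigma> \<tau>}" for \<sigma>
    by (rule finite_subset[of _ "{f ` \<sigma>}"]) (auto simp: maps_onto_def)
  have finb: "finite {\<tau>. is_face \<sigma> \<tau>}" if "c \<sigma> \<noteq> 0" for \<sigma>
  proof (rule finite_subset)
    show "{\<tau>. is_face \<sigma> \<tau>} \<subseteq> (\<lambda>v. \<sigma> - {v}) ` \<sigma>" unfolding is_face_def by blast
    show "finite ((\<lambda>v. \<sigma> - {v}) ` \<sigma>)" using fin'[OF that] by (rule finite_imageI)
  qed
  have par: "even (card {\<tau>. is_face \<sigma> \<tau> \<and> maps_onto f \<tau> \<rho>})
      \<longleftrightarrow> even (card {\<tau>. maps_onto f \<sigma> \<tau> \<and> is_face \<tau> \<rho>})" if "c \<sigma> \<noteq> 0" for \<sigma>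
  proof (cases "inj_on f \<sigma>")
    case True
    have "{\<tau>. maps_onto f \<sigma> \<tau> \<and> is_face \<tau> \<rho>} = (if is_face (f ` \<sigma>) \<rho> then {f ` \<sigma>} else {})"
      using True by (auto simp: maps_onto_def)
    moreover have "{\<tau>. is_face \<sigma> \<tau> \<and> maps_onto f \<tau> \<rho>}
        = (if is_face (f ` \<sigma>) \<rho> then {\<sigma> \<inter> f -` \<rho>} else {})"
    proof -
      have img: "f ` (\<sigma> - {u}) = f ` \<sigma> - {f u}" if "u \<in> \<sigma>" for u
        using True that by (auto simp: inj_on_def)
      have "is_face (f ` \<sigma>) \<rho> \<and> \<tau> = \<sigma> \<inter> f -` \<rho>" if face: "is_face \<sigma> \<tau>" "maps_onto f \<tau> \<rho>" for \<tau>
      proof -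
        obtain u where u: "u \<in> \<sigma>" "\<tau> = \<sigma> - {u}" "\<tau> \<noteq> {}" "\<rho> = f ` \<tau>"
          using face unfolding is_face_def maps_onto_def by blast
        have \<rho>: "\<rho> = f ` \<sigma> - {f u}" using img u by simp
        have eq: "\<sigma> \<inter> f -` \<rho> = \<sigma> - {u}"
          unfolding \<rho> using True u(1) by (auto simp: inj_on_def)
        have ne: "\<rho> \<noteq> {}" unfolding u(4) using u(3) by blast
        have "is_face (f ` \<sigma>) \<rho>"
          unfolding is_face_def by (intro conjI ne bexI[of _ "f u"] \<rho> imageI u(1))
        then show ?thesis by (simp only: eq u(2) simp_thms)
      qed
      moreover have "is_face \<sigma> (\<sigma> \<inter> f -` \<rho>) \<and> maps_onto f (\<sigma> \<inter> f -` \<rho>) \<rho>"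
        if face: "is_face (f ` \<sigma>) \<rho>"
      proof -
        obtain u where u: "u \<in> \<sigma>" "\<rho> = f ` \<sigma> - {f u}" "\<rho> \<noteq> {}"
          using face by (auto simp: is_face_def)
        have eq: "\<sigma> \<inter> f -` \<rho> = \<sigma> - {u}"
          unfolding u(2) using True u(1) by (auto simp: inj_on_def)
        have im: "f ` (\<sigma> - {u}) = \<rho>" using img u by simp
        then have ne: "\<sigma> - {u} \<noteq> {}" using u(3) by auto
        have "is_face \<sigma> (\<sigma> - {u})"
          unfolding is_face_def by (intro conjI ne bexI[of _ u] refl u(1))
        moreover have "inj_on f (\<sigma> - {u})" using True by (rule inj_on_subset) blast
        ultimately show ?thesis unfolding eq maps_onto_def using im by blast
      qed
      ultimately show ?thesis by auto
    qed
    ultimately show ?thesis by simp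
  next
    case False
    then have rhs: "{\<tau>. maps_onto f \<sigma> \<tau> \<and> is_face \<tau> \<rho>} = {}" by (auto simp: maps_onto_def)
    obtain u w where uw: "u \<in> \<sigma>" "w \<in> \<sigma>" "u \<noteq> w" "f u = f w"
      using False by (auto simp: inj_on_def)
    have faces: "\<tau> = \<sigma> - {u} \<or> \<tau> = \<sigma> - {w}" if face: "is_face \<sigma> \<tau>" "inj_on f \<tau>" for \<tau>
    proof -
      obtain v where v: "v \<in> \<sigma>" "\<tau> = \<sigma> - {v}" using face(1) unfolding is_face_def by blast
      then have "v = u \<or> v = w" using face(2) uw unfolding inj_on_def by blast
      then show ?thesis using v by auto
    qed
    have isf: "is_face \<sigma> (\<sigma> - {u})" "is_face \<sigma> (\<sigma> - {w})"
      using uw(1-3) unfolding is_face_def by blast+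
    have im: "f ` (\<sigma> - {u}) = f ` (\<sigma> - {w})"
    proof -
      have "f ` \<sigma> \<subseteq> f ` (\<sigma> - {a})" if "b \<in> \<sigma>" "a \<noteq> b" "f a = f b" for a b
      proof (rule image_subsetI)
        fix x assume x: "x \<in> \<sigma>"
        show "f x \<in> f ` (\<sigma> - {a})"
          by (cases "x = a") (use that x in \<open>auto intro: rev_image_eqI[of b]\<close>)
      qed
      from this[of w u] this[of u w] have "f ` \<sigma> \<subseteq> f ` (\<sigma> - {u})" "f ` \<sigma> \<subseteq> f ` (\<sigma> - {w})"
        using uw by simp_all
      then show ?thesis by blast
    qed
    have card_eq: "card (\<sigma> - {u}) = card (\<sigma> - {w})"
      using uw fin'[OF that] by simp
    have inj_iff: "inj_on f (\<sigma> - {u}) \<longleftrightarrow> inj_on f (\<sigma> - {w})"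
      using im card_eq fin'[OF that] by (simp add: inj_on_iff_eq_card)
    have "{\<tau>. is_face \<sigma> \<tau> \<and> maps_onto f \<tau> \<rho>}
        = (if maps_onto f (\<sigma> - {u}) \<rho> then {\<sigma> - {u}, \<sigma> - {w}} else {})"
    proof (cases "maps_onto f (\<sigma> - {u}) \<rho>")
      case True
      then have "maps_onto f (\<sigma> - {w}) \<rho>" using im inj_iff by (simp add: maps_onto_def)
      moreover have "is_face \<sigma> \<tau> \<and> maps_onto f \<tau> \<rho> \<Longrightarrow> \<tau> = \<sigma> - {u} \<or> \<tau> = \<sigma> - {w}" for \<tau>
        using faces[of \<tau>] by (simp add: maps_onto_def)
      ultimately show ?thesis using isf True by auto
    next
      case False
      then have "\<not> maps_onto f (\<sigma> - {w}) \<rho>" using im inj_iff by (simp add: maps_onto_def)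
      then have "\<not> (is_face \<sigma> \<tau> \<and> maps_onto f \<tau> \<rho>)" for \<tau>
        using faces[of \<tau>] False by (auto simp: maps_onto_def)
      then show ?thesis using False by simp
    qed
    moreover have "\<sigma> - {u} \<noteq> \<sigma> - {w}" using uw by blast
    ultimately show ?thesis unfolding rhs by simp
  qed
  show "chain_map f (boundary_map c) \<rho> = boundary_map (chain_map f c) \<rho>"
  proof -
    have "incidence_map (maps_onto f) (incidence_map is_face c) \<rho>
        = (\<Sum>\<sigma> | c \<sigma> \<noteq> 0. c \<sigma> * of_nat (card {\<tau>. is_face \<sigma> \<tau> \<and> maps_onto f \<tau> \<rho>}))"
      by (rule incidence_map_comp[OF fin finb])
    also have "\<dots> = (\<Sum>\<sigma> | c \<sigma> \<noteq> 0. c \<sigma> * of_nat (card {\<tau>. maps_onto f \<sigma> \<tau> \<and> is_face \<tau> \<rho>}))"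
      by (intro sum.cong refl) (simp add: of_nat_bit par)
    also have "\<dots> = incidence_map is_face (incidence_map (maps_onto f) c) \<rho>"
      by (rule incidence_map_comp[OF fin finf, symmetric])
    finally show ?thesis by (simp only: chain_map_eq boundary_map_eq)
  qed
qed

section \<open>The rank in homology as a quotient of cardinalities\<close>

text \<open>
  Finiteness is included, since all complexes that are compared are built on finite sets of
  points.
\<close>

definition abstract_complex :: "'v set set \<Rightarrow> bool" where
  "abstract_complex K \<longleftrightarrow> finite K \<and>
     (\<forall>\<sigma>\<in>K. finite \<sigma> \<and> \<sigma> \<noteq> {} \<and> (\<forall>\<tau>. \<tau> \<subseteq> \<sigma> \<longrightarrow> \<tau> \<noteq> {} \<longrightarrow> \<tau> \<in> K))"

definition simplicial_map :: "('v \<Rightarrow> 'u) \<Rightarrow> 'v set set \<Rightarrow> 'u set set \<Rightarrow> bool" where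
  "simplicial_map f K L \<longleftrightarrow> (\<forall>\<sigma>\<in>K. f ` \<sigma> \<in> L)"

definition simplices :: "'v set set \<Rightarrow> nat \<Rightarrow> 'v set set" where
  "simplices K q = {\<sigma> \<in> K. card \<sigma> = Suc q}"

definition chains_on :: "'a set \<Rightarrow> ('a \<Rightarrow> bit) set" where
  "chains_on F = {c. \<forall>\<sigma>. c \<sigma> \<noteq> 0 \<longrightarrow> \<sigma> \<in> F}"

lemma chains_on_group: "chain_group (chains_on F)"
  unfolding chain_group_def chains_on_def by (auto simp del: bit_not_zero_iff) (metis add_0_right)

lemma chains_on_mono: "F \<subseteq> G \<Longrightarrow> chains_on F \<subseteq> chains_on G"
  by (auto simp: chains_on_def)

lemma chains_on_support: "finite F \<Longrightarrow> c \<in> chains_on F \<Longrightarrow> finite {\<sigma>. c \<sigma> \<noteq> 0}"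
  by (rule finite_subset[of _ F]) (auto simp: chains_on_def)

lemma chains_on_finite_card:
  assumes "finite F"
  shows "finite (chains_on F)" "card (chains_on F) = 2 ^ card F"
proof -
  have bij: "bij_betw (\<lambda>S \<sigma>. if \<sigma> \<in> S then 1 else 0 :: bit) (Pow F) (chains_on F)"
  proof (rule bij_betw_byWitness[where f' = "\<lambda>c. {\<sigma>. c \<sigma> \<noteq> 0}"])
    show "\<forall>c\<in>chains_on F. (\<lambda>\<sigma>. if \<sigma> \<in> {\<sigma>. c \<sigma> \<noteq> 0} then 1 else 0) = c"
      by (auto simp: fun_eq_iff)
  qed (auto simp: chains_on_def split: if_splits)
  show "finite (chains_on F)"
    using bij_betw_finite[OF bij] assms by simp
  show "card (chains_on F) = 2 ^ card F"
    using bij_betw_same_card[OF bij] by (simp add: card_Pow assms)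
qed

lemma finite_simplices: "abstract_complex K \<Longrightarrow> finite (simplices K q)"
  by (auto simp: abstract_complex_def simplices_def)

lemma carrier_chain_space:
  assumes "finite K"
  shows "carrier (chain_space K q) = chains_on (simplices K q)"
proof -
  have "finite {\<sigma>. c \<sigma> \<noteq> 0}" if "\<forall>\<sigma>. c \<sigma> \<noteq> 0 \<longrightarrow> \<sigma> \<in> K \<and> card \<sigma> = Suc q" for c :: "'a set \<Rightarrow> bit"
    by (rule finite_subset[OF _ assms]) (use that in blast)
  then have "c \<in> carrier (chain_space K q) \<longleftrightarrow> c \<in> chains_on (simplices K q)" for c
    unfolding chain_space_def chains_on_def simplices_def partial_object.select_convs mem_Collect_eq by blast
  then show ?thesis by blast
qed

lemma incidence_map_chains_on:
  assumes "c \<in> chains_on F" "\<And>\<sigma> \<tau>. \<sigma> \<in> F \<Longrightarrow> P \<sigma> \<tau> \<Longrightarrow> \<tau> \<in> G"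
  shows "incidence_map P c \<in> chains_on G"
  unfolding chains_on_def
proof (intro CollectI allI impI)
  fix \<tau> assume "incidence_map P c \<tau> \<noteq> 0"
  then obtain \<sigma> where "c \<sigma> \<noteq> 0" "P \<sigma> \<tau>" by (rule incidence_map_nonzero)
  then show "\<tau> \<in> G" using assms by (auto simp: chains_on_def)
qed

lemma is_faceD:
  assumes "is_face \<sigma> \<tau>"
  shows "\<tau> \<noteq> {}" "\<tau> \<subseteq> \<sigma>" "finite \<sigma> \<Longrightarrow> card \<sigma> = Suc (card \<tau>)"
proof -
  obtain v where v: "v \<in> \<sigma>" "\<tau> = \<sigma> - {v}" "\<tau> \<noteq> {}" using assms unfolding is_face_def by blast
  show "\<tau> \<noteq> {}" "\<tau> \<subseteq> \<sigma>" using v by blast+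
  show "card \<sigma> = Suc (card \<tau>)" if "finite \<sigma>"
    unfolding v(2) using card.remove[OF that v(1)] by simp
qed

lemma abstract_complexD:
  assumes "abstract_complex K"
  shows "finite K" "\<sigma> \<in> K \<Longrightarrow> finite \<sigma>" "\<sigma> \<in> K \<Longrightarrow> \<sigma> \<noteq> {}"
    "\<sigma> \<in> K \<Longrightarrow> is_face \<sigma> \<tau> \<Longrightarrow> \<tau> \<in> K"
  using assms is_faceD(1,2)[of \<sigma> \<tau>] unfolding abstract_complex_def by blast+

lemma boundary_chains_on:
  assumes "abstract_complex K" "c \<in> chains_on (simplices K (Suc q))"
  shows "boundary_map c \<in> chains_on (simplices K q)"
  unfolding boundary_map_eq
proof (rule incidence_map_chains_on[OF assms(2)])
  fix \<sigma> \<tau> assume \<sigma>: "\<sigma> \<in> simplices K (Suc q)" and face: "is_face \<sigma> \<tau>"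
  then have "\<sigma> \<in> K" "card \<sigma> = Suc (Suc q)" by (auto simp: simplices_def)
  then show "\<tau> \<in> simplices K q"
    using abstract_complexD(2,4)[OF assms(1) \<open>\<sigma> \<in> K\<close>] face is_faceD(3)[OF face] by (simp add: simplices_def)
qed

lemma boundary_chains_on_complex:
  assumes "abstract_complex K" "c \<in> chains_on K"
  shows "boundary_map c \<in> chains_on K"
  unfolding boundary_map_eq
  by (rule incidence_map_chains_on[OF assms(2) abstract_complexD(4)[OF assms(1)]])

lemma chain_map_chains_on:
  assumes "simplicial_map f K L" "c \<in> chains_on (simplices K q)"
  shows "chain_map f c \<in> chains_on (simplices L q)"
  unfolding chain_map_eq
  by (rule incidence_map_chains_on[OF assms(2)])
     (use assms(1) in \<open>auto simp: maps_onto_def simplices_def simplicial_map_def card_image\<close>)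

lemma boundary_add:
  assumes "finite F" "c \<in> chains_on F" "c' \<in> chains_on F"
  shows "boundary_map (c + c') = boundary_map c + boundary_map c'"
  unfolding boundary_map_eq
  by (rule incidence_map_add) (use chains_on_support[OF assms(1)] assms in auto)

lemma chain_map_add:
  assumes "finite F" "c \<in> chains_on F" "c' \<in> chains_on F"
  shows "chain_map f (c + c') = chain_map f c + chain_map f c'"
  unfolding chain_map_eq
  by (rule incidence_map_add) (use chains_on_support[OF assms(1)] assms in auto)

lemma boundary_zero [simp]: "boundary_map 0 = 0"
  by (simp add: boundary_map_eq)

lemma chain_map_zero [simp]: "chain_map f 0 = 0"
  by (simp add: chain_map_eq)

lemma cycles_eq:
  assumes "abstract_complex K"
  shows "cycles K q = {c \<in> chains_on (simplices K q). boundary_map c = 0}"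
  using abstract_complexD(1)[OF assms]
  unfolding cycles_def zero_fun_def by (simp add: carrier_chain_space)

lemma boundaries_eq:
  assumes "abstract_complex K"
  shows "boundaries K q = boundary_map ` chains_on (simplices K (Suc q))"
  using assms by (simp add: boundaries_def carrier_chain_space abstract_complex_def)

lemma chain_group_image:
  assumes "chain_group S" "\<And>c c'. c \<in> S \<Longrightarrow> c' \<in> S \<Longrightarrow> f (c + c') = f c + f c'" "f 0 = 0"
  shows "chain_group (f ` S)"
  unfolding chain_group_def
proof (intro conjI ballI)
  show "0 \<in> f ` S" using chain_groupD(1)[OF assms(1)] assms(3) by (metis imageI)
  fix x y assume "x \<in> f ` S" "y \<in> f ` S"
  then obtain c c' where "c \<in> S" "c' \<in> S" "x = f c" "y = f c'" by blast
  then show "x + y \<in> f ` S" using assms(2) chain_groupD(2)[OF assms(1)] by (metis imageI)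
qed

lemma cycles_group:
  assumes K: "abstract_complex K"
  shows "chain_group (cycles K q)"
  unfolding chain_group_def cycles_eq[OF K]
proof (intro conjI ballI CollectI)
  fix c c' assume c: "c \<in> {c \<in> chains_on (simplices K q). boundary_map c = 0}"
    and c': "c' \<in> {c \<in> chains_on (simplices K q). boundary_map c = 0}"
  then have "boundary_map (c + c') = boundary_map c + boundary_map c'"
    by (intro boundary_add[OF finite_simplices[OF K]]) blast+
  also have "\<dots> = 0" using c c' by simp
  finally show "boundary_map (c + c') = 0" .
  show "c + c' \<in> chains_on (simplices K q)"
    using c c' chain_groupD(2)[OF chains_on_group] by blast
qed (rule chain_groupD(1)[OF chains_on_group], rule boundary_zero)

lemma boundaries_group:
  assumes K: "abstract_complex K"
  shows "chain_group (boundaries K q)"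
  unfolding boundaries_eq[OF K]
  by (rule chain_group_image[OF chains_on_group boundary_add[OF finite_simplices[OF K]] boundary_zero])

lemma cycles_subset: "abstract_complex K \<Longrightarrow> cycles K q \<subseteq> chains_on (simplices K q)"
  by (auto simp: cycles_eq)

lemma boundaries_subset: "abstract_complex K \<Longrightarrow> boundaries K q \<subseteq> chains_on (simplices K q)"
  by (auto simp: boundaries_eq boundary_chains_on)

lemma finite_cycles: "abstract_complex K \<Longrightarrow> finite (cycles K q)"
  by (rule finite_subset[OF cycles_subset chains_on_finite_card(1)[OF finite_simplices]])

lemma finite_boundaries: "abstract_complex K \<Longrightarrow> finite (boundaries K q)"
  by (rule finite_subset[OF boundaries_subset chains_on_finite_card(1)[OF finite_simplices]])

lemma chain_map_cycles_group:
  assumes K: "abstract_complex K"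
  shows "chain_group (chain_map f ` cycles K q)"
proof (rule chain_group_image[OF cycles_group[OF K]])
  fix c c' assume "c \<in> cycles K q" "c' \<in> cycles K q"
  then show "chain_map f (c + c') = chain_map f c + chain_map f c'"
    using cycles_subset[OF K] by (intro chain_map_add[OF finite_simplices[OF K]]) auto
qed simp

lemma chain_map_boundaries:
  assumes K: "abstract_complex K" and f: "simplicial_map f K L" and L: "abstract_complex L"
    and b: "b \<in> boundaries K q"
  shows "chain_map f b \<in> boundaries L q"
proof -
  obtain c where c: "c \<in> chains_on (simplices K (Suc q))" "b = boundary_map c"
    using b by (auto simp: boundaries_eq[OF K])
  have fin: "finite \<sigma>" if "c \<sigma> \<noteq> 0" for \<sigma>
  proof -
    have "\<sigma> \<in> K" using that c(1) by (auto simp: chains_on_def simplices_def)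
    then show ?thesis using K by (auto simp: abstract_complex_def)
  qed
  have "chain_map f b = boundary_map (chain_map f c)"
    unfolding c(2) by (rule chain_map_boundary[OF chains_on_support[OF finite_simplices[OF K] c(1)] fin])
  then show ?thesis
    unfolding boundaries_eq[OF L] using chain_map_chains_on[OF f c(1)] by (rule image_eqI)
qed

text \<open>
  Its quotient by the boundaries of \<open>L\<close> is the image of the map induced in homology.
\<close>

definition image_group :: "('v \<Rightarrow> 'u) \<Rightarrow> 'v set set \<Rightarrow> 'u set set \<Rightarrow> nat \<Rightarrow> ('u set \<Rightarrow> bit) set" where
  "image_group f K L q = sumset (boundaries L q) (chain_map f ` cycles K q)"

lemma coset_chain_space: "A +>\<^bsub>(chain_space K q)\<lparr>carrier := C\<rparr>\<^esub> z = chain_coset A z"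
    "A +>\<^bsub>chain_space K q\<^esub> z = chain_coset A z"
  by (auto simp: a_r_coset_def' chain_coset_def chain_space_def plus_fun_def)

text \<open>
  The union in the definition of the induced map does not depend on the representative of a
  homology class, because chain maps send boundaries to boundaries.
\<close>

lemma homology_map_image:
  assumes K: "abstract_complex K" and L: "abstract_complex L" and f: "simplicial_map f K L"
  shows "homology_map f L q ` carrier (homology K q)
    = chain_coset (boundaries L q) ` chain_map f ` cycles K q"
proof -
  note B = boundaries_group[OF L, of q]
  have carrier: "carrier (homology K q) = chain_coset (boundaries K q) ` cycles K q"
    by (auto simp: homology_def quotient_module_def A_RCOSETS_def' coset_chain_space)
  have "homology_map f L q (chain_coset (boundaries K q) z) = chain_coset (boundaries L q) (chain_map f z)"
    if z: "z \<in> cycles K q" for z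
  proof -
    have "chain_coset (boundaries L q) (chain_map f c) = chain_coset (boundaries L q) (chain_map f z)"
      if "c \<in> chain_coset (boundaries K q) z" for c
    proof -
      obtain b where b: "b \<in> boundaries K q" "c = b + z"
        using \<open>c \<in> chain_coset (boundaries K q) z\<close> by (auto simp: chain_coset_def)
      have "chain_map f c = chain_map f b + chain_map f z"
        unfolding b(2)
        by (rule chain_map_add[OF finite_simplices[OF K, of q]])
           (use b(1) z boundaries_subset[OF K] cycles_subset[OF K] in auto)
      then have "chain_map f c + chain_map f z = chain_map f b" by (simp add: add.assoc)
      then show ?thesis
        using chain_map_boundaries[OF K f L b(1)] by (simp add: chain_coset_eq_iff[OF B])
    qed
    moreover have "chain_coset (boundaries K q) z \<noteq> {}"
      using chain_groupD(1)[OF boundaries_group[OF K]] by (auto simp: chain_coset_def)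
    ultimately show ?thesis by (simp add: homology_map_def coset_chain_space)
  qed
  then show ?thesis unfolding carrier image_image by (rule image_cong[OF refl])
qed

lemma homology_record:
  "zero (homology L q) = boundaries L q"
  "add (homology L q) A A' = (\<Union>h\<in>A. \<Union>k\<in>A'. {h + k})"
  "smult (homology L q) a A = (\<Union>x\<in>A. chain_coset (boundaries L q) (\<lambda>\<sigma>. a * x \<sigma>))"
proof -
  have "smult ((chain_space L q)\<lparr>carrier := cycles L q\<rparr>) = (\<lambda>a c \<sigma>. a * c \<sigma>)"
    and add: "add ((chain_space L q)\<lparr>carrier := cycles L q\<rparr>) = (\<lambda>c c'. c + c')"
    by (simp_all add: chain_space_def plus_fun_def)
  then show "smult (homology L q) a A = (\<Union>x\<in>A. chain_coset (boundaries L q) (\<lambda>\<sigma>. a * x \<sigma>))"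
    by (simp add: homology_def quotient_module_def coset_chain_space)
  show "add (homology L q) A A' = (\<Union>h\<in>A. \<Union>k\<in>A'. {h + k})"
    unfolding homology_def quotient_module_def ring_record_simps set_add_def' add ..
qed (simp add: homology_def quotient_module_def)

text \<open>
  The image in homology consists of the cosets of the boundaries of \<open>L\<close> met by the
  images of cycles. Counting these cosets turns statements about ranks into statements about
  cardinalities.
\<close>

theorem homology_image_dim_card:
  assumes K: "abstract_complex K" and L: "abstract_complex L" and f: "simplicial_map f K L"
  shows "2 ^ homology_image_dim f K L q * card (boundaries L q) = card (image_group f K L q)"
proof -
  let ?V = "(homology L q)\<lparr>carrier := homology_map f L q ` carrier (homology K q)\<rparr>"
  let ?S = "chain_map f ` cycles K q" and ?B = "boundaries L q"
  have carrier: "carrier ?V = chain_coset ?B ` ?S"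
    using homology_map_image[OF K L f] by simp
  have "vectorspace Z2 ?V"
    by (rule cosets_vectorspace[OF boundaries_group[OF L] chain_map_cycles_group[OF K] carrier])
       (simp_all add: homology_record)
  moreover have "finite (carrier ?V)"
    unfolding carrier using finite_cycles[OF K] by simp
  ultimately have "card (carrier ?V) = 2 ^ homology_image_dim f K L q"
    unfolding homology_image_dim_def by (rule card_eq_two_power_dim)
  then show ?thesis
    unfolding carrier image_group_def
    using card_sumset_cosets[OF boundaries_group[OF L, of q] finite_boundaries[OF L], of ?S]
      finite_cycles[OF K, of q]
    by simp
qed

section \<open>Removing simplices\<close>

lemma abstract_complex_subset:
  "abstract_complex K \<Longrightarrow> \<sigma> \<in> K \<Longrightarrow> \<tau> \<subseteq> \<sigma> \<Longrightarrow> \<tau> \<noteq> {} \<Longrightarrow> \<tau> \<in> K"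
  unfolding abstract_complex_def by blast

text \<open>
  Used with \<open>R\<close> a small set of representatives: \<open>S\<close> is not much larger
  than \<open>S'\<close> if it lies in few translates of \<open>S'\<close>.
\<close>

lemma card_le_if_covered:
  assumes "finite R" "finite S'" "S \<subseteq> sumset R S'"
  shows "card S \<le> card R * card S'"
proof -
  have "card S \<le> card (sumset R S')"
    using assms by (intro card_mono) (auto simp: sumset_def)
  also have "\<dots> \<le> card (R \<times> S')"
    unfolding sumset_def using assms by (intro card_image_le) auto
  finally show ?thesis by (simp add: card_cartesian_product)
qed

lemma sumsetI: "s \<in> S \<Longrightarrow> t \<in> T \<Longrightarrow> s + t \<in> sumset S T"
  by (auto simp: sumset_def)

lemma sumsetE:
  assumes "x \<in> sumset S T" obtains s t where "s \<in> S" "t \<in> T" "x = s + t"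
  using assms by (auto simp: sumset_def)

definition restrict_chain :: "'a set \<Rightarrow> ('a \<Rightarrow> bit) \<Rightarrow> 'a \<Rightarrow> bit" where
  "restrict_chain F c \<sigma> = (if \<sigma> \<in> F then c \<sigma> else 0)"

lemma restrict_chain_in: "restrict_chain F c \<in> chains_on F"
  by (auto simp: chains_on_def restrict_chain_def split: if_splits)

lemma chains_on_split:
  assumes "c \<in> chains_on (F \<union> G)"
  shows "\<exists>c1\<in>chains_on F. \<exists>c2\<in>chains_on G. c = c1 + c2"
proof (intro bexI)
  show "c = restrict_chain F c + restrict_chain (G - F) c"
    using assms by (auto simp: fun_eq_iff restrict_chain_def chains_on_def)
  show "restrict_chain (G - F) c \<in> chains_on G"
    using restrict_chain_in chains_on_mono[of "G - F" G] by blast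
qed (rule restrict_chain_in)

text \<open>
  Split a chain of \<open>L\<close> into its part on the removed simplices and the rest.
\<close>

lemma boundaries_cover:
  assumes L: "abstract_complex L" and L': "abstract_complex L'" and sub: "L' \<subseteq> L"
  shows "\<exists>R. finite R \<and> card R \<le> 2 ^ card (simplices (L - L') (Suc q)) \<and>
    boundaries L q \<subseteq> sumset R (boundaries L' q)"
proof (intro exI conjI)
  let ?D = "simplices (L - L') (Suc q)"
  let ?R = "boundary_map ` chains_on ?D"
  have fD: "finite ?D" using abstract_complexD(1)[OF L] by (auto simp: simplices_def)
  note D = chains_on_finite_card[OF fD]
  show "finite ?R" using D(1) by simp
  show "card ?R \<le> 2 ^ card ?D" using card_image_le[OF D(1), of boundary_map] D(2) by simp
  show "boundaries L q \<subseteq> sumset ?R (boundaries L' q)"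
  proof
    fix b assume "b \<in> boundaries L q"
    then obtain c where c: "c \<in> chains_on (simplices L (Suc q))" "b = boundary_map c"
      by (auto simp: boundaries_eq[OF L])
    have "simplices L (Suc q) = ?D \<union> simplices L' (Suc q)" using sub by (auto simp: simplices_def)
    then obtain c1 c2 where c12: "c1 \<in> chains_on ?D" "c2 \<in> chains_on (simplices L' (Suc q))" "c = c1 + c2"
      using chains_on_split[of c ?D "simplices L' (Suc q)"] c(1) by metis
    have "b = boundary_map c1 + boundary_map c2"
      unfolding c(2) c12(3)
    proof (rule boundary_add[OF finite_simplices[OF L, of "Suc q"]])
      show "c1 \<in> chains_on (simplices L (Suc q))"
        using c12(1) chains_on_mono[of ?D "simplices L (Suc q)"] by (auto simp: simplices_def)
      show "c2 \<in> chains_on (simplices L (Suc q))"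
        using c12(2) chains_on_mono[of "simplices L' (Suc q)" "simplices L (Suc q)"] sub
        by (auto simp: simplices_def)
    qed
    then show "b \<in> sumset ?R (boundaries L' q)"
      using c12 by (auto simp: boundaries_eq[OF L'] intro!: sumsetI)
  qed
qed

text \<open>
  Two cycles of \<open>K\<close> that agree on the removed simplices differ by a cycle of
  \<open>K'\<close>. One cycle is chosen for every pattern that occurs on the removed simplices.
\<close>

lemma cycles_cover:
  assumes K: "abstract_complex K" and K': "abstract_complex K'" and sub: "K' \<subseteq> K"
  shows "\<exists>R. finite R \<and> card R \<le> 2 ^ card (simplices (K - K') q) \<and> R \<subseteq> cycles K q \<and>
    cycles K q \<subseteq> sumset R (cycles K' q)"
proof -
  let ?D = "simplices (K - K') q" and ?Z = "cycles K q"
  let ?res = "restrict_chain ?D"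
  \<comment> \<open>One cycle for each restriction to the removed simplices.\<close>
  define rep where "rep r = (SOME z. z \<in> ?Z \<and> ?res z = r)" for r
  have rep: "rep (?res z) \<in> ?Z \<and> ?res (rep (?res z)) = ?res z" if "z \<in> ?Z" for z
    unfolding rep_def by (rule someI[of _ z]) (use that in blast)
  let ?R = "rep ` ?res ` ?Z"
  have fD: "finite ?D" using abstract_complexD(1)[OF K] by (auto simp: simplices_def)
  have "card ?R \<le> card (?res ` ?Z)"
    by (intro card_image_le finite_imageI finite_cycles K)
  also have "\<dots> \<le> card (chains_on ?D)"
    by (rule card_mono[OF chains_on_finite_card(1)[OF fD]]) (auto simp: restrict_chain_in)
  also have "\<dots> = 2 ^ card ?D" by (rule chains_on_finite_card(2)[OF fD])
  finally have card: "card ?R \<le> 2 ^ card ?D" .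
  have cover: "z \<in> sumset ?R (cycles K' q)" if z: "z \<in> ?Z" for z
  proof -
    let ?z = "rep (?res z)"
    have z': "?z \<in> ?Z" "?res ?z = ?res z" using rep[OF z] by auto
    have sum: "?z + z \<in> ?Z" using chain_groupD(2)[OF cycles_group[OF K] z'(1) z] .
    have "?z + z \<in> chains_on (simplices K' q)"
      unfolding chains_on_def
    proof (intro CollectI allI impI)
      fix \<sigma> assume ne: "(?z + z) \<sigma> \<noteq> 0"
      have "?z + z \<in> chains_on (simplices K q)" using sum cycles_subset[OF K] by blast
      then have \<sigma>: "\<sigma> \<in> simplices K q" using ne unfolding chains_on_def by blast
      have "\<sigma> \<notin> ?D"
      proof
        assume "\<sigma> \<in> ?D"
        then have "?z \<sigma> = z \<sigma>" using fun_cong[OF z'(2), of \<sigma>] by (simp add: restrict_chain_def)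
        then show False using ne by simp
      qed
      with \<sigma> show "\<sigma> \<in> simplices K' q" by (auto simp: simplices_def)
    qed
    then have "?z + z \<in> cycles K' q" using sum by (auto simp: cycles_eq[OF K] cycles_eq[OF K'])
    moreover have "?z \<in> ?R" using z by blast
    ultimately have "?z + (?z + z) \<in> sumset ?R (cycles K' q)" by (intro sumsetI)
    then show ?thesis by simp
  qed
  show ?thesis
  proof (intro exI conjI)
    show "finite ?R" by (intro finite_imageI finite_cycles K)
    show "card ?R \<le> 2 ^ card ?D" by (rule card)
    show "?R \<subseteq> ?Z" using rep by blast
    show "?Z \<subseteq> sumset ?R (cycles K' q)" using cover by blast
  qed
qed

lemma image_group_subset:
  assumes K: "abstract_complex K" and L: "abstract_complex L" and f: "simplicial_map f K L"
  shows "image_group f K L q \<subseteq> chains_on (simplices L q)"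
proof
  fix x assume "x \<in> image_group f K L q"
  then obtain b z where "b \<in> boundaries L q" "z \<in> cycles K q" "x = b + chain_map f z"
    by (auto simp: image_group_def elim!: sumsetE)
  then show "x \<in> chains_on (simplices L q)"
    using boundaries_subset[OF L, of q] cycles_subset[OF K, of q] chain_map_chains_on[OF f, of z q]
    by (auto intro!: chain_groupD(2)[OF chains_on_group])
qed

lemma finite_image_group:
  assumes "abstract_complex K" "abstract_complex L" "simplicial_map f K L"
  shows "finite (image_group f K L q)"
  by (rule finite_subset[OF image_group_subset[OF assms]
        chains_on_finite_card(1)[OF finite_simplices[OF assms(2)]]])

text \<open>
  The coverings of the cycles and of the boundaries, added up.
\<close>

lemma image_group_cover:
  assumes K: "abstract_complex K" "abstract_complex K'" "K' \<subseteq> K"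
    and L: "abstract_complex L" "abstract_complex L'" "L' \<subseteq> L"
    and f: "simplicial_map f K' L'"
  shows "card (image_group f K L q)
    \<le> 2 ^ (card (simplices (K - K') q) + card (simplices (L - L') (Suc q))) * card (image_group f K' L' q)"
proof -
  let ?W' = "image_group f K' L' q"
  obtain R where R: "finite R" "card R \<le> 2 ^ card (simplices (L - L') (Suc q))"
      "boundaries L q \<subseteq> sumset R (boundaries L' q)"
    using boundaries_cover[OF L, of q] by blast
  obtain S where S: "finite S" "card S \<le> 2 ^ card (simplices (K - K') q)" "S \<subseteq> cycles K q"
      "cycles K q \<subseteq> sumset S (cycles K' q)"
    using cycles_cover[OF K, of q] by blast
  let ?Q = "sumset R (chain_map f ` S)"
  have "image_group f K L q \<subseteq> sumset ?Q ?W'"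
  proof
    fix x assume "x \<in> image_group f K L q"
    then obtain b z where bz: "b \<in> boundaries L q" "z \<in> cycles K q" "x = b + chain_map f z"
      by (auto simp: image_group_def elim!: sumsetE)
    obtain r b' where b: "r \<in> R" "b' \<in> boundaries L' q" "b = r + b'"
      using bz(1) R(3) by (blast elim: sumsetE)
    obtain s z' where z: "s \<in> S" "z' \<in> cycles K' q" "z = s + z'"
      using bz(2) S(4) by (blast elim: sumsetE)
    have "cycles K' q \<subseteq> chains_on (simplices K q)"
      using cycles_subset[OF K(2), of q] chains_on_mono[of "simplices K' q" "simplices K q"] K(3)
      by (auto simp: simplices_def)
    then have "chain_map f z = chain_map f s + chain_map f z'"
      unfolding z(3) using z S(3) cycles_subset[OF K(1), of q]
      by (intro chain_map_add[OF finite_simplices[OF K(1), of q]]) blast+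
    then have "x = (r + chain_map f s) + (b' + chain_map f z')"
      unfolding bz(3) b(3) by (simp add: ac_simps)
    also have "\<dots> \<in> sumset ?Q ?W'"
      unfolding image_group_def using b z by (intro sumsetI imageI)
    finally show "x \<in> sumset ?Q ?W'" .
  qed
  moreover have "finite ?Q" using R(1) S(1) by (auto simp: sumset_def)
  ultimately have "card (image_group f K L q) \<le> card ?Q * card ?W'"
    by (intro card_le_if_covered finite_image_group K L f)
  also have "card ?Q \<le> card R * card S"
  proof -
    have "card ?Q \<le> card R * card (chain_map f ` S)"
      using R(1) S(1) by (intro card_le_if_covered) auto
    also have "\<dots> \<le> card R * card S" using S(1) by (intro mult_left_mono card_image_le) auto
    finally show ?thesis .
  qed
  also have "card R * card S \<le> 2 ^ card (simplices (L - L') (Suc q)) * 2 ^ card (simplices (K - K') q)"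
    using R(2) S(2) by (rule mult_mono) auto
  finally show ?thesis by (simp add: power_add mult.commute)
qed

lemma chains_subcomplex_mono:
  assumes K: "abstract_complex K" "abstract_complex K'" "K' \<subseteq> K"
  shows "cycles K' q \<subseteq> cycles K q" "boundaries K' q \<subseteq> boundaries K q"
proof -
  have *: "chains_on (simplices K' i) \<subseteq> chains_on (simplices K i)" for i
    using K(3) by (intro chains_on_mono) (auto simp: simplices_def)
  show "cycles K' q \<subseteq> cycles K q" "boundaries K' q \<subseteq> boundaries K q"
    using * by (auto simp: cycles_eq[OF K(1)] cycles_eq[OF K(2)] boundaries_eq[OF K(1)] boundaries_eq[OF K(2)])
qed

lemma card_boundaries_pos:
  assumes "abstract_complex L" shows "card (boundaries L q) > 0"
  using chain_groupD(1)[OF boundaries_group[OF assms, of q]] finite_boundaries[OF assms, of q]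
  unfolding card_gt_0_iff by blast

text \<open>
  The rank is the logarithm of the index of the boundaries in \<open>image_group\<close>. Passing
  to the subcomplexes shrinks both groups, and the coverings above bound the factors. The
  shrinking of the boundaries can only raise the rank, that of the other group can only lower it.
\<close>

theorem homology_image_dim_subcomplex:
  assumes K: "abstract_complex K" "abstract_complex K'" "K' \<subseteq> K"
    and L: "abstract_complex L" "abstract_complex L'" "L' \<subseteq> L"
    and f: "simplicial_map f K L" and f': "simplicial_map f K' L'"
  shows "\<bar>real (homology_image_dim f K L q) - real (homology_image_dim f K' L' q)\<bar>
    \<le> real (card (simplices (K - K') q) + card (simplices (L - L') (Suc q)))"
proof -
  let ?a = "card (simplices (K - K') q)" and ?b = "card (simplices (L - L') (Suc q))"
  let ?p = "homology_image_dim f K L q" and ?p' = "homology_image_dim f K' L' q"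
  let ?W = "image_group f K L q" and ?W' = "image_group f K' L' q"
  let ?B = "boundaries L q" and ?B' = "boundaries L' q"
  have e: "2 ^ ?p * card ?B = card ?W" "2 ^ ?p' * card ?B' = card ?W'"
    using homology_image_dim_card[OF K(1) L(1) f] homology_image_dim_card[OF K(2) L(2) f'] by auto
  have B: "card ?B' \<le> card ?B"
    by (rule card_mono[OF finite_boundaries[OF L(1)] chains_subcomplex_mono(2)[OF L]])
  have "?W' \<subseteq> ?W"
    using chains_subcomplex_mono(1)[OF K, of q] chains_subcomplex_mono(2)[OF L, of q]
    unfolding image_group_def sumset_def by blast
  then have W: "card ?W' \<le> card ?W" by (rule card_mono[OF finite_image_group[OF K(1) L(1) f]])
  have pos: "card ?B > 0" "card ?B' > 0"
    using card_boundaries_pos L by blast+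
  have "card ?B \<le> 2 ^ ?b * card ?B'"
  proof -
    obtain R where R: "finite R" "card R \<le> 2 ^ ?b" "?B \<subseteq> sumset R ?B'"
      using boundaries_cover[OF L, of q] by blast
    have "card ?B \<le> card R * card ?B'"
      by (rule card_le_if_covered[OF R(1) finite_boundaries[OF L(2)] R(3)])
    also have "\<dots> \<le> 2 ^ ?b * card ?B'" using R(2) by simp
    finally show ?thesis .
  qed
  then have "2 ^ ?p' * card ?B' \<le> 2 ^ ?p * (2 ^ ?b * card ?B')"
    using W e by (metis (no_types) mult_le_mono2 order_trans)
  then have "(2::nat) ^ ?p' \<le> 2 ^ (?p + ?b)" using pos by (simp add: power_add)
  then have 1: "?p' \<le> ?p + ?b" by simp
  have "2 ^ ?p * card ?B \<le> 2 ^ (?a + ?b) * (2 ^ ?p' * card ?B')"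
    unfolding e by (rule image_group_cover[OF K L f'])
  also have "\<dots> \<le> 2 ^ (?a + ?b) * (2 ^ ?p' * card ?B)" by (intro mult_le_mono2 B)
  also have "\<dots> = 2 ^ (?a + ?b + ?p') * card ?B" by (simp only: power_add mult.assoc)
  finally have "(2::nat) ^ ?p \<le> 2 ^ (?a + ?b + ?p')" using pos by (simp only: mult_le_cancel2)
  then have 2: "?p \<le> ?a + ?b + ?p'" by simp
  from 1 2 show ?thesis by linarith
qed

section \<open>Additivity over disjoint complexes\<close>

lemma card_sumset_disjoint:
  assumes "S \<subseteq> chains_on F" "T \<subseteq> chains_on G" "F \<inter> G = {}"
  shows "card (sumset S T) = card S * card T"
proof -
  have "inj_on (\<lambda>(s, t). s + t) (S \<times> T)"
  proof (rule inj_onI, clarify)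
    fix s t s' t' assume st: "s \<in> S" "t \<in> T" "s' \<in> S" "t' \<in> T" and eq: "s + t = s' + t'"
    have "s \<sigma> = s' \<sigma> \<and> t \<sigma> = t' \<sigma>" for \<sigma>
    proof -
      have "s \<sigma> + t \<sigma> = s' \<sigma> + t' \<sigma>" using fun_cong[OF eq, of \<sigma>] by simp
      moreover have "s \<sigma> = 0 \<and> s' \<sigma> = 0 \<or> t \<sigma> = 0 \<and> t' \<sigma> = 0"
        using st assms unfolding chains_on_def by blast
      ultimately show ?thesis by auto
    qed
    then show "s = s' \<and> t = t'" by (auto simp: fun_eq_iff)
  qed
  then show ?thesis unfolding sumset_def by (simp add: card_image card_cartesian_product)
qed

lemma abstract_complex_Un:
  "abstract_complex K \<Longrightarrow> abstract_complex K' \<Longrightarrow> abstract_complex (K \<union> K')"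
  unfolding abstract_complex_def by blast

lemma simplices_Un: "simplices (K \<union> K') q = simplices K q \<union> simplices K' q"
  by (auto simp: simplices_def)

lemma boundaries_Un:
  assumes K: "abstract_complex K" and K': "abstract_complex K'"
  shows "boundaries (K \<union> K') q = sumset (boundaries K q) (boundaries K' q)"
proof -
  note KK = abstract_complex_Un[OF K K']
  have fin: "finite (simplices (K \<union> K') (Suc q))" by (rule finite_simplices[OF KK])
  have add: "boundary_map (c + c') = boundary_map c + boundary_map c'"
    if "c \<in> chains_on (simplices K (Suc q))" "c' \<in> chains_on (simplices K' (Suc q))" for c c'
    by (rule boundary_add[OF fin])
       (use that chains_on_mono[of "simplices K (Suc q)" "simplices (K \<union> K') (Suc q)"]
          chains_on_mono[of "simplices K' (Suc q)" "simplices (K \<union> K') (Suc q)"]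
        in \<open>auto simp: simplices_Un\<close>)
  have sub: "c + c' \<in> chains_on (simplices (K \<union> K') (Suc q))"
    if "c \<in> chains_on (simplices K (Suc q))" "c' \<in> chains_on (simplices K' (Suc q))" for c c'
    by (rule chain_groupD(2)[OF chains_on_group])
       (use that chains_on_mono[of "simplices K (Suc q)" "simplices (K \<union> K') (Suc q)"]
          chains_on_mono[of "simplices K' (Suc q)" "simplices (K \<union> K') (Suc q)"]
        in \<open>auto simp: simplices_Un\<close>)
  show ?thesis
    unfolding boundaries_eq[OF K] boundaries_eq[OF K'] boundaries_eq[OF KK]
  proof (intro subset_antisym subsetI)
    fix b assume "b \<in> boundary_map ` chains_on (simplices (K \<union> K') (Suc q))"
    then obtain c where c: "c \<in> chains_on (simplices (K \<union> K') (Suc q))" "b = boundary_map c" by blast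
    then obtain c1 c2 where "c1 \<in> chains_on (simplices K (Suc q))" "c2 \<in> chains_on (simplices K' (Suc q))"
        "c = c1 + c2"
      using chains_on_split unfolding simplices_Un by metis
    then show "b \<in> sumset (boundary_map ` chains_on (simplices K (Suc q))) (boundary_map ` chains_on (simplices K' (Suc q)))"
      using c(2) add by (auto intro!: sumsetI)
  next
    fix b assume "b \<in> sumset (boundary_map ` chains_on (simplices K (Suc q))) (boundary_map ` chains_on (simplices K' (Suc q)))"
    then obtain c1 c2 where "c1 \<in> chains_on (simplices K (Suc q))" "c2 \<in> chains_on (simplices K' (Suc q))"
        "b = boundary_map c1 + boundary_map c2"
      by (auto elim!: sumsetE)
    then show "b \<in> boundary_map ` chains_on (simplices (K \<union> K') (Suc q))"
      using add sub by (metis imageI)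
  qed
qed

text \<open>
  The boundaries of the two parts of a cycle are supported on disjoint complexes, so they cannot
  cancel each other and must both vanish.
\<close>

lemma cycles_Un:
  assumes K: "abstract_complex K" and K': "abstract_complex K'" and disj: "K \<inter> K' = {}"
  shows "cycles (K \<union> K') q = sumset (cycles K q) (cycles K' q)"
proof -
  note KK = abstract_complex_Un[OF K K']
  have fin: "finite (simplices (K \<union> K') q)" by (rule finite_simplices[OF KK])
  have mono: "chains_on (simplices K q) \<subseteq> chains_on (simplices (K \<union> K') q)"
    "chains_on (simplices K' q) \<subseteq> chains_on (simplices (K \<union> K') q)"
    by (auto simp: simplices_Un intro!: chains_on_mono)
  have add: "boundary_map (c + c') = boundary_map c + boundary_map c'"
    if "c \<in> chains_on (simplices K q)" "c' \<in> chains_on (simplices K' q)" for c c'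
    by (rule boundary_add[OF fin]) (use that mono in auto)
  have sub: "c + c' \<in> chains_on (simplices (K \<union> K') q)"
    if "c \<in> chains_on (simplices K q)" "c' \<in> chains_on (simplices K' q)" for c c'
    by (rule chain_groupD(2)[OF chains_on_group]) (use that mono in auto)
  show ?thesis
  proof (intro subset_antisym subsetI)
    fix c assume "c \<in> cycles (K \<union> K') q"
    then have c: "c \<in> chains_on (simplices K q \<union> simplices K' q)" "boundary_map c = 0"
      by (auto simp: cycles_eq[OF KK] simplices_Un)
    obtain c1 c2 where c12: "c1 \<in> chains_on (simplices K q)" "c2 \<in> chains_on (simplices K' q)" "c = c1 + c2"
      using chains_on_split[OF c(1)] by metis
    have eq: "boundary_map c1 + boundary_map c2 = 0" using add[OF c12(1,2)] c(2) c12(3) by simp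
    have s: "chains_on (simplices K q) \<subseteq> chains_on K" "chains_on (simplices K' q) \<subseteq> chains_on K'"
      by (auto simp: simplices_def intro!: chains_on_mono)
    have "boundary_map c1 \<in> chains_on K" "boundary_map c2 \<in> chains_on K'"
      using boundary_chains_on_complex[OF K, of c1] boundary_chains_on_complex[OF K', of c2] c12 s by auto
    then have "boundary_map c1 \<sigma> = 0 \<and> boundary_map c2 \<sigma> = 0" for \<sigma>
    proof -
      have "boundary_map c1 \<sigma> + boundary_map c2 \<sigma> = 0" using fun_cong[OF eq, of \<sigma>] by simp
      moreover have "boundary_map c1 \<sigma> = 0 \<or> boundary_map c2 \<sigma> = 0"
        using \<open>boundary_map c1 \<in> chains_on K\<close> \<open>boundary_map c2 \<in> chains_on K'\<close> disj
        unfolding chains_on_def by blast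
      ultimately show ?thesis by auto
    qed
    then have "boundary_map c1 = 0" "boundary_map c2 = 0" by (auto simp: fun_eq_iff)
    then show "c \<in> sumset (cycles K q) (cycles K' q)"
      unfolding c12(3) using c12 by (intro sumsetI) (auto simp: cycles_eq[OF K] cycles_eq[OF K'])
  next
    fix c assume "c \<in> sumset (cycles K q) (cycles K' q)"
    then obtain c1 c2 where "c1 \<in> cycles K q" "c2 \<in> cycles K' q" "c = c1 + c2" by (rule sumsetE)
    then show "c \<in> cycles (K \<union> K') q"
      using add sub by (auto simp: cycles_eq[OF K] cycles_eq[OF K'] cycles_eq[OF KK])
  qed
qed

text \<open>
  Cycles, boundaries and their sums all split, and cardinalities multiply.
\<close>

lemma homology_image_dim_Un:
  assumes K: "abstract_complex K" "abstract_complex K'" "K \<inter> K' = {}"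
    and L: "abstract_complex L" "abstract_complex L'" "L \<inter> L' = {}"
    and f: "simplicial_map f K L" "simplicial_map f K' L'"
  shows "homology_image_dim f (K \<union> K') (L \<union> L') q
    = homology_image_dim f K L q + homology_image_dim f K' L' q"
proof -
  have ff: "simplicial_map f (K \<union> K') (L \<union> L')" using f by (auto simp: simplicial_map_def)
  note KK = abstract_complex_Un[OF K(1,2)] and LL = abstract_complex_Un[OF L(1,2)]
  have disj: "simplices L q \<inter> simplices L' q = {}" using L(3) by (auto simp: simplices_def)
  have cB: "card (boundaries (L \<union> L') q) = card (boundaries L q) * card (boundaries L' q)"
    unfolding boundaries_Un[OF L(1,2)]
    by (rule card_sumset_disjoint[OF boundaries_subset[OF L(1)] boundaries_subset[OF L(2)] disj])
  have "image_group f (K \<union> K') (L \<union> L') q = sumset (image_group f K L q) (image_group f K' L' q)"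
  proof -
    have fz: "chain_map f (z + z') = chain_map f z + chain_map f z'"
      if "z \<in> cycles K q" "z' \<in> cycles K' q" for z z'
    proof (rule chain_map_add[OF finite_simplices[OF KK, of q]])
      have "chains_on (simplices K q) \<subseteq> chains_on (simplices (K \<union> K') q)"
        "chains_on (simplices K' q) \<subseteq> chains_on (simplices (K \<union> K') q)"
        by (auto simp: simplices_Un intro!: chains_on_mono)
      then show "z \<in> chains_on (simplices (K \<union> K') q)" "z' \<in> chains_on (simplices (K \<union> K') q)"
        using that cycles_subset[OF K(1)] cycles_subset[OF K(2)] by blast+
    qed
    show ?thesis
      unfolding image_group_def boundaries_Un[OF L(1,2)] cycles_Un[OF K]
    proof (intro subset_antisym subsetI)
      fix x assume "x \<in> sumset (sumset (boundaries L q) (boundaries L' q))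
            (chain_map f ` sumset (cycles K q) (cycles K' q))"
      then obtain b b' z z' where *: "b \<in> boundaries L q" "b' \<in> boundaries L' q" "z \<in> cycles K q"
          "z' \<in> cycles K' q" "x = (b + b') + chain_map f (z + z')"
        by (elim sumsetE imageE) blast
      have "x = (b + chain_map f z) + (b' + chain_map f z')"
        unfolding *(5) fz[OF *(3,4)] by (simp add: ac_simps)
      also have "\<dots> \<in> sumset (sumset (boundaries L q) (chain_map f ` cycles K q))
           (sumset (boundaries L' q) (chain_map f ` cycles K' q))"
        using * by (intro sumsetI imageI)
      finally show "x \<in> sumset (sumset (boundaries L q) (chain_map f ` cycles K q))
           (sumset (boundaries L' q) (chain_map f ` cycles K' q))" .
    next
      fix x assume "x \<in> sumset (sumset (boundaries L q) (chain_map f ` cycles K q))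
           (sumset (boundaries L' q) (chain_map f ` cycles K' q))"
      then obtain b b' z z' where *: "b \<in> boundaries L q" "b' \<in> boundaries L' q" "z \<in> cycles K q"
          "z' \<in> cycles K' q" "x = (b + chain_map f z) + (b' + chain_map f z')"
        by (elim sumsetE imageE) blast
      have "x = (b + b') + chain_map f (z + z')"
        unfolding *(5) fz[OF *(3,4)] by (simp add: ac_simps)
      also have "\<dots> \<in> sumset (sumset (boundaries L q) (boundaries L' q))
            (chain_map f ` sumset (cycles K q) (cycles K' q))"
        using * by (intro sumsetI imageI)
      finally show "x \<in> sumset (sumset (boundaries L q) (boundaries L' q))
            (chain_map f ` sumset (cycles K q) (cycles K' q))" .
    qed
  qed
  then have cW: "card (image_group f (K \<union> K') (L \<union> L') q)
      = card (image_group f K L q) * card (image_group f K' L' q)"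
    using card_sumset_disjoint[OF image_group_subset[OF K(1) L(1) f(1)]
        image_group_subset[OF K(2) L(2) f(2)] disj] by simp
  have "2 ^ homology_image_dim f (K \<union> K') (L \<union> L') q * (card (boundaries L q) * card (boundaries L' q))
      = 2 ^ (homology_image_dim f K L q + homology_image_dim f K' L' q) * (card (boundaries L q) * card (boundaries L' q))"
    using homology_image_dim_card[OF KK LL ff, of q]
    unfolding cB cW homology_image_dim_card[OF K(1) L(1) f(1), of q, symmetric]
      homology_image_dim_card[OF K(2) L(2) f(2), of q, symmetric] power_add
    by (simp only: mult_ac)
  moreover have "card (boundaries L q) > 0" "card (boundaries L' q) > 0"
    using card_boundaries_pos L by blast+
  ultimately have "(2::nat) ^ homology_image_dim f (K \<union> K') (L \<union> L') q
      = 2 ^ (homology_image_dim f K L q + homology_image_dim f K' L' q)" by simp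
  then show ?thesis by (rule power_inject_exp[THEN iffD1, rotated]) simp
qed

lemma homology_image_dim_empty: "homology_image_dim f {} {} q = 0"
proof -
  have c: "abstract_complex ({} :: 'a set set)" "abstract_complex ({} :: 'b set set)"
    by (auto simp: abstract_complex_def)
  have f: "simplicial_map f {} ({} :: 'b set set)" by (simp add: simplicial_map_def)
  have e: "chains_on {} = {0 :: 'c \<Rightarrow> bit}" by (auto simp: chains_on_def fun_eq_iff)
  have s: "simplices {} i = {}" for i by (simp add: simplices_def)
  have B: "boundaries ({} :: 'b set set) q = {0}"
    unfolding boundaries_eq[OF c(2)] s e by (simp only: image_insert image_empty boundary_zero)
  have "cycles ({} :: 'a set set) q = {0}"
    unfolding cycles_eq[OF c(1)] s e using boundary_zero by blast
  then have "image_group f {} {} q = sumset {0} {0}"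
    unfolding image_group_def B by (simp only: image_insert image_empty chain_map_zero)
  also have "\<dots> = {0}" by (simp add: sumset_def)
  finally have "image_group f {} {} q = {0}" .
  with B show ?thesis using homology_image_dim_card[OF c f, of q] by simp
qed

lemma homology_image_dim_UNION:
  assumes "finite J"
    and K: "\<And>j. j \<in> J \<Longrightarrow> abstract_complex (K j)" "\<And>i j. i \<in> J \<Longrightarrow> j \<in> J \<Longrightarrow> i \<noteq> j \<Longrightarrow> K i \<inter> K j = {}"
    and L: "\<And>j. j \<in> J \<Longrightarrow> abstract_complex (L j)" "\<And>i j. i \<in> J \<Longrightarrow> j \<in> J \<Longrightarrow> i \<noteq> j \<Longrightarrow> L i \<inter> L j = {}"
    and f: "\<And>j. j \<in> J \<Longrightarrow> simplicial_map f (K j) (L j)"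
  shows "abstract_complex (\<Union>j\<in>J. K j) \<and> abstract_complex (\<Union>j\<in>J. L j) \<and>
    simplicial_map f (\<Union>j\<in>J. K j) (\<Union>j\<in>J. L j) \<and>
    homology_image_dim f (\<Union>j\<in>J. K j) (\<Union>j\<in>J. L j) q = (\<Sum>j\<in>J. homology_image_dim f (K j) (L j) q)"
  using assms
proof (induction J)
  case empty
  then show ?case by (simp add: homology_image_dim_empty abstract_complex_def simplicial_map_def)
next
  case (insert i J)
  have IH: "abstract_complex (\<Union>j\<in>J. K j)" "abstract_complex (\<Union>j\<in>J. L j)"
      "simplicial_map f (\<Union>j\<in>J. K j) (\<Union>j\<in>J. L j)"
      "homology_image_dim f (\<Union>j\<in>J. K j) (\<Union>j\<in>J. L j) q = (\<Sum>j\<in>J. homology_image_dim f (K j) (L j) q)"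
    using insert by auto
  have i: "abstract_complex (K i)" "abstract_complex (L i)" "simplicial_map f (K i) (L i)"
    using insert.prems by auto
  have disj: "K i \<inter> (\<Union>j\<in>J. K j) = {}" "L i \<inter> (\<Union>j\<in>J. L j) = {}"
    using insert.hyps(2) insert.prems(2)[of i] insert.prems(4)[of i] by auto
  show ?case
    using homology_image_dim_Un[OF i(1) IH(1) disj(1) i(2) IH(2) disj(2) i(3) IH(3), of q] IH i insert.hyps
      abstract_complex_Un[OF i(1) IH(1)] abstract_complex_Un[OF i(2) IH(2)]
    by (auto simp: simplicial_map_def)
qed

section \<open>Invariance under isomorphism\<close>

lemma chains_on_zero: "c \<in> chains_on F \<Longrightarrow> \<sigma> \<notin> F \<Longrightarrow> c \<sigma> = 0"
  unfolding chains_on_def by blast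

text \<open>
  An injective vertex map has exactly one simplex above each simplex of the image.
\<close>

lemma chain_map_apply_inj:
  assumes g: "inj_on g (\<Union>F)" and \<sigma>: "\<sigma> \<in> F" and c: "c \<in> chains_on F"
  shows "chain_map g c (g ` \<sigma>) = c \<sigma>"
proof -
  have "{\<sigma>'. c \<sigma>' \<noteq> 0 \<and> maps_onto g \<sigma>' (g ` \<sigma>)} = (if c \<sigma> \<noteq> 0 then {\<sigma>} else {})"
  proof -
    have "\<sigma>' = \<sigma>" if "c \<sigma>' \<noteq> 0" "maps_onto g \<sigma>' (g ` \<sigma>)" for \<sigma>'
    proof -
      have "\<sigma>' \<in> F" using that(1) c unfolding chains_on_def by blast
      then show ?thesis
        using inj_on_image_eq_iff[OF g, of \<sigma>' \<sigma>] \<sigma> that(2) unfolding maps_onto_def by blast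
    qed
    moreover have "maps_onto g \<sigma> (g ` \<sigma>)"
      using inj_on_subset[OF g, of \<sigma>] \<sigma> unfolding maps_onto_def by blast
    ultimately have "c \<sigma>' \<noteq> 0 \<and> maps_onto g \<sigma>' (g ` \<sigma>) \<longleftrightarrow> c \<sigma> \<noteq> 0 \<and> \<sigma>' = \<sigma>" for \<sigma>'
      by metis
    then show ?thesis by simp
  qed
  then show ?thesis unfolding chain_map_eq incidence_map_def by simp
qed

lemma chain_map_iso_inj:
  assumes g: "inj_on g (\<Union>F)"
  shows "inj_on (chain_map g) (chains_on F)"
proof (rule inj_onI)
  fix c c' assume c: "c \<in> chains_on F" "c' \<in> chains_on F" "chain_map g c = chain_map g c'"
  show "c = c'"
  proof
    fix \<sigma> show "c \<sigma> = c' \<sigma>"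
    proof (cases "\<sigma> \<in> F")
      case True
      then show ?thesis
        using chain_map_apply_inj[OF g True c(1)] chain_map_apply_inj[OF g True c(2)] c(3) by simp
    next
      case False
      then show ?thesis using chains_on_zero[OF c(1)] chains_on_zero[OF c(2)] by simp
    qed
  qed
qed

lemma chain_map_iso_image:
  assumes g: "inj_on g (\<Union>F)"
  shows "chain_map g ` chains_on F = chains_on ((`) g ` F)"
proof (intro subset_antisym subsetI)
  fix c' assume "c' \<in> chain_map g ` chains_on F"
  then obtain c where c: "c \<in> chains_on F" "c' = chain_map g c" by blast
  show "c' \<in> chains_on ((`) g ` F)"
    unfolding c(2) chain_map_eq
    by (rule incidence_map_chains_on[OF c(1)]) (auto simp: maps_onto_def)
next
  fix c' assume c': "c' \<in> chains_on ((`) g ` F)"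
  define c where "c = restrict_chain F (\<lambda>\<sigma>. c' (g ` \<sigma>))"
  have c: "c \<in> chains_on F" unfolding c_def by (rule restrict_chain_in)
  have "chain_map g c \<tau> = c' \<tau>" for \<tau>
  proof (cases "\<tau> \<in> (`) g ` F")
    case True
    then obtain \<sigma> where "\<sigma> \<in> F" "\<tau> = g ` \<sigma>" by blast
    then show ?thesis using chain_map_apply_inj[OF g _ c] by (simp add: c_def restrict_chain_def)
  next
    case False
    have "chain_map g c \<in> chains_on ((`) g ` F)"
      unfolding chain_map_eq by (rule incidence_map_chains_on[OF c]) (auto simp: maps_onto_def)
    then show ?thesis using chains_on_zero[OF c' False] chains_on_zero[OF _ False] by simp
  qed
  then have "c' = chain_map g c" by (auto simp: fun_eq_iff)
  then show "c' \<in> chain_map g ` chains_on F" using c by blast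
qed

lemma simplices_iso:
  assumes "inj_on g (\<Union>K)"
  shows "simplices ((`) g ` K) q = (`) g ` simplices K q"
proof -
  have "card (g ` \<sigma>) = card \<sigma>" if "\<sigma> \<in> K" for \<sigma>
    by (rule card_image[OF inj_on_subset[OF assms]]) (use that in blast)
  then show ?thesis by (auto simp: simplices_def)
qed

lemma abstract_complex_iso:
  assumes "abstract_complex K"
  shows "abstract_complex ((`) g ` K)"
  unfolding abstract_complex_def
proof (intro conjI ballI allI impI)
  show "finite ((`) g ` K)" using abstract_complexD(1)[OF assms] by simp
  fix \<sigma>' assume "\<sigma>' \<in> (`) g ` K"
  then obtain \<sigma> where \<sigma>: "\<sigma> \<in> K" "\<sigma>' = g ` \<sigma>" by blast
  show "finite \<sigma>'" "\<sigma>' \<noteq> {}" using abstract_complexD(2,3)[OF assms \<sigma>(1)] \<sigma>(2) by auto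
  fix \<tau>' assume \<tau>': "\<tau>' \<subseteq> \<sigma>'" "\<tau>' \<noteq> {}"
  have eq: "\<tau>' = g ` (\<sigma> \<inter> g -` \<tau>')" using \<tau>'(1) \<sigma>(2) by blast
  then have "\<sigma> \<inter> g -` \<tau>' \<noteq> {}" using \<tau>'(2) by (metis image_empty)
  then have "\<sigma> \<inter> g -` \<tau>' \<in> K"
    by (intro abstract_complex_subset[OF assms \<sigma>(1)]) simp_all
  with eq show "\<tau>' \<in> (`) g ` K" by (rule image_eqI)
qed

text \<open>
  The vertex bijection \<open>g\<close> induces bijections of chains that commute with boundaries
  and with the two simplicial maps, so all cardinalities agree.
\<close>

theorem homology_image_dim_iso:
  fixes f :: "'v \<Rightarrow> 'v" and f' :: "'u \<Rightarrow> 'u" and g :: "'v \<Rightarrow> 'u"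
  assumes K: "abstract_complex K" and L: "abstract_complex L" and f: "simplicial_map f K L"
    and gK: "inj_on g (\<Union>K)" and gL: "inj_on g (\<Union>L)"
    and comm: "\<And>v. v \<in> \<Union>K \<Longrightarrow> f' (g v) = g (f v)"
  shows "homology_image_dim f' ((`) g ` K) ((`) g ` L) q = homology_image_dim f K L q"
proof -
  let ?K = "(`) g ` K" and ?L = "(`) g ` L"
  note K' = abstract_complex_iso[OF K, of g] and L' = abstract_complex_iso[OF L, of g]
  have f': "simplicial_map f' ?K ?L"
    unfolding simplicial_map_def
  proof
    fix \<sigma>' assume "\<sigma>' \<in> ?K"
    then obtain \<sigma> where \<sigma>: "\<sigma> \<in> K" "\<sigma>' = g ` \<sigma>" by blast
    have "f' ` \<sigma>' = g ` f ` \<sigma>"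
      unfolding \<sigma>(2) image_image using comm \<sigma>(1) by (intro image_cong) blast+
    then show "f' ` \<sigma>' \<in> ?L" using f \<sigma>(1) unfolding simplicial_map_def by blast
  qed
  have inj: "inj_on g (\<Union> (simplices K i))" "inj_on g (\<Union> (simplices L i))" for i
    by (rule inj_on_subset[OF gK], rule Union_mono, simp add: simplices_def)
       (rule inj_on_subset[OF gL], rule Union_mono, simp add: simplices_def)
  have chains: "chain_map g ` chains_on (simplices K i) = chains_on (simplices ?K i)"
    "chain_map g ` chains_on (simplices L i) = chains_on (simplices ?L i)" for i
    by (simp_all add: chain_map_iso_image[OF inj(1)] chain_map_iso_image[OF inj(2)]
        simplices_iso[OF gK] simplices_iso[OF gL])
  have bd: "chain_map g (boundary_map c) = boundary_map (chain_map g c)"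
    if "abstract_complex K0" "c \<in> chains_on (simplices K0 i)" for K0 c i
  proof (rule chain_map_boundary[OF chains_on_support[OF finite_simplices[OF that(1)] that(2)]])
    fix \<sigma> assume "c \<sigma> \<noteq> 0"
    then have "\<sigma> \<in> simplices K0 i" using that(2) unfolding chains_on_def by blast
    then show "finite \<sigma>" using abstract_complexD(2)[OF that(1)] unfolding simplices_def by blast
  qed
  have B: "boundaries ?L q = chain_map g ` boundaries L q"
    unfolding boundaries_eq[OF L] boundaries_eq[OF L'] chains(2)[symmetric] image_image
    by (rule image_cong[OF refl]) (simp add: bd[OF L])
  have Z: "cycles ?K q = chain_map g ` cycles K q"
  proof -
    have "boundary_map (chain_map g c) = 0 \<longleftrightarrow> boundary_map c = 0"
      if c: "c \<in> chains_on (simplices K q)" for c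
    proof -
      have s: "simplices K q \<subseteq> K" by (auto simp: simplices_def)
      have mem: "boundary_map c \<in> chains_on K" "0 \<in> chains_on K"
        using boundary_chains_on_complex[OF K] c chains_on_mono[OF s] chain_groupD(1)[OF chains_on_group] by blast+
      have "boundary_map (chain_map g c) = chain_map g (boundary_map c)" using bd[OF K c] by simp
      then show ?thesis
        using inj_on_eq_iff[OF chain_map_iso_inj[OF gK] mem] by (simp only: chain_map_zero)
    qed
    then show ?thesis
      unfolding cycles_eq[OF K] cycles_eq[OF K'] chains(1)[symmetric] by blast
  qed
  have fz: "chain_map f' (chain_map g z) = chain_map g (chain_map f z)" if "z \<in> cycles K q" for z
  proof -
    have z: "z \<in> chains_on (simplices K q)" using cycles_subset[OF K] that by blast
    have fin: "finite {\<sigma>. z \<sigma> \<noteq> 0}" by (rule chains_on_support[OF finite_simplices[OF K] z])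
    have "chain_map (f' \<circ> g) z = chain_map (g \<circ> f) z"
      unfolding chain_map_eq
    proof (rule incidence_map_cong)
      fix \<sigma> \<tau> assume "z \<sigma> \<noteq> 0"
      then have "\<sigma> \<in> K" using z unfolding chains_on_def simplices_def by blast
      then have "(f' \<circ> g) v = (g \<circ> f) v" if "v \<in> \<sigma>" for v using comm[of v] that by auto
      then show "maps_onto (f' \<circ> g) \<sigma> \<tau> \<longleftrightarrow> maps_onto (g \<circ> f) \<sigma> \<tau>"
        unfolding maps_onto_def using inj_on_cong[of \<sigma> "f' \<circ> g" "g \<circ> f"] image_cong[of \<sigma> \<sigma> "f' \<circ> g" "g \<circ> f"]
        by simp
    qed
    then show ?thesis by (simp only: chain_map_comp[OF fin])
  qed
  have W: "image_group f' ?K ?L q = chain_map g ` image_group f K L q"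
  proof -
    have add: "chain_map g (b + chain_map f z) = chain_map g b + chain_map f' (chain_map g z)"
      if "b \<in> boundaries L q" "z \<in> cycles K q" for b z
    proof -
      have "chain_map g (b + chain_map f z) = chain_map g b + chain_map g (chain_map f z)"
        using that boundaries_subset[OF L, of q] chain_map_chains_on[OF f, of z q] cycles_subset[OF K, of q]
        by (intro chain_map_add[OF finite_simplices[OF L, of q]]) blast+
      then show ?thesis by (simp add: fz[OF that(2)])
    qed
    show ?thesis
      unfolding image_group_def B Z
    proof (intro subset_antisym subsetI)
      fix x assume "x \<in> sumset (chain_map g ` boundaries L q) (chain_map f' ` chain_map g ` cycles K q)"
      then obtain b z where "b \<in> boundaries L q" "z \<in> cycles K q" "x = chain_map g b + chain_map f' (chain_map g z)"
        by (elim sumsetE imageE) blast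
      then show "x \<in> chain_map g ` sumset (boundaries L q) (chain_map f ` cycles K q)"
        using add by (metis imageI sumsetI)
    next
      fix x assume "x \<in> chain_map g ` sumset (boundaries L q) (chain_map f ` cycles K q)"
      then obtain b z where "b \<in> boundaries L q" "z \<in> cycles K q" "x = chain_map g (b + chain_map f z)"
        by (elim sumsetE imageE) blast
      then show "x \<in> sumset (chain_map g ` boundaries L q) (chain_map f' ` chain_map g ` cycles K q)"
        using add by (metis imageI sumsetI)
    qed
  qed
  have injL: "inj_on (chain_map g) (chains_on (simplices L q))" by (rule chain_map_iso_inj[OF inj(2)])
  have cB: "card (boundaries ?L q) = card (boundaries L q)"
    unfolding B by (rule card_image[OF inj_on_subset[OF injL boundaries_subset[OF L]]])
  have cW: "card (image_group f' ?K ?L q) = card (image_group f K L q)"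
    unfolding W by (rule card_image[OF inj_on_subset[OF injL image_group_subset[OF K L f]]])
  have "2 ^ homology_image_dim f' ?K ?L q * card (boundaries L q)
      = 2 ^ homology_image_dim f K L q * card (boundaries L q)"
    using homology_image_dim_card[OF K' L' f', of q] homology_image_dim_card[OF K L f, of q] cB cW by simp
  then have "(2::nat) ^ homology_image_dim f' ?K ?L q = 2 ^ homology_image_dim f K L q"
    using card_boundaries_pos[OF L, of q] by simp
  then show ?thesis by (rule power_inject_exp[THEN iffD1, rotated]) simp
qed

section \<open>The lexicographic order\<close>

lemma lex_less_irrefl: "\<not> lex_less x x"
  by (simp add: lex_less_def)

lemma lex_less_trans:
  assumes "lex_less x y" "lex_less y z"
  shows "lex_less x z"
proof -
  obtain i where i: "x $ i < y $ i" "\<forall>l<i. x $ l = y $ l" using assms(1) by (auto simp: lex_less_def)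
  obtain j where j: "y $ j < z $ j" "\<forall>l<j. y $ l = z $ l" using assms(2) by (auto simp: lex_less_def)
  show ?thesis
    unfolding lex_less_def
  proof (intro exI conjI allI impI)
    show "x $ min i j < z $ min i j"
      using i j by (cases i j rule: linorder_cases) (auto simp: min_def)
    show "x $ l = z $ l" if "l < min i j" for l using that i j by auto
  qed
qed

lemma lex_less_total:
  fixes x y :: "real ^ 'n::{finite,linorder}"
  assumes "x \<noteq> y" shows "lex_less x y \<or> lex_less y x"
proof -
  let ?D = "{i. x $ i \<noteq> y $ i}"
  have D: "?D \<noteq> {}" using assms by (auto simp: vec_eq_iff)
  define i where "i = Min ?D"
  have i: "i \<in> ?D" unfolding i_def by (rule Min_in) (use D in auto)
  have below: "x $ j = y $ j" if "j < i" for j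
  proof (rule ccontr)
    assume "x $ j \<noteq> y $ j"
    then have "i \<le> j" unfolding i_def by (intro Min_le) auto
    then show False using \<open>j < i\<close> by simp
  qed
  show ?thesis
    using i below unfolding lex_less_def by (metis (mono_tags) mem_Collect_eq linorder_neqE)
qed

lemma lex_smallest_subset: "lex_smallest k \<phi> \<subseteq> \<phi>"
  by (auto simp: lex_smallest_def)

text \<open>
  The rank of an element, the number of smaller ones, is an injection of \<open>\<phi>\<close>
  into the numbers below \<open>card \<phi>\<close>, hence a bijection; \<open>k\<close> elements
  have rank below \<open>k\<close>.
\<close>

lemma card_lex_smallest:
  assumes fin: "finite \<phi>" and k: "k \<le> card \<phi>"
  shows "card (lex_smallest k \<phi>) = k"
proof -
  define rank where "rank x = card {y \<in> \<phi>. lex_less y x}" for x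
  have less: "rank x < rank y" if "x \<in> \<phi>" "lex_less x y" for x y
    unfolding rank_def
  proof (rule psubset_card_mono)
    show "{z \<in> \<phi>. lex_less z x} \<subset> {z \<in> \<phi>. lex_less z y}"
      using that lex_less_trans lex_less_irrefl by blast
  qed (use fin in simp)
  have inj: "inj_on rank \<phi>"
    by (rule inj_onI) (metis less lex_less_total less_irrefl)
  have "rank x < card \<phi>" if "x \<in> \<phi>" for x
    unfolding rank_def using that lex_less_irrefl[of x] fin by (intro psubset_card_mono) auto
  then have "rank ` \<phi> = {..<card \<phi>}"
    using inj by (intro card_subset_eq) (auto simp: card_image)
  then have "bij_betw rank \<phi> {..<card \<phi>}" using inj by (simp add: bij_betw_def)
  have "rank ` (lex_smallest k \<phi>) = {..<k}"
  proof
    show "rank ` lex_smallest k \<phi> \<subseteq> {..<k}" by (auto simp: lex_smallest_def rank_def)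
    show "{..<k} \<subseteq> rank ` lex_smallest k \<phi>"
    proof
      fix m assume m: "m \<in> {..<k}"
      then have "m \<in> rank ` \<phi>" using k \<open>rank ` \<phi> = {..<card \<phi>}\<close> by auto
      then obtain x where "x \<in> \<phi>" "m = rank x" by blast
      then show "m \<in> rank ` lex_smallest k \<phi>" using m by (auto simp: lex_smallest_def rank_def)
    qed
  qed
  moreover have "inj_on rank (lex_smallest k \<phi>)" by (rule inj_on_subset[OF inj lex_smallest_subset])
  ultimately show ?thesis by (metis card_image card_lessThan)
qed

lemma lex_smallest_image:
  assumes inj: "inj_on \<gamma> \<phi>" and mono: "\<And>x y. x \<in> \<phi> \<Longrightarrow> y \<in> \<phi> \<Longrightarrow> lex_less (\<gamma> x) (\<gamma> y) \<longleftrightarrow> lex_less x y"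
  shows "lex_smallest k (\<gamma> ` \<phi>) = \<gamma> ` lex_smallest k \<phi>"
proof -
  have "card {y \<in> \<gamma> ` \<phi>. lex_less y (\<gamma> x)} = card {y \<in> \<phi>. lex_less y x}" if "x \<in> \<phi>" for x
  proof -
    have "{y \<in> \<gamma> ` \<phi>. lex_less y (\<gamma> x)} = \<gamma> ` {y \<in> \<phi>. lex_less y x}" using mono that by auto
    moreover have "inj_on \<gamma> {y \<in> \<phi>. lex_less y x}" by (rule inj_on_subset[OF inj]) auto
    ultimately show ?thesis by (simp add: card_image)
  qed
  then show ?thesis by (auto simp: lex_smallest_def)
qed

section \<open>Enclosing balls and multicover complexes\<close>

text \<open>
  The condition behind the Cech radius, freed from the choice of a least radius.
\<close>

definition enclosed :: "real \<Rightarrow> 'a::metric_space set \<Rightarrow> bool" where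
  "enclosed t \<sigma> \<longleftrightarrow> (\<exists>c. \<forall>x\<in>\<sigma>. dist x c \<le> t)"

text \<open>
  The distance to the farthest point of \<open>\<sigma>\<close> is a continuous function of the
  centre. Outside a large ball it exceeds its value at a point of \<open>\<sigma>\<close>, so its
  minimum over the ball is a global one.
\<close>

lemma enclosing_ball_attained:
  fixes \<sigma> :: "(real ^ 'n::finite) set"
  assumes fin: "finite \<sigma>" and ne: "\<sigma> \<noteq> {}"
  shows "\<exists>t\<ge>0. enclosed t \<sigma> \<and> (\<forall>s. enclosed s \<sigma> \<longrightarrow> t \<le> s)"
proof -
  define F where "F c = Max ((\<lambda>x. dist x c) ` \<sigma>)" for c
  have cont: "continuous_on UNIV (\<lambda>c. Max ((\<lambda>x. dist x c) ` \<sigma>))"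
    using fin ne
  proof (induction \<sigma> rule: finite_ne_induct)
    case (singleton x)
    show ?case by (simp add: continuous_intros)
  next
    case (insert x \<sigma>)
    then show ?case by (simp add: continuous_intros)
  qed
  have F: "dist x c \<le> F c" if "x \<in> \<sigma>" for x c
    unfolding F_def using that fin by (intro Max_ge) auto
  have F_le: "F c \<le> t" if "\<forall>x\<in>\<sigma>. dist x c \<le> t" for c t
    unfolding F_def using that fin ne by (intro Max.boundedI) auto
  obtain x0 where x0: "x0 \<in> \<sigma>" using ne by blast
  have "\<exists>c\<in>cball x0 (F x0). \<forall>y\<in>cball x0 (F x0). F c \<le> F y"
  proof (rule continuous_attains_inf)
    show "cball x0 (F x0) \<noteq> {}" using F[OF x0, of x0] by simp
    show "continuous_on (cball x0 (F x0)) F"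
      using cont continuous_on_subset unfolding F_def by blast
  qed simp
  then obtain c where c: "\<And>y. y \<in> cball x0 (F x0) \<Longrightarrow> F c \<le> F y" "c \<in> cball x0 (F x0)" by blast
  have min: "F c \<le> F y" for y
  proof (cases "y \<in> cball x0 (F x0)")
    case False
    then have "F x0 < F y" using F[OF x0, of y] by simp
    moreover have "x0 \<in> cball x0 (F x0)" using F[OF x0, of x0] by simp
    ultimately show ?thesis using c(1)[of x0] by linarith
  qed (use c in blast)
  have "0 \<le> F c" using F[OF x0, of c] zero_le_dist[of x0 c] by linarith
  moreover have "enclosed (F c) \<sigma>" unfolding enclosed_def using F by blast
  moreover have "F c \<le> s" if enc: "enclosed s \<sigma>" for s
  proof -
    obtain y where "\<forall>x\<in>\<sigma>. dist x y \<le> s" using enc by (auto simp: enclosed_def)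
    then show ?thesis using min[of y] F_le[of y s] by linarith
  qed
  ultimately show ?thesis by blast
qed

lemma cech_radius_le_iff:
  fixes \<sigma> :: "(real ^ 'n::finite) set"
  assumes fin: "finite \<sigma>" and ne: "\<sigma> \<noteq> {}"
  shows "cech_radius \<sigma> \<le> r \<longleftrightarrow> enclosed r \<sigma>"
proof -
  obtain t where t: "t \<ge> 0" "enclosed t \<sigma>" "\<And>s. enclosed s \<sigma> \<Longrightarrow> t \<le> s"
    using enclosing_ball_attained[OF assms] by blast
  have eq: "(\<Inter>x\<in>\<sigma>. cball x s) \<noteq> {} \<longleftrightarrow> enclosed s \<sigma>" for s
  proof -
    have "c \<in> (\<Inter>x\<in>\<sigma>. cball x s) \<longleftrightarrow> (\<forall>x\<in>\<sigma>. dist x c \<le> s)" for c by simp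
    then show ?thesis unfolding enclosed_def by blast
  qed
  have "cech_radius \<sigma> = t"
    unfolding cech_radius_def eq by (rule Least_equality) (use t in blast)+
  moreover have "enclosed r \<sigma>" if "t \<le> r"
  proof -
    obtain c where "\<forall>x\<in>\<sigma>. dist x c \<le> t" using t(2) by (auto simp: enclosed_def)
    then show ?thesis using that unfolding enclosed_def by (meson order_trans)
  qed
  ultimately show ?thesis using t(3) by blast
qed

lemma enclosed_subset: "enclosed t \<sigma> \<Longrightarrow> \<tau> \<subseteq> \<sigma> \<Longrightarrow> enclosed t \<tau>"
  unfolding enclosed_def by blast

lemma enclosed_mono: "enclosed t \<sigma> \<Longrightarrow> t \<le> s \<Longrightarrow> enclosed s \<sigma>"
  unfolding enclosed_def by (meson order_trans)

lemma enclosed_dist: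
  assumes "enclosed t \<sigma>" "x \<in> \<sigma>" "y \<in> \<sigma>" shows "dist x y \<le> 2 * t"
proof -
  obtain c where "dist x c \<le> t" "dist y c \<le> t" using assms by (auto simp: enclosed_def)
  then show ?thesis using dist_triangle2[of x y c] by linarith
qed

lemma Mult_iff:
  assumes "k \<ge> 1"
  shows "\<Phi> \<in> Mult r k P \<longleftrightarrow> finite \<Phi> \<and> \<Phi> \<noteq> {} \<and> (\<forall>\<phi>\<in>\<Phi>. \<phi> \<subseteq> P \<and> finite \<phi> \<and> card \<phi> = k) \<and> enclosed r (\<Union>\<Phi>)"
    (is "_ \<longleftrightarrow> ?R")
proof -
  have *: "\<Union>\<Phi> \<in> Cech r P \<longleftrightarrow> enclosed r (\<Union>\<Phi>)"
    if \<Phi>: "finite \<Phi>" "\<Phi> \<noteq> {}" "\<forall>\<phi>\<in>\<Phi>. \<phi> \<subseteq> P \<and> finite \<phi> \<and> card \<phi> = k"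
  proof -
    obtain \<phi> where "\<phi> \<in> \<Phi>" using \<Phi>(2) by blast
    then have "card \<phi> \<noteq> 0" using \<Phi>(3) assms by auto
    then have "\<phi> \<noteq> {}" by auto
    then have ne: "\<Union>\<Phi> \<noteq> {}" using \<open>\<phi> \<in> \<Phi>\<close> by blast
    have fin: "finite (\<Union>\<Phi>)" using \<Phi> by auto
    have "\<Union>\<Phi> \<subseteq> P" using \<Phi>(3) by blast
    then show ?thesis using ne fin cech_radius_le_iff[OF fin ne] by (simp add: Cech_def)
  qed
  show ?thesis unfolding Mult_def mem_Collect_eq using * by blast
qed

lemma finite_Mult: "finite P \<Longrightarrow> finite (Mult r k P)"
  by (rule finite_subset[of _ "Pow (Pow P)"]) (auto simp: Mult_def)

lemma Mult_complex:
  assumes "finite P" "k \<ge> 1"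
  shows "abstract_complex (Mult r k P)"
  unfolding abstract_complex_def
proof (intro conjI ballI allI impI)
  show "finite (Mult r k P)" by (rule finite_Mult[OF assms(1)])
  fix \<Phi> assume \<Phi>: "\<Phi> \<in> Mult r k P"
  then show "finite \<Phi>" "\<Phi> \<noteq> {}" by (auto simp: Mult_def)
  fix \<Psi> assume \<Psi>: "\<Psi> \<subseteq> \<Phi>" "\<Psi> \<noteq> {}"
  have "\<Union>\<Psi> \<subseteq> \<Union>\<Phi>" using \<Psi>(1) by blast
  then show "\<Psi> \<in> Mult r k P"
    using \<Phi> \<Psi> finite_subset[OF \<Psi>(1)] enclosed_subset[of r "\<Union>\<Phi>" "\<Union>\<Psi>"]
    unfolding Mult_iff[OF assms(2)] by blast
qed

lemma Mult_mono: "P \<subseteq> P' \<Longrightarrow> k \<ge> 1 \<Longrightarrow> Mult r k P \<subseteq> Mult r k P'"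
  unfolding subset_iff by (simp only: Mult_iff) blast

text \<open>
  Passing to subsets shrinks the union of the vertices of a simplex, so an enclosing ball remains
  one.
\<close>

lemma lex_smallest_simplicial:
  assumes "P \<subseteq> P'" "r \<le> r'" "k' \<le> k" "k' \<ge> 1"
  shows "simplicial_map (lex_smallest k') (Mult r k P) (Mult r' k' P')"
  unfolding simplicial_map_def
proof
  have k: "k \<ge> 1" using assms by linarith
  fix \<Phi> assume \<Phi>: "\<Phi> \<in> Mult r k P"
  have sub: "\<Union> (lex_smallest k' ` \<Phi>) \<subseteq> \<Union>\<Phi>" using lex_smallest_subset by fast
  have "enclosed r (\<Union>\<Phi>)" using \<Phi> unfolding Mult_iff[OF k] by blast
  then have "enclosed r' (\<Union> (lex_smallest k' ` \<Phi>))"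
    by (rule enclosed_mono[OF enclosed_subset[OF _ sub] assms(2)])
  moreover have "\<psi> \<subseteq> P' \<and> finite \<psi> \<and> card \<psi> = k'" if \<psi>: "\<psi> \<in> lex_smallest k' ` \<Phi>" for \<psi>
  proof -
    obtain \<phi> where \<phi>: "\<phi> \<in> \<Phi>" "\<psi> = lex_smallest k' \<phi>" using \<psi> by blast
    then have *: "\<phi> \<subseteq> P" "finite \<phi>" "card \<phi> = k" using \<Phi> unfolding Mult_iff[OF k] by blast+
    then show ?thesis
      using \<phi>(2) lex_smallest_subset[of k' \<phi>] card_lex_smallest[of \<phi> k'] assms finite_subset by auto
  qed
  ultimately show "lex_smallest k' ` \<Phi> \<in> Mult r' k' P'"
    using \<Phi> unfolding Mult_iff[OF assms(4)] Mult_iff[OF k] by blast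
qed

section \<open>Locality of persistent Betti numbers\<close>

text \<open>
  The two index sets are kept separate: \<open>P\<close> holds the points admitted at the smaller
  and \<open>P'\<close> those admitted at the larger filtration index.
\<close>

definition multicover_betti :: "real \<Rightarrow> real \<Rightarrow> nat \<Rightarrow> nat \<Rightarrow> nat \<Rightarrow>
    (real ^ 'n::{finite,linorder}) set \<Rightarrow> (real ^ 'n::{finite,linorder}) set \<Rightarrow> nat" where
  "multicover_betti r r' k k' q P P' =
     homology_image_dim (lex_smallest k') (Mult r k P) (Mult r' k' P') q"

text \<open>
  A simplex with \<open>q + 1\<close> vertices of \<open>k\<close> points each is determined by
  \<open>k * (q + 1)\<close> choices of points; a polynomial bound is essential because only
  polynomial moments of the number of points are available.
\<close>

lemma card_simplices_le_power:
  assumes "finite A" "k \<ge> 1"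
  shows "finite {\<Phi>. (\<forall>\<phi>\<in>\<Phi>. \<phi> \<subseteq> A \<and> card \<phi> = k) \<and> card \<Phi> = Suc q}"
    "card {\<Phi>. (\<forall>\<phi>\<in>\<Phi>. \<phi> \<subseteq> A \<and> card \<phi> = k) \<and> card \<Phi> = Suc q} \<le> card A ^ (k * Suc q)"
proof -
  have le: "n choose m \<le> n ^ m" for n m :: nat
    by (cases "m \<le> n") (auto simp: binomial_le_pow binomial_eq_0)
  let ?S = "{\<phi>. \<phi> \<subseteq> A \<and> card \<phi> = k}"
  have S: "finite ?S" using assms(1) by simp
  have eq: "{\<Phi>. (\<forall>\<phi>\<in>\<Phi>. \<phi> \<subseteq> A \<and> card \<phi> = k) \<and> card \<Phi> = Suc q} = {\<Phi>. \<Phi> \<subseteq> ?S \<and> card \<Phi> = Suc q}"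
    by blast
  show "finite {\<Phi>. (\<forall>\<phi>\<in>\<Phi>. \<phi> \<subseteq> A \<and> card \<phi> = k) \<and> card \<Phi> = Suc q}"
    unfolding eq by (rule finite_subset[OF _ finite_Pow_iff[THEN iffD2, OF S]]) blast
  have "card {\<Phi>. \<Phi> \<subseteq> ?S \<and> card \<Phi> = Suc q} = (card A choose k) choose Suc q"
    by (simp only: n_subsets[OF S] n_subsets[OF assms(1)])
  also have "\<dots> \<le> (card A choose k) ^ Suc q" by (rule le)
  also have "\<dots> \<le> (card A ^ k) ^ Suc q" by (intro power_mono le) simp
  also have "\<dots> = card A ^ (k * Suc q)" by (simp only: power_mult)
  finally show "card {\<Phi>. (\<forall>\<phi>\<in>\<Phi>. \<phi> \<subseteq> A \<and> card \<phi> = k) \<and> card \<Phi> = Suc q} \<le> card A ^ (k * Suc q)"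
    unfolding eq .
qed

lemma power_le_power_nat:
  fixes c :: nat
  assumes "1 \<le> a" "a \<le> b" shows "c ^ a \<le> c ^ b"
  using assms by (cases "c = 0") (auto intro: power_increasing simp: power_0_left)

text \<open>
  Choose a point \<open>x\<close> of a simplex that lies in no region. All points of the simplex
  have distance at most \<open>2 * r\<close> from \<open>x\<close> and so belong to the
  neighbourhood of the cell of \<open>x\<close>. That cell must be in \<open>U\<close>, because
  the neighbourhoods of all other cells are contained in a region.
\<close>

lemma crossing_simplices_bound:
  fixes Q :: "(real ^ 'n::{finite,linorder}) set"
  assumes fin: "finite Q" and k: "k \<ge> 1" and r: "2 * r \<le> \<rho>"
    and fU: "finite U"
    and nbh: "\<And>x y. x \<in> Q \<Longrightarrow> y \<in> Q \<Longrightarrow> dist x y \<le> \<rho> \<Longrightarrow> y \<in> N (cell x)"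
    and good: "\<And>x. x \<in> Q \<Longrightarrow> cell x \<notin> U \<Longrightarrow> \<exists>j\<in>J. N (cell x) \<inter> Q \<subseteq> \<Lambda> j"
    and p: "k * Suc q \<le> p"
  shows "card (simplices (Mult r k Q - (\<Union>j\<in>J. Mult r k (Q \<inter> \<Lambda> j))) q) \<le> (\<Sum>u\<in>U. card (Q \<inter> N u) ^ p)"
proof -
  let ?S = "\<lambda>u. {\<Phi>. (\<forall>\<phi>\<in>\<Phi>. \<phi> \<subseteq> Q \<inter> N u \<and> card \<phi> = k) \<and> card \<Phi> = Suc q}"
  have finN: "finite (Q \<inter> N u)" for u using fin by simp
  have "simplices (Mult r k Q - (\<Union>j\<in>J. Mult r k (Q \<inter> \<Lambda> j))) q \<subseteq> (\<Union>u\<in>U. ?S u)"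
  proof
    fix \<Phi> assume "\<Phi> \<in> simplices (Mult r k Q - (\<Union>j\<in>J. Mult r k (Q \<inter> \<Lambda> j))) q"
    then have \<Phi>: "\<Phi> \<in> Mult r k Q" "card \<Phi> = Suc q" "\<And>j. j \<in> J \<Longrightarrow> \<Phi> \<notin> Mult r k (Q \<inter> \<Lambda> j)"
      by (auto simp: simplices_def)
    then have *: "finite \<Phi>" "\<Phi> \<noteq> {}" "\<forall>\<phi>\<in>\<Phi>. \<phi> \<subseteq> Q \<and> finite \<phi> \<and> card \<phi> = k" "enclosed r (\<Union>\<Phi>)"
      unfolding Mult_iff[OF k] by blast+
    obtain \<phi> where "\<phi> \<in> \<Phi>" using *(2) by blast
    moreover have "\<phi> \<noteq> {}" using *(3) k \<open>\<phi> \<in> \<Phi>\<close> by force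
    ultimately obtain x where x: "x \<in> \<Union>\<Phi>" by blast
    have UQ: "\<Union>\<Phi> \<subseteq> Q" using *(3) by blast
    have sub: "\<Union>\<Phi> \<subseteq> Q \<inter> N (cell x)"
    proof
      fix y assume y: "y \<in> \<Union>\<Phi>"
      have "dist x y \<le> \<rho>" using enclosed_dist[OF *(4) x y] r by linarith
      then show "y \<in> Q \<inter> N (cell x)" using nbh[of x y] x y UQ by blast
    qed
    have "cell x \<in> U"
    proof (rule ccontr)
      assume "cell x \<notin> U"
      then obtain j where j: "j \<in> J" "N (cell x) \<inter> Q \<subseteq> \<Lambda> j" using good[of x] x UQ by blast
      then have "\<Union>\<Phi> \<subseteq> Q \<inter> \<Lambda> j" using sub by blast
      then have "\<Phi> \<in> Mult r k (Q \<inter> \<Lambda> j)" using * unfolding Mult_iff[OF k] by blast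
      then show False using \<Phi>(3)[OF j(1)] by blast
    qed
    moreover have "\<Phi> \<in> ?S (cell x)" using sub *(3) \<Phi>(2) by blast
    ultimately show "\<Phi> \<in> (\<Union>u\<in>U. ?S u)" by blast
  qed
  then have "card (simplices (Mult r k Q - (\<Union>j\<in>J. Mult r k (Q \<inter> \<Lambda> j))) q) \<le> card (\<Union>u\<in>U. ?S u)"
    using fU card_simplices_le_power(1)[OF finN k] by (intro card_mono) auto
  also have "\<dots> \<le> (\<Sum>u\<in>U. card (?S u))" by (rule card_UN_le[OF fU])
  also have "\<dots> \<le> (\<Sum>u\<in>U. card (Q \<inter> N u) ^ p)"
  proof (rule sum_mono)
    fix u
    have "1 * 1 \<le> k * Suc q" using k by (intro mult_le_mono) auto
    then have "card (Q \<inter> N u) ^ (k * Suc q) \<le> card (Q \<inter> N u) ^ p"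
      by (intro power_le_power_nat p) simp
    then show "card (?S u) \<le> card (Q \<inter> N u) ^ p"
      using card_simplices_le_power(2)[OF finN k, of u q] by linarith
  qed
  finally show ?thesis .
qed

text \<open>
  Compare the complexes with the disjoint unions of the complexes of the regions \<open>\<Lambda>
  j\<close>. Here \<open>cell\<close> discretises space, \<open>N u\<close> is a neighbourhood of
  the cell \<open>u\<close> and \<open>U\<close> collects the cells near the borders of the
  regions. With \<open>J\<close> empty the estimate is an upper bound for the Betti number itself.
\<close>

theorem multicover_betti_localisation:
  fixes Q :: "(real ^ 'n::{finite,linorder}) set"
  assumes fin: "finite Q'" and QQ: "Q \<subseteq> Q'" and k: "1 \<le> k'" "k' \<le> k" and r: "r \<le> r'" "2 * r' \<le> \<rho>"
    and fU: "finite U" and fJ: "finite J"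
    and disj: "\<And>i j. i \<in> J \<Longrightarrow> j \<in> J \<Longrightarrow> i \<noteq> j \<Longrightarrow> \<Lambda> i \<inter> \<Lambda> j = {}"
    and nbh: "\<And>x y. x \<in> Q' \<Longrightarrow> y \<in> Q' \<Longrightarrow> dist x y \<le> \<rho> \<Longrightarrow> y \<in> N (cell x)"
    and good: "\<And>x. x \<in> Q' \<Longrightarrow> cell x \<notin> U \<Longrightarrow> \<exists>j\<in>J. N (cell x) \<inter> Q' \<subseteq> \<Lambda> j"
  shows "\<bar>real (multicover_betti r r' k k' q Q Q') - (\<Sum>j\<in>J. real (multicover_betti r r' k k' q (Q \<inter> \<Lambda> j) (Q' \<inter> \<Lambda> j)))\<bar>
    \<le> (\<Sum>u\<in>U. 2 * real (card (Q' \<inter> N u)) ^ (k * (q + 2)))"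
proof -
  let ?f = "lex_smallest k'"
  let ?K = "Mult r k Q" and ?L = "Mult r' k' Q'"
  let ?Kj = "\<lambda>j. Mult r k (Q \<inter> \<Lambda> j)" and ?Lj = "\<lambda>j. Mult r' k' (Q' \<inter> \<Lambda> j)"
  have k1: "k \<ge> 1" using k by linarith
  have finQ: "finite Q" using finite_subset[OF QQ fin] .
  have disjM: "Mult s l (A \<inter> \<Lambda> i) \<inter> Mult s l (A \<inter> \<Lambda> j) = {}"
    if "i \<in> J" "j \<in> J" "i \<noteq> j" "l \<ge> 1" for s l A i j
  proof -
    have False if both: "\<Phi> \<in> Mult s l (A \<inter> \<Lambda> i)" "\<Phi> \<in> Mult s l (A \<inter> \<Lambda> j)" for \<Phi>
    proof -
      have ne: "\<Phi> \<noteq> {}"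
        using both(1) unfolding Mult_iff[OF \<open>l \<ge> 1\<close>] by (elim conjE)
      have i: "\<forall>\<phi>\<in>\<Phi>. \<phi> \<subseteq> A \<inter> \<Lambda> i \<and> finite \<phi> \<and> card \<phi> = l"
        using both(1) unfolding Mult_iff[OF \<open>l \<ge> 1\<close>] by (elim conjE)
      have j: "\<forall>\<phi>\<in>\<Phi>. \<phi> \<subseteq> A \<inter> \<Lambda> j \<and> finite \<phi> \<and> card \<phi> = l"
        using both(2) unfolding Mult_iff[OF \<open>l \<ge> 1\<close>] by (elim conjE)
      obtain \<phi> where \<phi>: "\<phi> \<in> \<Phi>" using ne by blast
      then have "\<phi> \<subseteq> \<Lambda> i \<inter> \<Lambda> j" "card \<phi> = l" using i j by blast+
      then show False using disj[OF \<open>i \<in> J\<close> \<open>j \<in> J\<close> \<open>i \<noteq> j\<close>] \<open>l \<ge> 1\<close> by simp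
    qed
    then show ?thesis by blast
  qed
  have Kc: "abstract_complex ?K" "abstract_complex ?L"
    by (intro Mult_complex finQ fin k1 k)+
  have Kjc: "abstract_complex (?Kj j)" "abstract_complex (?Lj j)" for j
    by (intro Mult_complex finite_Int disjI1 finQ fin k1 k)+
  have f: "simplicial_map ?f ?K ?L" by (rule lex_smallest_simplicial[OF QQ r(1) k(2,1)])
  have fj: "simplicial_map ?f (?Kj j) (?Lj j)" for j
    by (rule lex_smallest_simplicial[OF _ r(1) k(2,1)]) (use QQ in blast)
  have un: "abstract_complex (\<Union>j\<in>J. ?Kj j)" "abstract_complex (\<Union>j\<in>J. ?Lj j)"
    "simplicial_map ?f (\<Union>j\<in>J. ?Kj j) (\<Union>j\<in>J. ?Lj j)"
    "homology_image_dim ?f (\<Union>j\<in>J. ?Kj j) (\<Union>j\<in>J. ?Lj j) q = (\<Sum>j\<in>J. homology_image_dim ?f (?Kj j) (?Lj j) q)"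
    using homology_image_dim_UNION[of J ?Kj ?Lj ?f q, OF fJ Kjc(1) disjM Kjc(2) disjM fj] k1 k(1) by auto
  have sub: "(\<Union>j\<in>J. ?Kj j) \<subseteq> ?K" "(\<Union>j\<in>J. ?Lj j) \<subseteq> ?L"
    by (intro UN_least Mult_mono k1 k(1) Int_lower1)+
  have "\<bar>real (homology_image_dim ?f ?K ?L q) - real (homology_image_dim ?f (\<Union>j\<in>J. ?Kj j) (\<Union>j\<in>J. ?Lj j) q)\<bar>
    \<le> real (card (simplices (?K - (\<Union>j\<in>J. ?Kj j)) q) + card (simplices (?L - (\<Union>j\<in>J. ?Lj j)) (Suc q)))"
    by (rule homology_image_dim_subcomplex[OF Kc(1) un(1) sub(1) Kc(2) un(2) sub(2) f un(3)])
  also have "\<dots> \<le> real ((\<Sum>u\<in>U. card (Q' \<inter> N u) ^ (k * (q + 2))) + (\<Sum>u\<in>U. card (Q' \<inter> N u) ^ (k * (q + 2))))"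
  proof (intro of_nat_mono add_mono)
    have "card (simplices (?K - (\<Union>j\<in>J. ?Kj j)) q) \<le> (\<Sum>u\<in>U. card (Q \<inter> N u) ^ (k * (q + 2)))"
    proof (rule crossing_simplices_bound[where \<rho> = \<rho> and cell = cell])
      fix x assume "x \<in> Q" "cell x \<notin> U"
      then obtain j where "j \<in> J" "N (cell x) \<inter> Q' \<subseteq> \<Lambda> j" using good[of x] QQ by blast
      then show "\<exists>j\<in>J. N (cell x) \<inter> Q \<subseteq> \<Lambda> j" using QQ by blast
    qed (use finQ k1 r fU nbh QQ in auto)
    also have "\<dots> \<le> (\<Sum>u\<in>U. card (Q' \<inter> N u) ^ (k * (q + 2)))"
      by (intro sum_mono power_mono card_mono) (use fin QQ in auto)
    finally show "card (simplices (?K - (\<Union>j\<in>J. ?Kj j)) q) \<le> (\<Sum>u\<in>U. card (Q' \<inter> N u) ^ (k * (q + 2)))" .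
    show "card (simplices (?L - (\<Union>j\<in>J. ?Lj j)) (Suc q)) \<le> (\<Sum>u\<in>U. card (Q' \<inter> N u) ^ (k * (q + 2)))"
    proof (rule crossing_simplices_bound[where \<rho> = \<rho> and cell = cell])
      \<comment> \<open>Simplices of the target have one vertex more, but their vertices are sets of at most the same size.\<close>
      show "k' * Suc (Suc q) \<le> k * (q + 2)" using k(2) by (intro mult_le_mono) auto
    qed (use fin k r fU nbh good in auto)
  qed
  also have "\<dots> = (\<Sum>u\<in>U. 2 * real (card (Q' \<inter> N u)) ^ (k * (q + 2)))"
    by (simp add: sum_distrib_left[symmetric])
  finally show ?thesis
    unfolding un(4) multicover_betti_def by simp
qed

lemma Mult_image:
  assumes inj: "inj_on \<gamma> Q" and k: "k \<ge> 1"
    and enc: "\<And>\<sigma>. \<sigma> \<subseteq> Q \<Longrightarrow> finite \<sigma> \<Longrightarrow> \<sigma> \<noteq> {} \<Longrightarrow> enclosed s (\<gamma> ` \<sigma>) \<longleftrightarrow> enclosed r \<sigma>"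
  shows "Mult s k (\<gamma> ` Q) = (`) ((`) \<gamma>) ` Mult r k Q"
proof -
  have card: "card (\<gamma> ` \<phi>) = card \<phi>" if "\<phi> \<subseteq> Q" for \<phi>
    by (rule card_image[OF inj_on_subset[OF inj that]])
  have enc': "enclosed s (\<Union> ((`) \<gamma> ` \<Phi>)) \<longleftrightarrow> enclosed r (\<Union>\<Phi>)"
    if \<Phi>: "finite \<Phi>" "\<Phi> \<noteq> {}" "\<forall>\<phi>\<in>\<Phi>. \<phi> \<subseteq> Q \<and> finite \<phi> \<and> card \<phi> = k" for \<Phi>
  proof -
    have "\<Union> ((`) \<gamma> ` \<Phi>) = \<gamma> ` \<Union>\<Phi>" by blast
    moreover have "\<Union>\<Phi> \<noteq> {}"
    proof -
      obtain \<phi> where "\<phi> \<in> \<Phi>" using \<Phi>(2) by blast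
      moreover have "\<phi> \<noteq> {}" using \<Phi>(3) k \<open>\<phi> \<in> \<Phi>\<close> by force
      ultimately show ?thesis by blast
    qed
    moreover have "\<Union>\<Phi> \<subseteq> Q" "finite (\<Union>\<Phi>)" using \<Phi> by auto
    ultimately show ?thesis using enc[of "\<Union>\<Phi>"] by simp
  qed
  show ?thesis
  proof (intro subset_antisym subsetI)
    fix \<Psi> assume \<Psi>: "\<Psi> \<in> Mult s k (\<gamma> ` Q)"
    define \<Phi> where "\<Phi> = (\<lambda>\<psi>. Q \<inter> \<gamma> -` \<psi>) ` \<Psi>"
    have \<psi>: "\<gamma> ` (Q \<inter> \<gamma> -` \<psi>) = \<psi>" if "\<psi> \<in> \<Psi>" for \<psi>
      using \<Psi> that unfolding Mult_iff[OF k] by blast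
    have eq: "(`) \<gamma> ` \<Phi> = \<Psi>" unfolding \<Phi>_def image_image using \<psi> by simp
    have "\<phi> \<subseteq> Q \<and> finite \<phi> \<and> card \<phi> = k" if "\<phi> \<in> \<Phi>" for \<phi>
    proof -
      obtain \<psi>' where \<psi>': "\<psi>' \<in> \<Psi>" "\<phi> = Q \<inter> \<gamma> -` \<psi>'" using \<open>\<phi> \<in> \<Phi>\<close> by (auto simp: \<Phi>_def)
      have sub: "\<phi> \<subseteq> Q" using \<psi>'(2) by blast
      have im: "\<gamma> ` \<phi> = \<psi>'" unfolding \<psi>'(2) by (rule \<psi>[OF \<psi>'(1)])
      have "finite \<psi>'" "card \<psi>' = k" using \<Psi> \<psi>'(1) unfolding Mult_iff[OF k] by blast+
      then show ?thesis
        using sub card[OF sub] im finite_imageD[of \<gamma> \<phi>] inj_on_subset[OF inj sub] by simp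
    qed
    then have \<Phi>: "finite \<Phi>" "\<Phi> \<noteq> {}" "\<forall>\<phi>\<in>\<Phi>. \<phi> \<subseteq> Q \<and> finite \<phi> \<and> card \<phi> = k"
      using \<Psi> unfolding Mult_iff[OF k] by (auto simp: \<Phi>_def)
    then have "\<Phi> \<in> Mult r k Q"
      using \<Psi> enc'[OF \<Phi>] unfolding Mult_iff[OF k] eq by blast
    then show "\<Psi> \<in> (`) ((`) \<gamma>) ` Mult r k Q" using eq by blast
  next
    fix \<Psi> assume "\<Psi> \<in> (`) ((`) \<gamma>) ` Mult r k Q"
    then obtain \<Phi> where eq: "\<Psi> = (`) \<gamma> ` \<Phi>" and "\<Phi> \<in> Mult r k Q" by blast
    then have \<Phi>: "finite \<Phi>" "\<Phi> \<noteq> {}" "\<forall>\<phi>\<in>\<Phi>. \<phi> \<subseteq> Q \<and> finite \<phi> \<and> card \<phi> = k" "enclosed r (\<Union>\<Phi>)"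
      unfolding Mult_iff[OF k] by blast+
    have "\<psi> \<subseteq> \<gamma> ` Q \<and> finite \<psi> \<and> card \<psi> = k" if mem: "\<psi> \<in> \<Psi>" for \<psi>
    proof -
      obtain \<phi> where "\<phi> \<in> \<Phi>" "\<psi> = \<gamma> ` \<phi>" using mem eq by blast
      moreover from this have "\<phi> \<subseteq> Q" "finite \<phi>" "card \<phi> = k" using \<Phi>(3) by blast+
      ultimately show ?thesis using card[of \<phi>] by (simp add: image_mono)
    qed
    moreover have "enclosed s (\<Union>\<Psi>)" unfolding eq using \<Phi>(4) enc'[OF \<Phi>(1-3)] by simp
    moreover have "finite \<Psi>" "\<Psi> \<noteq> {}" unfolding eq using \<Phi>(1,2) by simp_all
    ultimately show "\<Psi> \<in> Mult s k (\<gamma> ` Q)" unfolding Mult_iff[OF k] by simp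
  qed
qed

text \<open>
  The persistent Betti number depends only on the lexicographic order of the points and on which
  subsets fit into balls of the two radii.
\<close>

theorem multicover_betti_iso:
  fixes Q :: "(real ^ 'n::{finite,linorder}) set"
  assumes fin: "finite Q'" and QQ: "Q \<subseteq> Q'" and k: "1 \<le> k'" "k' \<le> k" and r: "r \<le> r'"
    and inj: "inj_on \<gamma> Q'"
    and mono: "\<And>x y. x \<in> Q' \<Longrightarrow> y \<in> Q' \<Longrightarrow> lex_less (\<gamma> x) (\<gamma> y) \<longleftrightarrow> lex_less x y"
    and enc: "\<And>\<sigma>. \<sigma> \<subseteq> Q \<Longrightarrow> finite \<sigma> \<Longrightarrow> \<sigma> \<noteq> {} \<Longrightarrow> enclosed s (\<gamma> ` \<sigma>) \<longleftrightarrow> enclosed r \<sigma>"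
    and enc': "\<And>\<sigma>. \<sigma> \<subseteq> Q' \<Longrightarrow> finite \<sigma> \<Longrightarrow> \<sigma> \<noteq> {} \<Longrightarrow> enclosed s' (\<gamma> ` \<sigma>) \<longleftrightarrow> enclosed r' \<sigma>"
  shows "multicover_betti s s' k k' q (\<gamma> ` Q) (\<gamma> ` Q') = multicover_betti r r' k k' q Q Q'"
proof -
  have k1: "k \<ge> 1" using k by linarith
  have inj': "inj_on ((`) \<gamma>) (Pow Q')" by (rule inj_on_image_Pow[OF inj])
  have sub: "\<Union> (Mult r k Q) \<subseteq> Pow Q'" "\<Union> (Mult r' k' Q') \<subseteq> Pow Q'"
    using QQ unfolding Mult_def by blast+
  have im: "Mult s k (\<gamma> ` Q) = (`) ((`) \<gamma>) ` Mult r k Q"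
    by (rule Mult_image[OF inj_on_subset[OF inj QQ] k1 enc])
  have im': "Mult s' k' (\<gamma> ` Q') = (`) ((`) \<gamma>) ` Mult r' k' Q'"
    by (rule Mult_image[OF inj k(1) enc'])
  show ?thesis
    unfolding multicover_betti_def im im'
  proof (rule homology_image_dim_iso)
    show "abstract_complex (Mult r k Q)" by (rule Mult_complex[OF finite_subset[OF QQ fin] k1])
    show "abstract_complex (Mult r' k' Q')" by (rule Mult_complex[OF fin k(1)])
    show "simplicial_map (lex_smallest k') (Mult r k Q) (Mult r' k' Q')"
      by (rule lex_smallest_simplicial[OF QQ r k(2,1)])
    show "inj_on ((`) \<gamma>) (\<Union> (Mult r k Q))" "inj_on ((`) \<gamma>) (\<Union> (Mult r' k' Q'))"
      by (rule inj_on_subset[OF inj'], rule sub)+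
    fix \<phi> assume "\<phi> \<in> \<Union> (Mult r k Q)"
    then have \<phi>: "\<phi> \<subseteq> Q'" using sub(1) by blast
    show "lex_smallest k' (\<gamma> ` \<phi>) = \<gamma> ` lex_smallest k' \<phi>"
      by (rule lex_smallest_image[OF inj_on_subset[OF inj \<phi>]]) (use mono \<phi> in blast)
  qed
qed

section \<open>Translation and rounding to a grid\<close>

lemma enclosed_translate: "enclosed r ((\<lambda>x. x + a) ` \<sigma>) \<longleftrightarrow> enclosed r \<sigma>" for a :: "'a::real_normed_vector"
proof
  assume "enclosed r \<sigma>"
  then obtain c where "\<forall>x\<in>\<sigma>. dist x c \<le> r" unfolding enclosed_def by blast
  then show "enclosed r ((\<lambda>x. x + a) ` \<sigma>)"
    unfolding enclosed_def by (intro exI[of _ "c + a"]) simp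
next
  assume "enclosed r ((\<lambda>x. x + a) ` \<sigma>)"
  then obtain c where c: "\<forall>x\<in>\<sigma>. dist (x + a) c \<le> r" unfolding enclosed_def by blast
  have "dist x (c - a) = dist (x + a) c" for x by (simp add: dist_norm algebra_simps)
  then show "enclosed r \<sigma>" unfolding enclosed_def using c by (intro exI[of _ "c - a"]) simp
qed

lemma multicover_betti_translate:
  assumes "finite Q'" "Q \<subseteq> Q'" "1 \<le> k'" "k' \<le> k" "r \<le> r'"
  shows "multicover_betti r r' k k' q ((\<lambda>x. x + a) ` Q) ((\<lambda>x. x + a) ` Q') = multicover_betti r r' k k' q Q Q'"
  by (rule multicover_betti_iso[OF assms]) (auto simp: enclosed_translate lex_less_def)

definition grid_round :: "nat \<Rightarrow> real ^ 'n::finite \<Rightarrow> real ^ 'n::finite" where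
  "grid_round j x = (\<chi> i. of_int \<lfloor>real (Suc j) * x $ i\<rfloor> / real (Suc j))"

text \<open>
  A bound for the Euclidean diameter of a grid cell, through the sum of the coordinates.
\<close>

definition grid_error :: "'n::finite itself \<Rightarrow> nat \<Rightarrow> real" where
  "grid_error _ j = real CARD('n) / real (Suc j)"

lemma grid_error_tendsto: "(\<lambda>j. grid_error TYPE('n::finite) j) \<longlonglongrightarrow> 0"
  unfolding grid_error_def by (rule LIMSEQ_Suc) (rule lim_const_over_n)

lemma dist_grid_round: "dist (grid_round j x) x \<le> grid_error TYPE('n) j" for x :: "real ^ 'n::finite"
proof -
  have "\<bar>(grid_round j x - x) $ i\<bar> \<le> 1 / real (Suc j)" for i
  proof -
    have "(grid_round j x - x) $ i = (of_int \<lfloor>real (Suc j) * x $ i\<rfloor> - real (Suc j) * x $ i) / real (Suc j)"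
      by (simp add: grid_round_def field_simps del: of_nat_Suc)
    moreover have "\<bar>of_int \<lfloor>real (Suc j) * x $ i\<rfloor> - real (Suc j) * x $ i\<bar> \<le> 1" by linarith
    ultimately show ?thesis by (simp only: abs_divide abs_of_nat) (rule divide_right_mono, auto)
  qed
  then have "(\<Sum>i\<in>UNIV. \<bar>(grid_round j x - x) $ i\<bar>) \<le> (\<Sum>i\<in>(UNIV::'n set). 1 / real (Suc j))"
    by (intro sum_mono)
  also have "\<dots> = grid_error TYPE('n) j" by (simp add: grid_error_def)
  finally show ?thesis
    unfolding dist_norm using norm_le_l1_cart[of "grid_round j x - x"] by linarith
qed

lemma grid_round_mono: "x $ i \<le> y $ i \<Longrightarrow> grid_round j x $ i \<le> grid_round j y $ i"
  by (simp add: grid_round_def divide_right_mono floor_mono mult_left_mono del: of_nat_Suc)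

lemma grid_round_strict:
  assumes "x $ i < y $ i"
  shows "\<forall>\<^sub>F j in sequentially. grid_round j x $ i < grid_round j y $ i"
proof -
  have "filterlim (\<lambda>j. (y $ i - x $ i) * real (Suc j)) at_top sequentially"
    using assms
    by (intro filterlim_tendsto_pos_mult_at_top[OF tendsto_const] filterlim_compose[OF filterlim_real_sequentially filterlim_Suc]) auto
  then have "\<forall>\<^sub>F j in sequentially. (y $ i - x $ i) * real (Suc j) \<ge> 1"
    unfolding filterlim_at_top by blast
  then show ?thesis
  proof eventually_elim
    case (elim j)
    then have "real (Suc j) * x $ i + 1 \<le> real (Suc j) * y $ i" by (simp add: algebra_simps)
    then have "\<lfloor>real (Suc j) * x $ i\<rfloor> < \<lfloor>real (Suc j) * y $ i\<rfloor>" by linarith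
    then show ?case by (simp add: grid_round_def divide_strict_right_mono del: of_nat_Suc)
  qed
qed

text \<open>
  Rounding moves points by at most the grid error, so a ball enlarged by this error contains the
  rounded points. Conversely, if \<open>\<sigma>\<close> fits into no ball of radius
  \<open>r\<close>, its Cech radius is strictly larger than \<open>r\<close>, and there is room
  for twice the error once the grid is fine enough. Without the enlargement the equivalence could
  fail when the radius is exactly \<open>r\<close>.
\<close>

lemma grid_round_enclosed:
  fixes \<sigma> :: "(real ^ 'n::finite) set"
  assumes fin: "finite \<sigma>" and ne: "\<sigma> \<noteq> {}"
  shows "\<forall>\<^sub>F j in sequentially.
    enclosed (r + grid_error TYPE('n) j) (grid_round j ` \<sigma>) \<longleftrightarrow> enclosed r \<sigma>"
proof (cases "enclosed r \<sigma>")
  case True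
  then obtain c where c: "\<forall>x\<in>\<sigma>. dist x c \<le> r" unfolding enclosed_def by blast
  have "enclosed (r + grid_error TYPE('n) j) (grid_round j ` \<sigma>)" for j
    unfolding enclosed_def
  proof (intro exI ballI)
    fix y assume "y \<in> grid_round j ` \<sigma>"
    then obtain x where x: "x \<in> \<sigma>" "y = grid_round j x" by blast
    then have "dist x c \<le> r" using c by blast
    then show "dist y c \<le> r + grid_error TYPE('n) j"
      using dist_triangle[of y c x] dist_grid_round[of j x] x(2) by simp
  qed
  with True show ?thesis by simp
next
  case False
  then have "r < cech_radius \<sigma>" using cech_radius_le_iff[OF fin ne, of r] by simp
  moreover have "(\<lambda>j. r + 2 * grid_error TYPE('n) j) \<longlonglongrightarrow> r + 2 * 0"
    by (intro tendsto_intros grid_error_tendsto)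
  ultimately have "\<forall>\<^sub>F j in sequentially. r + 2 * grid_error TYPE('n) j < cech_radius \<sigma>"
    by (intro order_tendstoD(2)) auto
  then show ?thesis
  proof eventually_elim
    case (elim j)
    have "\<not> enclosed (r + grid_error TYPE('n) j) (grid_round j ` \<sigma>)"
    proof
      assume "enclosed (r + grid_error TYPE('n) j) (grid_round j ` \<sigma>)"
      then obtain c where c: "\<And>x. x \<in> \<sigma> \<Longrightarrow> dist (grid_round j x) c \<le> r + grid_error TYPE('n) j"
        unfolding enclosed_def by blast
      have "dist x c \<le> r + 2 * grid_error TYPE('n) j" if "x \<in> \<sigma>" for x
        using c[OF that] dist_triangle3[of x c "grid_round j x"] dist_grid_round[of j x] by linarith
      then have "enclosed (r + 2 * grid_error TYPE('n) j) \<sigma>" unfolding enclosed_def by blast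
      then show False using elim cech_radius_le_iff[OF fin ne] by (meson not_le)
    qed
    with False show ?case by simp
  qed
qed

text \<open>
  Finitely many comparisons of coordinates and finitely many subsets are involved, and each of
  them is eventually decided correctly after rounding.
\<close>

theorem multicover_betti_grid_round:
  fixes Q :: "(real ^ 'n::{finite,linorder}) set"
  assumes fin: "finite Q'" and QQ: "Q \<subseteq> Q'" and k: "1 \<le> k'" "k' \<le> k" and r: "r \<le> r'"
  shows "\<forall>\<^sub>F j in sequentially.
    multicover_betti (r + grid_error TYPE('n) j) (r' + grid_error TYPE('n) j) k k' q
      (grid_round j ` Q) (grid_round j ` Q') = multicover_betti r r' k k' q Q Q'"
proof -
  have enc: "\<forall>\<^sub>F j in sequentially. \<forall>\<sigma>\<in>Pow Q' - {{}}.
      enclosed (s + grid_error TYPE('n) j) (grid_round j ` \<sigma>) \<longleftrightarrow> enclosed s \<sigma>" for s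
    by (rule eventually_ball_finite) (use fin grid_round_enclosed finite_subset in blast)+
  have "\<forall>\<^sub>F j in sequentially. \<forall>p\<in>Q' \<times> Q' \<times> UNIV. case p of (x, y, i) \<Rightarrow>
      x $ i < y $ i \<longrightarrow> grid_round j x $ i < grid_round j y $ i"
  proof (rule eventually_ball_finite)
    show "\<forall>p\<in>Q' \<times> Q' \<times> UNIV. \<forall>\<^sub>F j in sequentially. case p of (x, y, i) \<Rightarrow>
      x $ i < y $ i \<longrightarrow> grid_round j x $ i < grid_round j y $ i"
    proof clarify
      fix x y i
      show "\<forall>\<^sub>F j in sequentially. x $ i < y $ i \<longrightarrow> grid_round j x $ i < grid_round j y $ i"
        using grid_round_strict[of x i y] by (cases "x $ i < y $ i") (auto elim: eventually_mono)
    qed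
  qed (use fin in simp)
  then show ?thesis
    using enc[of r'] enc[of r]
  proof eventually_elim
    case (elim j)
    have less: "grid_round j x $ i < grid_round j y $ i \<longleftrightarrow> x $ i < y $ i"
      if "x \<in> Q'" "y \<in> Q'" for x y i
      using elim(1) that grid_round_mono[of y i x j] by (force simp: not_less[symmetric])
    have eq: "grid_round j x $ i = grid_round j y $ i \<longleftrightarrow> x $ i = y $ i"
      if "x \<in> Q'" "y \<in> Q'" for x y i
      using less[OF that, of i] less[OF that(2,1), of i] by (metis linorder_less_linear order_less_irrefl)
    show ?case
    proof (rule multicover_betti_iso[OF assms])
      show "inj_on (grid_round j) Q'"
        by (rule inj_onI) (metis eq vec_eq_iff)
      show "lex_less (grid_round j x) (grid_round j y) \<longleftrightarrow> lex_less x y" if "x \<in> Q'" "y \<in> Q'" for x y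
        unfolding lex_less_def using less[OF that] eq[OF that] by simp
    qed (use elim(2-) QQ in blast)+
  qed
qed

section \<open>Measures with atoms of mass at least one\<close>

text \<open>
  These are the locally finite sums of point masses of size at least one. Stated through open
  sets, the condition is visibly invariant under translations and can be checked on a countable
  base.
\<close>

definition hard_atomic :: "(real ^ 'n::finite) measure \<Rightarrow> bool" where
  "hard_atomic m \<longleftrightarrow> sets m = sets borel \<and> (\<forall>n::nat. emeasure m (cball 0 (real n)) < \<infinity>) \<and>
     (\<forall>U. open U \<longrightarrow> emeasure m U = 0 \<or> emeasure m U \<ge> 1)"

definition atoms :: "(real ^ 'n::finite) measure \<Rightarrow> (real ^ 'n) set" where
  "atoms m = {x. emeasure m {x} \<ge> 1}"

lemma hard_atomic_bounded:
  assumes "hard_atomic m" "bounded B"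
  shows "emeasure m B < \<infinity>"
proof -
  obtain a where "\<forall>x\<in>B. norm x \<le> a" using assms(2) bounded_iff by blast
  then have "B \<subseteq> cball 0 (real (nat \<lceil>a\<rceil>))" by (force intro: order_trans real_nat_ceiling_ge)
  moreover have "cball 0 (real (nat \<lceil>a\<rceil>)) \<in> sets m" using assms(1) by (simp add: hard_atomic_def)
  ultimately have "emeasure m B \<le> emeasure m (cball 0 (real (nat \<lceil>a\<rceil>)))" by (rule emeasure_mono)
  also have "\<dots> < \<infinity>" using assms(1) unfolding hard_atomic_def by blast
  finally show ?thesis .
qed

text \<open>
  The masses of the punctured balls decrease to the mass of the empty set. Once the mass is below
  one it is zero, because the punctured ball is open.
\<close>

lemma hard_atomic_punctured_ball:
  assumes m: "hard_atomic m"
  shows "\<exists>e>0. emeasure m (ball x e - {x}) = 0"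
proof -
  let ?A = "\<lambda>n::nat. ball x (1 / real (Suc n)) - {x}"
  have sets: "sets m = sets borel" using m by (simp add: hard_atomic_def)
  have A: "?A n \<in> sets m" for n unfolding sets by measurable
  have "(\<lambda>n. emeasure m (?A n)) \<longlonglongrightarrow> emeasure m (\<Inter>n. ?A n)"
  proof (rule Lim_emeasure_decseq)
    show "range ?A \<subseteq> sets m" using A by blast
    show "decseq ?A"
    proof (rule decseq_SucI)
      fix n
      have "1 / real (Suc (Suc n)) \<le> 1 / real (Suc n)" by (simp add: frac_le)
      then show "?A (Suc n) \<subseteq> ?A n" using subset_ball by blast
    qed
    show "emeasure m (?A n) \<noteq> \<infinity>" for n
      using hard_atomic_bounded[OF m, of "?A n"] by (simp add: bounded_diff)
  qed
  also have "(\<Inter>n. ?A n) = {}"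
  proof -
    have False if y: "\<And>n. y \<in> ?A n" for y
    proof -
      have "0 < dist x y" using y[of 0] by (auto simp: zero_less_dist_iff)
      then obtain n where "inverse (real (Suc n)) < dist x y" using reals_Archimedean by blast
      then show False using y[of n] by (simp add: inverse_eq_divide del: of_nat_Suc)
    qed
    then show ?thesis by blast
  qed
  finally have "(\<lambda>n. emeasure m (?A n)) \<longlonglongrightarrow> 0" by simp
  then have "\<forall>\<^sub>F n in sequentially. emeasure m (?A n) < 1" by (rule order_tendstoD) simp
  then obtain n where n: "emeasure m (?A n) < 1" by (auto dest: eventually_happens)
  have "open (?A n)" by (intro open_Diff) auto
  then have "emeasure m (?A n) = 0"
    using m n unfolding hard_atomic_def by (meson not_le)
  then show ?thesis by (intro exI[of _ "1 / real (Suc n)"]) simp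
qed

lemma hard_atomic_singleton:
  assumes m: "hard_atomic m"
  shows "emeasure m {x} = 0 \<or> emeasure m {x} \<ge> 1"
proof -
  obtain e where e: "e > 0" "emeasure m (ball x e - {x}) = 0" using hard_atomic_punctured_ball[OF m] by blast
  have sets: "sets m = sets borel" using m by (simp add: hard_atomic_def)
  have "emeasure m (ball x e) = emeasure m ({x} \<union> (ball x e - {x}))"
    using e(1) by (intro arg_cong[where f = "emeasure m"]) auto
  also have "\<dots> = emeasure m {x} + emeasure m (ball x e - {x})"
    by (rule plus_emeasure[symmetric]) (auto simp: sets)
  finally have "emeasure m (ball x e) = emeasure m {x}" using e(2) by simp
  then show ?thesis using m unfolding hard_atomic_def by (metis open_ball)
qed

text \<open>
  Finitely many balls whose punctured versions are null cover the closure of \<open>B\<close>;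
  only their centres can be atoms, and everything else is null.
\<close>

lemma hard_atomic_atoms:
  assumes m: "hard_atomic m" and B: "bounded B" "B \<in> sets borel"
  shows "finite (atoms m \<inter> B)" "emeasure m (B - atoms m) = 0"
proof -
  have sets: "sets m = sets borel" using m by (simp add: hard_atomic_def)
  have "\<forall>x. \<exists>e. e > 0 \<and> emeasure m (ball x e - {x}) = 0" using hard_atomic_punctured_ball[OF m] by blast
  then obtain e where e: "\<And>x. e x > 0" "\<And>x. emeasure m (ball x (e x) - {x}) = 0" by metis
  have "compact (closure B)" using B(1) by (simp add: compact_closure)
  moreover have "closure B \<subseteq> (\<Union>x\<in>closure B. ball x (e x))" using e(1) by force
  ultimately obtain F where F: "F \<subseteq> closure B" "finite F" "closure B \<subseteq> (\<Union>x\<in>F. ball x (e x))"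
    using compactE_image[of "closure B" "closure B" "\<lambda>x. ball x (e x)"] by (metis open_ball)
  have "atoms m \<inter> B \<subseteq> F"
  proof
    fix y assume y: "y \<in> atoms m \<inter> B"
    then obtain x where x: "x \<in> F" "y \<in> ball x (e x)" using F(3) closure_subset by blast
    have "y = x"
    proof (rule ccontr)
      assume "y \<noteq> x"
      then have "emeasure m {y} \<le> emeasure m (ball x (e x) - {x})"
        using x(2) by (intro emeasure_mono) (auto simp: sets)
      then show False using y e(2)[of x] by (simp add: atoms_def)
    qed
    then show "y \<in> F" using x(1) by simp
  qed
  then show fin: "finite (atoms m \<inter> B)" using F(2) finite_subset by blast
  have "B - atoms m \<subseteq> (\<Union>x\<in>F. ball x (e x) - {x}) \<union> (F - atoms m)"
  proof
    fix y assume y: "y \<in> B - atoms m"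
    then have "y \<in> closure B" using closure_subset by blast
    then obtain x where x: "x \<in> F" "y \<in> ball x (e x)" using F(3) by blast
    show "y \<in> (\<Union>x\<in>F. ball x (e x) - {x}) \<union> (F - atoms m)"
    proof (cases "y = x")
      case True
      then show ?thesis using x y by simp
    next
      case False
      then show ?thesis using x by (intro UnI1 UN_I[of x]) simp_all
    qed
  qed
  moreover have "(\<Union>x\<in>F. ball x (e x) - {x}) \<in> null_sets m"
    using e(2) F(2) by (intro null_sets_UN' ) (auto simp: sets null_sets_def countable_finite)
  moreover have "F - atoms m \<in> null_sets m"
  proof -
    have "(\<Union>x\<in>F - atoms m. {x}) \<in> null_sets m"
      using F(2) hard_atomic_singleton[OF m]
      by (intro null_sets_UN') (auto simp: sets null_sets_def countable_finite atoms_def)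
    then show ?thesis by simp
  qed
  moreover have "B - atoms m \<in> sets m"
  proof -
    have "B - atoms m = B - (atoms m \<inter> B)" by blast
    then show ?thesis using B(2) finite_imp_closed[OF fin] unfolding sets by (metis sets.Diff borel_closed)
  qed
  ultimately have "B - atoms m \<in> null_sets m"
    by (meson null_sets.Un null_sets_subset)
  then show "emeasure m (B - atoms m) = 0" by (simp add: null_sets_def)
qed

lemma hard_atomic_zero_iff:
  assumes m: "hard_atomic m" and B: "bounded B" "B \<in> sets borel"
  shows "emeasure m B = 0 \<longleftrightarrow> atoms m \<inter> B = {}"
proof
  have sets: "sets m = sets borel" using m by (simp add: hard_atomic_def)
  assume 0: "emeasure m B = 0"
  have False if "x \<in> atoms m" "x \<in> B" for x
  proof -
    have "emeasure m {x} \<le> emeasure m B" using that B(2) sets by (intro emeasure_mono) auto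
    then show False using 0 that(1) by (simp add: atoms_def)
  qed
  then show "atoms m \<inter> B = {}" by blast
next
  assume "atoms m \<inter> B = {}"
  then have "B - atoms m = B" by blast
  then show "emeasure m B = 0" using hard_atomic_atoms(2)[OF assms] by simp
qed

lemma hard_atomic_card_le:
  assumes m: "hard_atomic m" and B: "bounded B" "B \<in> sets borel"
  shows "of_nat (card (atoms m \<inter> B)) \<le> emeasure m B"
proof -
  have sets: "sets m = sets borel" using m by (simp add: hard_atomic_def)
  let ?S = "atoms m \<inter> B"
  have fin: "finite ?S" by (rule hard_atomic_atoms(1)[OF assms])
  have "of_nat (card ?S) = (\<Sum>x\<in>?S. (1::ennreal))" by simp
  also have "\<dots> \<le> (\<Sum>x\<in>?S. emeasure m {x})" by (intro sum_mono) (auto simp: atoms_def)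
  also have "\<dots> = emeasure m ?S"
    by (rule emeasure_eq_sum_singleton[symmetric, OF fin]) (simp add: sets)
  also have "\<dots> \<le> emeasure m B" using B(2) sets by (intro emeasure_mono) auto
  finally show ?thesis .
qed

text \<open>
  If an open set has mass less than one, all basic sets inside it are null, and so is their
  countable union.
\<close>

lemma open_zero_or_one_iff_basis:
  assumes sets: "sets m = sets borel" and \<B>: "countable \<B>" "topological_basis \<B>"
  shows "(\<forall>U. open U \<longrightarrow> emeasure m U = 0 \<or> emeasure m U \<ge> 1) \<longleftrightarrow>
    (\<forall>U\<in>\<B>. emeasure m U = 0 \<or> emeasure m U \<ge> 1)"
proof
  assume "\<forall>U. open U \<longrightarrow> emeasure m U = 0 \<or> emeasure m U \<ge> 1"
  then show "\<forall>U\<in>\<B>. emeasure m U = 0 \<or> emeasure m U \<ge> 1"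
    using topological_basis_open[OF \<B>(2)] by blast
next
  assume basis: "\<forall>U\<in>\<B>. emeasure m U = 0 \<or> emeasure m U \<ge> 1"
  show "\<forall>U. open U \<longrightarrow> emeasure m U = 0 \<or> emeasure m U \<ge> 1"
  proof (intro allI impI)
    fix V :: "'a set" assume V: "open V"
    obtain \<C> where \<C>: "\<C> \<subseteq> \<B>" "\<Union>\<C> = V" using \<B>(2) V unfolding topological_basis_def by blast
    show "emeasure m V = 0 \<or> emeasure m V \<ge> 1"
    proof (rule disjCI)
      assume less: "\<not> 1 \<le> emeasure m V"
      have "(\<Union>U\<in>\<C>. U) \<in> null_sets m"
      proof (rule null_sets_UN')
        show "countable \<C>" using \<C>(1) \<B>(1) countable_subset by blast
        fix U assume U: "U \<in> \<C>"
        then have oU: "open U" using \<C>(1) topological_basis_open[OF \<B>(2)] by blast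
        have "emeasure m U \<le> emeasure m V" using U \<C>(2) V sets by (intro emeasure_mono) auto
        then have "\<not> 1 \<le> emeasure m U" using less order_trans by blast
        then have "emeasure m U = 0" using basis U \<C>(1) by blast
        then show "U \<in> null_sets m" using oU by (simp add: null_sets_def sets)
      qed
      then show "emeasure m V = 0" using \<C>(2) by (simp add: null_sets_def)
    qed
  qed
qed

section \<open>Configurations as measures\<close>

type_synonym 'n configuration = "((real ^ 'n) \<times> real) measure"

lemma space_configuration_space: "space configuration_space = {\<mu>. sets \<mu> = sets borel}"
  by (auto simp: configuration_space_def space_Sup_eq_UN)

lemma measurable_emeasure_configuration:
  "A \<in> sets borel \<Longrightarrow> (\<lambda>\<mu>. emeasure \<mu> A) \<in> borel_measurable configuration_space"
  by (auto intro!: measurable_Sup1 measurable_vimage_algebra1 simp: configuration_space_def)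

lemma measurable_configuration_spaceI:
  assumes "\<And>a. a \<in> space M \<Longrightarrow> sets (K a) = sets borel"
    and "\<And>A. A \<in> sets borel \<Longrightarrow> (\<lambda>a. emeasure (K a) A) \<in> borel_measurable M"
  shows "K \<in> measurable M configuration_space"
  using assms by (auto intro!: measurable_Sup2 measurable_vimage_algebra2 simp: configuration_space_def)

lemma configurationD:
  assumes "\<mu> \<in> space configuration_space"
  shows "sets \<mu> = sets borel" "space \<mu> = UNIV"
  using assms sets_eq_imp_space_eq[of \<mu> borel] by (auto simp: space_configuration_space)

lemma shift_measurable: "(\<lambda>(y, m). (y + x, m)) \<in> borel_measurable (borel :: ('a::euclidean_space \<times> real) measure)"
proof -
  have "continuous_on UNIV (\<lambda>p::'a \<times> real. (fst p + x, snd p))" by (intro continuous_intros)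
  then show ?thesis by (simp add: borel_measurable_continuous_onI case_prod_beta)
qed

lemma emeasure_shift_configuration:
  assumes "\<mu> \<in> space configuration_space" "A \<in> sets borel"
  shows "emeasure (shift_configuration x \<mu>) A = emeasure \<mu> ((\<lambda>(y, m). (y + x, m)) -` A)"
proof -
  have "(\<lambda>(y, m). (y + x, m)) \<in> measurable \<mu> borel"
    unfolding measurable_cong_sets[OF configurationD(1)[OF assms(1)] refl] by (rule shift_measurable)
  from emeasure_distr[OF this assms(2)] show ?thesis
    by (simp only: shift_configuration_def configurationD(2)[OF assms(1)] Int_UNIV_right)
qed

lemma sets_shift_configuration: "sets (shift_configuration x \<mu>) = sets borel"
  by (simp add: shift_configuration_def)

lemma shift_configuration_measurable:
  "shift_configuration x \<in> measurable configuration_space configuration_space"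
proof (rule measurable_configuration_spaceI)
  fix A :: "((real ^ 'a) \<times> real) set" assume A: "A \<in> sets borel"
  have "(\<lambda>(y, m). (y + x, m)) -` A \<in> sets borel"
    using measurable_sets[OF shift_measurable A, of x] by simp
  then have "(\<lambda>\<mu>. emeasure \<mu> ((\<lambda>(y, m). (y + x, m)) -` A)) \<in> borel_measurable configuration_space"
    by (rule measurable_emeasure_configuration)
  then show "(\<lambda>\<mu>. emeasure (shift_configuration x \<mu>) A) \<in> borel_measurable configuration_space"
    by (rule measurable_cong[THEN iffD1, rotated]) (simp add: emeasure_shift_configuration A)
qed (simp add: sets_shift_configuration)

lemma shift_configuration_space:
  "\<mu> \<in> space configuration_space \<Longrightarrow> shift_configuration x \<mu> \<in> space configuration_space"
  by (rule measurable_space[OF shift_configuration_measurable])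

lemma shift_configuration_shift:
  assumes \<mu>: "\<mu> \<in> space configuration_space"
  shows "shift_configuration x (shift_configuration y \<mu>) = shift_configuration (x + y) \<mu>"
proof (rule measure_eqI)
  fix A assume "A \<in> sets (shift_configuration x (shift_configuration y \<mu>))"
  then have A: "A \<in> sets borel" by (simp add: sets_shift_configuration)
  have A': "(\<lambda>(z, m). (z + x, m)) -` A \<in> sets borel"
    using measurable_sets[OF shift_measurable A, of x] by simp
  have "emeasure (shift_configuration x (shift_configuration y \<mu>)) A
      = emeasure \<mu> ((\<lambda>(z, m). (z + y, m)) -` (\<lambda>(z, m). (z + x, m)) -` A)"
    by (simp only: emeasure_shift_configuration[OF shift_configuration_space[OF \<mu>] A]
        emeasure_shift_configuration[OF \<mu> A'])
  also have "(\<lambda>(z, m). (z + y, m)) -` (\<lambda>(z, m). (z + x, m)) -` A = (\<lambda>(z, m). (z + (x + y), m)) -` A"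
    by (auto simp: ac_simps)
  also have "emeasure \<mu> \<dots> = emeasure (shift_configuration (x + y) \<mu>) A"
    by (simp only: emeasure_shift_configuration[OF \<mu> A])
  finally show "emeasure (shift_configuration x (shift_configuration y \<mu>)) A
      = emeasure (shift_configuration (x + y) \<mu>) A" .
qed (simp add: sets_shift_configuration)

lemma shift_configuration_0:
  assumes \<mu>: "\<mu> \<in> space configuration_space"
  shows "shift_configuration 0 \<mu> = \<mu>"
proof (rule measure_eqI)
  fix A assume "A \<in> sets (shift_configuration 0 \<mu>)"
  then have A: "A \<in> sets borel" by (simp add: sets_shift_configuration)
  have "(\<lambda>(z, m). (z + 0, m)) -` A = A" by auto
  then show "emeasure (shift_configuration 0 \<mu>) A = emeasure \<mu> A"
    by (simp only: emeasure_shift_configuration[OF \<mu> A])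
qed (simp add: sets_shift_configuration configurationD[OF \<mu>])

section \<open>Points of bounded mark\<close>

text \<open>
  The points of mark at most \<open>s\<close>, projected to their locations, since a complex at
  one filtration index sees the marks only through the bound \<open>s\<close>.
\<close>

definition slice :: "real \<Rightarrow> ((real ^ 'n::finite) \<times> real) measure \<Rightarrow> (real ^ 'n) measure" where
  "slice s \<mu> = distr (restrict_space \<mu> (UNIV \<times> {..s})) borel fst"

lemma Times_borel: "B \<in> sets borel \<Longrightarrow> (B::(real ^ 'n::finite) set) \<times> {..s::real} \<in> sets borel"
  by (simp add: borel_prod[symmetric])

lemma sets_slice [simp]: "sets (slice s \<mu>) = sets borel"
  by (simp add: slice_def)

lemma emeasure_slice:
  fixes \<mu> :: "((real ^ 'n::finite) \<times> real) measure"
  assumes "\<mu> \<in> space configuration_space" "B \<in> sets borel"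
  shows "emeasure (slice s \<mu>) B = emeasure \<mu> (B \<times> {..s})"
proof -
  note \<mu> = configurationD[OF assms(1)]
  have "fst \<in> measurable \<mu> (borel :: (real ^ 'n) measure)"
    unfolding measurable_cong_sets[OF \<mu>(1) refl]
    by (intro borel_measurable_continuous_onI continuous_on_fst continuous_on_id)
  then have "fst \<in> measurable (restrict_space \<mu> (UNIV \<times> {..s})) (borel :: (real ^ 'n) measure)"
    by (rule measurable_restrict_space1)
  then have "emeasure (slice s \<mu>) B = emeasure (restrict_space \<mu> (UNIV \<times> {..s})) (fst -` B \<inter> (UNIV \<times> {..s}))"
    unfolding slice_def using assms(2) by (subst emeasure_distr) (auto simp: space_restrict_space \<mu>)
  also have "fst -` B \<inter> (UNIV \<times> {..s}) = B \<times> {..s}" by auto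
  also have "emeasure (restrict_space \<mu> (UNIV \<times> {..s})) (B \<times> {..s}) = emeasure \<mu> (B \<times> {..s})"
    using Times_borel[of UNIV s] by (intro emeasure_restrict_space) (auto simp: \<mu>)
  finally show ?thesis .
qed

lemma measurable_emeasure_slice:
  assumes B: "B \<in> sets borel"
  shows "(\<lambda>\<mu>. emeasure (slice s \<mu>) B) \<in> borel_measurable configuration_space"
  using measurable_emeasure_configuration[OF Times_borel[OF B, of s]]
  by (rule measurable_cong[THEN iffD1, rotated]) (rule emeasure_slice[OF _ B, symmetric])

lemma translate_borel:
  fixes x :: "'a::euclidean_space"
  assumes "B \<in> sets borel" shows "(\<lambda>y. y + x) -` B \<in> sets borel"
proof -
  have "(\<lambda>y. y + x) \<in> borel_measurable borel" by measurable
  from measurable_sets[OF this assms] show ?thesis by simp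
qed

lemma emeasure_slice_shift:
  assumes "\<mu> \<in> space configuration_space" "B \<in> sets borel"
  shows "emeasure (slice s (shift_configuration x \<mu>)) B = emeasure (slice s \<mu>) ((\<lambda>y. y + x) -` B)"
proof -
  have "(\<lambda>(y, m). (y + x, m)) -` (B \<times> {..s}) = ((\<lambda>y. y + x) -` B) \<times> {..s}" by auto
  then show ?thesis
    using assms by (simp add: emeasure_slice shift_configuration_space emeasure_shift_configuration
        Times_borel translate_borel)
qed

lemma open_translate:
  fixes x :: "'a::real_normed_vector"
  shows "open U \<Longrightarrow> open ((\<lambda>y. y + x) -` U)"
  by (rule open_vimage) (auto intro: continuous_intros)

lemma bounded_translate:
  fixes x :: "'a::real_normed_vector"
  assumes "bounded B" shows "bounded ((\<lambda>y. y + x) -` B)"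
proof -
  have "(\<lambda>y. y + x) -` B = (\<lambda>y. - x + y) ` B" by (force simp: image_iff algebra_simps)
  then show ?thesis using assms bounded_translation[of B "- x"] by (simp add: add.commute)
qed

lemma hard_atomic_slice_shift:
  assumes \<mu>: "\<mu> \<in> space configuration_space" and h: "hard_atomic (slice s \<mu>)"
  shows "hard_atomic (slice s (shift_configuration x \<mu>))"
  unfolding hard_atomic_def
proof (intro conjI allI impI)
  fix n :: nat
  have "bounded ((\<lambda>y. y + x) -` cball 0 (real n))" by (rule bounded_translate) simp
  from hard_atomic_bounded[OF h this]
  show "emeasure (slice s (shift_configuration x \<mu>)) (cball 0 (real n)) < \<infinity>"
    by (simp add: emeasure_slice_shift[OF \<mu>])
next
  fix U :: "(real ^ 'a) set" assume "open U"
  then show "emeasure (slice s (shift_configuration x \<mu>)) U = 0 \<or> 1 \<le> emeasure (slice s (shift_configuration x \<mu>)) U"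
    using h open_translate[of U x] by (simp add: emeasure_slice_shift[OF \<mu>] hard_atomic_def)
qed simp

lemma atoms_slice_shift:
  assumes \<mu>: "\<mu> \<in> space configuration_space"
  shows "atoms (slice s (shift_configuration x \<mu>)) = (\<lambda>y. y + x) ` atoms (slice s \<mu>)"
proof -
  have *: "(\<lambda>y. y + x) -` {z} = {z - x}" for z by (auto simp: algebra_simps)
  have "z \<in> atoms (slice s (shift_configuration x \<mu>)) \<longleftrightarrow> z - x \<in> atoms (slice s \<mu>)" for z
    by (simp add: atoms_def emeasure_slice_shift[OF \<mu>] *)
  moreover have "z - x \<in> S \<longleftrightarrow> z \<in> (\<lambda>y. y + x) ` S" for z S
    by (metis (no_types, lifting) add_diff_cancel diff_add_cancel image_iff)
  ultimately show ?thesis by blast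
qed

lemma slice_mono:
  assumes \<mu>: "\<mu> \<in> space configuration_space" and "s \<le> s'" and B: "B \<in> sets borel"
  shows "emeasure (slice s \<mu>) B \<le> emeasure (slice s' \<mu>) B"
  unfolding emeasure_slice[OF \<mu> B]
  using assms(2) Times_borel[OF B, of s'] configurationD(1)[OF \<mu>]
  by (intro emeasure_mono) auto

lemma atoms_slice_mono:
  assumes "\<mu> \<in> space configuration_space" "s \<le> s'"
  shows "atoms (slice s \<mu>) \<subseteq> atoms (slice s' \<mu>)"
proof
  fix x assume "x \<in> atoms (slice s \<mu>)"
  then have "1 \<le> emeasure (slice s \<mu>) {x}" by (simp add: atoms_def)
  also have "\<dots> \<le> emeasure (slice s' \<mu>) {x}" using slice_mono[OF assms] by simp
  finally show "x \<in> atoms (slice s' \<mu>)" by (simp add: atoms_def)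
qed

text \<open>
  A countable base of the topology reduces the condition to countably many evaluations.
\<close>

lemma hard_atomic_slice_measurable:
  "{\<mu> \<in> space configuration_space. hard_atomic (slice s \<mu>)} \<in> sets (configuration_space :: ((real ^ 'n::finite) \<times> real) measure measure)"
proof -
  obtain \<B> :: "(real ^ 'n) set set" where \<B>: "countable \<B>" "topological_basis \<B>"
    using ex_countable_basis by blast
  have [measurable]: "(\<lambda>\<mu>. emeasure (slice s \<mu>) U) \<in> borel_measurable configuration_space" if "U \<in> \<B>" for U
    using topological_basis_open[OF \<B>(2) that] by (intro measurable_emeasure_slice) auto
  have [measurable]: "(\<lambda>\<mu>. emeasure (slice s \<mu>) (cball 0 (real n))) \<in> borel_measurable configuration_space" for n
    by (intro measurable_emeasure_slice) auto
  have "{\<mu> \<in> space configuration_space. hard_atomic (slice s \<mu>)} =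
    {\<mu> \<in> space configuration_space. (\<forall>n::nat. emeasure (slice s \<mu>) (cball 0 (real n)) < \<infinity>)} \<inter>
    {\<mu> \<in> space configuration_space. \<forall>U\<in>\<B>. emeasure (slice s \<mu>) U = 0 \<or> emeasure (slice s \<mu>) U \<ge> 1}"
    unfolding hard_atomic_def using open_zero_or_one_iff_basis[OF sets_slice \<B>] by auto
  also have "\<dots> \<in> sets configuration_space"
  proof (rule sets.Int)
    show "{\<mu> \<in> space configuration_space. (\<forall>n::nat. emeasure (slice s \<mu>) (cball 0 (real n)) < \<infinity>)} \<in> sets configuration_space"
      by measurable
    have "{\<mu> \<in> space configuration_space. \<forall>U\<in>\<B>. emeasure (slice s \<mu>) U = 0 \<or> emeasure (slice s \<mu>) U \<ge> 1}
      = space configuration_space - (\<Union>U\<in>\<B>. {\<mu> \<in> space configuration_space. \<not> (emeasure (slice s \<mu>) U = 0 \<or> emeasure (slice s \<mu>) U \<ge> 1)})"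
      by blast
    also have "\<dots> \<in> sets configuration_space"
    proof (intro sets.Diff sets.top sets.countable_UN'' \<B>(1))
      fix U assume "U \<in> \<B>"
      note [measurable] = \<open>\<And>U. U \<in> \<B> \<Longrightarrow> (\<lambda>\<mu>. emeasure (slice s \<mu>) U) \<in> borel_measurable configuration_space\<close>[OF this]
      show "{\<mu> \<in> space configuration_space. \<not> (emeasure (slice s \<mu>) U = 0 \<or> emeasure (slice s \<mu>) U \<ge> 1)} \<in> sets configuration_space"
        by measurable
    qed
    finally show "{\<mu> \<in> space configuration_space. \<forall>U\<in>\<B>. emeasure (slice s \<mu>) U = 0 \<or> emeasure (slice s \<mu>) U \<ge> 1} \<in> sets configuration_space" .
  qed
  finally show ?thesis .
qed

section \<open>Betti numbers and point counts of a configuration\<close>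

text \<open>
  Boxes around lattice points; those with \<open>\<rho> - 1\<close> at least the interaction
  distance contain every point that interacts with a point of the unit cell at \<open>u\<close>.
\<close>

definition window :: "real \<Rightarrow> ('n \<Rightarrow> int) \<Rightarrow> (real ^ 'n::finite) set" where
  "window \<rho> u = cbox (\<chi> i. of_int (u i) - \<rho>) (\<chi> i. of_int (u i) + \<rho>)"

text \<open>
  The corner of the unit cell that contains \<open>x\<close>.
\<close>

definition lattice_cell :: "real ^ 'n::finite \<Rightarrow> 'n \<Rightarrow> int" where
  "lattice_cell x i = \<lfloor>x $ i\<rfloor>"

lemma mem_window: "y \<in> window \<rho> u \<longleftrightarrow> (\<forall>i. of_int (u i) - \<rho> \<le> y $ i \<and> y $ i \<le> of_int (u i) + \<rho>)"
  by (simp add: window_def mem_box_cart)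

lemma near_in_window:
  assumes "dist x y \<le> \<rho> - 1" shows "y \<in> window \<rho> (lattice_cell x)"
  unfolding mem_window lattice_cell_def
proof
  fix i
  have "\<bar>x $ i - y $ i\<bar> \<le> \<rho> - 1"
    using assms dist_vec_nth_le[of x i y] by (simp add: dist_real_def)
  then show "of_int \<lfloor>x $ i\<rfloor> - \<rho> \<le> y $ i \<and> y $ i \<le> of_int \<lfloor>x $ i\<rfloor> + \<rho>" by linarith
qed

lemma finite_grid_round_image:
  fixes \<Lambda> :: "(real ^ 'n::finite) set"
  assumes "bounded \<Lambda>"
  shows "finite (grid_round j ` \<Lambda>)"
proof -
  obtain B where B: "\<And>x. x \<in> \<Lambda> \<Longrightarrow> norm x \<le> B" using assms bounded_iff by blast
  let ?n = "real (Suc j)"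
  let ?I = "{\<lfloor>- (?n * B)\<rfloor>..\<lfloor>?n * B\<rfloor>}"
  have "grid_round j ` \<Lambda> \<subseteq> (\<lambda>f. \<chi> i. of_int (f i) / ?n) ` (PiE (UNIV :: 'n set) (\<lambda>_. ?I))"
  proof
    fix y assume "y \<in> grid_round j ` \<Lambda>"
    then obtain x where x: "x \<in> \<Lambda>" "y = grid_round j x" by blast
    have "\<lfloor>?n * x $ i\<rfloor> \<in> ?I" for i
    proof -
      have "\<bar>x $ i\<bar> \<le> B" using component_le_norm_cart[of x i] B[OF x(1)] by linarith
      then have "- B \<le> x $ i" "x $ i \<le> B" by linarith+
      then have "?n * (- B) \<le> ?n * x $ i" "?n * x $ i \<le> ?n * B" by (intro mult_left_mono, auto)+
      then show ?thesis by (auto intro: floor_mono)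
    qed
    then show "y \<in> (\<lambda>f. \<chi> i. of_int (f i) / ?n) ` (PiE (UNIV :: 'n set) (\<lambda>_. ?I))"
      unfolding x(2) grid_round_def by (intro image_eqI[of _ _ "\<lambda>i. \<lfloor>?n * x $ i\<rfloor>"]) auto
  qed
  then show ?thesis by (rule finite_subset) (intro finite_imageI finite_PiE, auto)
qed

lemma grid_cell_borel: "{x. grid_round j x = z} \<in> sets borel"
proof -
  have [measurable]: "(\<lambda>x. grid_round j x $ i) \<in> borel_measurable borel" for i :: "'n::finite"
    unfolding grid_round_def by simp
  have "{x. grid_round j x = z} = {x \<in> space borel. \<forall>i\<in>UNIV. grid_round j x $ i = z $ i}"
    by (auto simp: vec_eq_iff)
  also have "\<dots> \<in> sets borel" by (intro sets.sets_Collect_finite_All) auto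
  finally show ?thesis .
qed

text \<open>
  Two comparable filtration indices: radii \<open>r\<close> and \<open>r'\<close>, mark bounds
  \<open>s\<close> and \<open>s'\<close>, and cardinalities \<open>k\<close> and
  \<open>k'\<close>, the latter in reversed order.
\<close>

locale persistence_parameters =
  fixes r r' s s' :: real and k k' q :: nat
  assumes radii: "r \<le> r'" and mark_bounds: "s \<le> s'" and sizes: "1 \<le> k'" "k' \<le> k"
begin

definition hard_configs :: "((real ^ 'n::finite) \<times> real) measure set" where
  "hard_configs = {\<mu> \<in> space configuration_space. hard_atomic (slice s \<mu>) \<and> hard_atomic (slice s' \<mu>)}"

text \<open>
  The value zero outside \<open>hard_configs\<close> makes measurability and shift covariance hold
  for all measures; realisations of a point process always belong to \<open>hard_configs\<close>.
\<close>

definition betti_in :: "(real ^ 'n::{finite,linorder}) set \<Rightarrow> ((real ^ 'n::{finite,linorder}) \<times> real) measure \<Rightarrow> real" where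
  "betti_in \<Lambda> \<mu> = (if \<mu> \<in> hard_configs then
     real (multicover_betti r r' k k' q (atoms (slice s \<mu>) \<inter> \<Lambda>) (atoms (slice s' \<mu>) \<inter> \<Lambda>)) else 0)"

definition count_in :: "(real ^ 'n::finite) set \<Rightarrow> ((real ^ 'n::finite) \<times> real) measure \<Rightarrow> real" where
  "count_in B \<mu> = (if \<mu> \<in> hard_configs then enn2real (emeasure (slice s' \<mu>) B) else 0)"

lemma hard_configsD:
  assumes "\<mu> \<in> hard_configs"
  shows "\<mu> \<in> space configuration_space" "hard_atomic (slice s \<mu>)" "hard_atomic (slice s' \<mu>)"
  using assms by (auto simp: hard_configs_def)

lemma hard_configs_sets: "(hard_configs :: ((real ^ 'n::finite) \<times> real) measure set) \<in> sets configuration_space"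
proof -
  have eq: "hard_configs = {\<mu> \<in> space configuration_space. hard_atomic (slice s \<mu>)} \<inter>
      {\<mu> \<in> space (configuration_space :: ((real ^ 'n) \<times> real) measure measure). hard_atomic (slice s' \<mu>)}"
    by (auto simp: hard_configs_def)
  show ?thesis unfolding eq by (intro sets.Int hard_atomic_slice_measurable)
qed

lemma hard_configs_shift:
  assumes \<mu>: "\<mu> \<in> space configuration_space"
  shows "shift_configuration x \<mu> \<in> hard_configs \<longleftrightarrow> \<mu> \<in> hard_configs"
proof -
  have *: "shift_configuration x \<mu> \<in> hard_configs" if "\<mu> \<in> hard_configs" for x \<mu>
    unfolding hard_configs_def mem_Collect_eq
    by (intro conjI shift_configuration_space hard_atomic_slice_shift hard_configsD[OF that])
  show ?thesis
  proof
    assume "shift_configuration x \<mu> \<in> hard_configs"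
    then have "shift_configuration (- x) (shift_configuration x \<mu>) \<in> hard_configs" by (rule *)
    then show "\<mu> \<in> hard_configs" by (simp add: shift_configuration_shift[OF \<mu>] shift_configuration_0[OF \<mu>])
  qed (rule *)
qed

lemma count_in_nonneg: "0 \<le> count_in B \<mu>"
  by (simp add: count_in_def)

lemma count_in_measurable:
  assumes "B \<in> sets borel"
  shows "count_in B \<in> borel_measurable configuration_space"
proof -
  have "(\<lambda>\<mu>. enn2real (emeasure (slice s' \<mu>) B)) \<in> borel_measurable configuration_space"
    using measurable_emeasure_slice[OF assms] by measurable
  then have "(\<lambda>\<mu>. if \<mu> \<in> hard_configs then enn2real (emeasure (slice s' \<mu>) B) else 0)
      \<in> borel_measurable configuration_space"
    using hard_configs_sets by (intro measurable_If_set) auto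
  then show ?thesis by (simp only: count_in_def[abs_def])
qed

lemma count_in_shift:
  assumes "\<mu> \<in> space configuration_space" "B \<in> sets borel"
  shows "count_in B (shift_configuration x \<mu>) = count_in ((\<lambda>y. y + x) -` B) \<mu>"
  by (simp add: count_in_def hard_configs_shift emeasure_slice_shift assms)

lemma count_in_emeasure:
  assumes "\<mu> \<in> hard_configs" "bounded B"
  shows "ennreal (count_in B \<mu>) = emeasure (slice s' \<mu>) B"
  using assms hard_atomic_bounded[OF hard_configsD(3)[OF assms(1)] assms(2)]
  by (simp add: count_in_def less_top[symmetric])

lemma count_in_mono:
  assumes "B \<subseteq> C" "bounded C" "C \<in> sets borel"
  shows "count_in B \<mu> \<le> count_in C \<mu>"
proof (cases "\<mu> \<in> hard_configs")
  case True
  have "emeasure (slice s' \<mu>) B \<le> emeasure (slice s' \<mu>) C" using assms by (intro emeasure_mono) auto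
  then show ?thesis
    using True hard_atomic_bounded[OF hard_configsD(3)[OF True] assms(2)]
    by (auto simp: count_in_def intro!: enn2real_mono)
qed (simp add: count_in_def)

lemma card_atoms_le_count:
  assumes "\<mu> \<in> hard_configs" "bounded B" "B \<in> sets borel"
  shows "real (card (atoms (slice s' \<mu>) \<inter> B)) \<le> count_in B \<mu>"
proof -
  have "ennreal (real (card (atoms (slice s' \<mu>) \<inter> B))) \<le> ennreal (count_in B \<mu>)"
    using hard_atomic_card_le[OF hard_configsD(3)[OF assms(1)] assms(2,3)]
    unfolding count_in_emeasure[OF assms(1,2)] by (simp add: ennreal_of_nat_eq_real_of_nat)
  then show ?thesis by (simp add: count_in_nonneg)
qed

lemma finite_atoms:
  assumes "\<mu> \<in> hard_configs" "bounded \<Lambda>" "\<Lambda> \<in> sets borel"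
  shows "finite (atoms (slice s' \<mu>) \<inter> \<Lambda>)" "atoms (slice s \<mu>) \<inter> \<Lambda> \<subseteq> atoms (slice s' \<mu>) \<inter> \<Lambda>"
  using hard_atomic_atoms(1)[OF hard_configsD(3)[OF assms(1)] assms(2,3)]
    atoms_slice_mono[OF hard_configsD(1)[OF assms(1)] mark_bounds] by auto

lemma betti_in_shift:
  assumes \<mu>: "\<mu> \<in> space configuration_space" and \<Lambda>: "bounded \<Lambda>" "\<Lambda> \<in> sets borel"
  shows "betti_in \<Lambda> (shift_configuration x \<mu>) = betti_in ((\<lambda>y. y + x) -` \<Lambda>) \<mu>"
proof (cases "\<mu> \<in> hard_configs")
  case True
  have eq: "(\<lambda>y. y + x) ` A \<inter> \<Lambda> = (\<lambda>y. y + x) ` (A \<inter> (\<lambda>y. y + x) -` \<Lambda>)" for A by auto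
  show ?thesis
    using True multicover_betti_translate[OF finite_atoms[OF True bounded_translate[OF \<Lambda>(1)] translate_borel[OF \<Lambda>(2)]] sizes radii]
    by (simp add: betti_in_def hard_configs_shift[OF \<mu>] atoms_slice_shift[OF \<mu>] eq)
qed (simp add: betti_in_def hard_configs_shift[OF \<mu>])

text \<open>
  The additional unit in \<open>\<rho>\<close> accounts for the side of a lattice cell. Points are
  bounded by the mass of the window, a measurable quantity that also counts multiplicities.
\<close>

lemma betti_in_localisation:
  fixes W :: "(real ^ 'n::{finite,linorder}) set" and \<Lambda> :: "'j \<Rightarrow> (real, 'n) vec set"
  assumes W: "bounded W" "W \<in> sets borel" and fU: "finite U" and fJ: "finite J"
    and sub: "\<And>j. j \<in> J \<Longrightarrow> \<Lambda> j \<subseteq> W"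
    and disj: "\<And>i j. i \<in> J \<Longrightarrow> j \<in> J \<Longrightarrow> i \<noteq> j \<Longrightarrow> \<Lambda> i \<inter> \<Lambda> j = {}"
    and \<rho>: "2 * r' + 1 \<le> \<rho>"
    and good: "\<And>x. x \<in> W \<Longrightarrow> lattice_cell x \<notin> U \<Longrightarrow> \<exists>j\<in>J. window \<rho> (lattice_cell x) \<inter> W \<subseteq> \<Lambda> j"
  shows "\<bar>betti_in W \<mu> - (\<Sum>j\<in>J. betti_in (\<Lambda> j) \<mu>)\<bar> \<le> (\<Sum>u\<in>U. 2 * count_in (window \<rho> u) \<mu> ^ (k * (q + 2)))"
proof (cases "\<mu> \<in> hard_configs")
  case True
  let ?Q = "atoms (slice s \<mu>) \<inter> W" and ?Q' = "atoms (slice s' \<mu>) \<inter> W"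
  note fin = finite_atoms[OF True W]
  have "\<bar>real (multicover_betti r r' k k' q ?Q ?Q') - (\<Sum>j\<in>J. real (multicover_betti r r' k k' q (?Q \<inter> \<Lambda> j) (?Q' \<inter> \<Lambda> j)))\<bar>
    \<le> (\<Sum>u\<in>U. 2 * real (card (?Q' \<inter> window \<rho> u)) ^ (k * (q + 2)))"
  proof (rule multicover_betti_localisation[OF fin sizes radii _ fU fJ disj])
    show "2 * r' \<le> \<rho> - 1" using \<rho> by simp
    show "y \<in> window \<rho> (lattice_cell x)" if "dist x y \<le> \<rho> - 1" for x y :: "(real, 'n) vec"
      by (rule near_in_window[OF that])
    fix x assume "x \<in> ?Q'" "lattice_cell x \<notin> U"
    then obtain j where "j \<in> J" "window \<rho> (lattice_cell x) \<inter> W \<subseteq> \<Lambda> j" using good[of x] by blast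
    then show "\<exists>j\<in>J. window \<rho> (lattice_cell x) \<inter> ?Q' \<subseteq> \<Lambda> j" by blast
  qed
  also have "\<dots> \<le> (\<Sum>u\<in>U. 2 * count_in (window \<rho> u) \<mu> ^ (k * (q + 2)))"
  proof (intro sum_mono mult_left_mono power_mono)
    fix u :: "'n \<Rightarrow> int"
    have w: "bounded (window \<rho> u)" "window \<rho> u \<in> sets borel" by (auto simp: window_def bounded_cbox)
    have "card (?Q' \<inter> window \<rho> u) \<le> card (atoms (slice s' \<mu>) \<inter> window \<rho> u)"
      by (rule card_mono[OF finite_atoms(1)[OF True w]]) blast
    then show "real (card (?Q' \<inter> window \<rho> u)) \<le> count_in (window \<rho> u) \<mu>"
      using card_atoms_le_count[OF True w] by linarith
  qed auto
  also have "(\<Sum>j\<in>J. real (multicover_betti r r' k k' q (?Q \<inter> \<Lambda> j) (?Q' \<inter> \<Lambda> j))) = (\<Sum>j\<in>J. betti_in (\<Lambda> j) \<mu>)"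
  proof (rule sum.cong[OF refl])
    fix j assume "j \<in> J"
    then have "A \<inter> W \<inter> \<Lambda> j = A \<inter> \<Lambda> j" for A using sub by blast
    then show "real (multicover_betti r r' k k' q (?Q \<inter> \<Lambda> j) (?Q' \<inter> \<Lambda> j)) = betti_in (\<Lambda> j) \<mu>"
      using True by (simp add: betti_in_def)
  qed
  finally show ?thesis using True by (simp add: betti_in_def)
next
  case False
  then show ?thesis by (simp add: betti_in_def count_in_def sum_nonneg)
qed

end

context persistence_parameters
begin

text \<open>
  Round the atoms to a grid. The grid points that occur are those whose cell has positive mass, so
  the rounded pattern is a measurable function with finitely many values. Its Betti number agrees
  with that of the atoms for all sufficiently fine grids, and limits of measurable functions are
  measurable.
\<close>

lemma betti_in_measurable:
  fixes \<Lambda> :: "(real ^ 'n::{finite,linorder}) set"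
  assumes \<Lambda>: "bounded \<Lambda>" "\<Lambda> \<in> sets borel"
  shows "betti_in \<Lambda> \<in> borel_measurable configuration_space"
proof -
  let ?N = "configuration_space :: ((real, 'n) vec \<times> real) measure measure"
  define G where "G j = grid_round j ` \<Lambda>" for j
  have G: "finite (G j)" for j unfolding G_def by (rule finite_grid_round_image[OF \<Lambda>(1)])
  define cell where "cell j z = {x. grid_round j x = z} \<inter> \<Lambda>" for j and z :: "(real, 'n) vec"
  have cell: "cell j z \<in> sets borel" "bounded (cell j z)" for j z
    unfolding cell_def using grid_cell_borel[of j z] \<Lambda> by (auto intro: bounded_subset)
  \<comment> \<open>The rounded pattern, expressed by masses of grid cells so as to be defined for every measure.\<close>
  define S where "S t j \<mu> = {z \<in> G j. emeasure (slice t \<mu>) (cell j z) \<noteq> 0}" for t j and \<mu> :: "((real, 'n) vec \<times> real) measure"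
  have S_eq: "S t j \<mu> = grid_round j ` (atoms (slice t \<mu>) \<inter> \<Lambda>)" if "hard_atomic (slice t \<mu>)" for t j \<mu>
  proof -
    have e: "emeasure (slice t \<mu>) (cell j z) \<noteq> 0 \<longleftrightarrow> (\<exists>x\<in>atoms (slice t \<mu>) \<inter> \<Lambda>. grid_round j x = z)" for z
      using hard_atomic_zero_iff[OF that cell(2,1), of j z] unfolding cell_def by blast
    show ?thesis
    proof (intro subset_antisym subsetI)
      fix z assume "z \<in> S t j \<mu>"
      then have "emeasure (slice t \<mu>) (cell j z) \<noteq> 0" by (simp add: S_def)
      then obtain x where "x \<in> atoms (slice t \<mu>) \<inter> \<Lambda>" "grid_round j x = z" 
        using iffD1[OF e] by blast
      then show "z \<in> grid_round j ` (atoms (slice t \<mu>) \<inter> \<Lambda>)" by (intro image_eqI[of z _ x]) simp_all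
    next
      fix z assume "z \<in> grid_round j ` (atoms (slice t \<mu>) \<inter> \<Lambda>)"
      then obtain x where x: "x \<in> atoms (slice t \<mu>) \<inter> \<Lambda>" "grid_round j x = z" by (elim imageE) simp
      then have "emeasure (slice t \<mu>) (cell j z) \<noteq> 0" using e[of z] by (intro iffD2[OF e] bexI[of _ x])
      moreover have "z \<in> G j" unfolding G_def using x by (intro image_eqI[of z _ x]) simp_all
      ultimately show "z \<in> S t j \<mu>" by (simp add: S_def)
    qed
  qed
  have Sm: "{\<mu> \<in> space ?N. S t j \<mu> = a} \<in> sets ?N" for t j a
  proof (cases "a \<subseteq> G j")
    case True
    have "{\<mu> \<in> space ?N. S t j \<mu> = a} = {\<mu> \<in> space ?N. \<forall>z\<in>G j. z \<in> a \<longleftrightarrow> emeasure (slice t \<mu>) (cell j z) \<noteq> 0}"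
      using True unfolding S_def by blast
    also have "\<dots> \<in> sets ?N"
    proof (rule sets.sets_Collect_finite_All[OF _ G])
      fix z
      have [measurable]: "(\<lambda>\<mu>. emeasure (slice t \<mu>) (cell j z)) \<in> borel_measurable ?N"
        by (rule measurable_emeasure_slice[OF cell(1)])
      show "{\<mu> \<in> space ?N. z \<in> a \<longleftrightarrow> emeasure (slice t \<mu>) (cell j z) \<noteq> 0} \<in> sets ?N"
        by measurable
    qed
    finally show ?thesis .
  next
    case False
    then have e: "{\<mu> \<in> space ?N. S t j \<mu> = a} = {}" unfolding S_def by blast
    show ?thesis unfolding e by simp
  qed
  define b where "b j \<mu> = real (multicover_betti (r + grid_error TYPE('n) j) (r' + grid_error TYPE('n) j) k k' q
      (S s j \<mu>) (S s' j \<mu>))" for j \<mu>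
  have bm: "b j \<in> borel_measurable ?N" for j
  proof -
    let ?D = "Pow (G j) \<times> Pow (G j)"
    have "(\<lambda>\<mu>. (S s j \<mu>, S s' j \<mu>)) \<in> measurable ?N (count_space ?D)"
    proof (subst measurable_count_space_eq2)
      show "finite ?D" using G by simp
      have "(\<lambda>\<mu>. (S s j \<mu>, S s' j \<mu>)) -` {(a, a')} \<inter> space ?N \<in> sets ?N" for a a'
      proof -
        have "(\<lambda>\<mu>. (S s j \<mu>, S s' j \<mu>)) -` {(a, a')} \<inter> space ?N
            = {\<mu> \<in> space ?N. S s j \<mu> = a} \<inter> {\<mu> \<in> space ?N. S s' j \<mu> = a'}" by blast
        then show ?thesis using Sm by simp
      qed
      then show "(\<lambda>\<mu>. (S s j \<mu>, S s' j \<mu>)) \<in> space ?N \<rightarrow> ?D \<and>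
          (\<forall>p\<in>?D. (\<lambda>\<mu>. (S s j \<mu>, S s' j \<mu>)) -` {p} \<inter> space ?N \<in> sets ?N)"
        by (auto simp: S_def)
    qed
    from measurable_compose[OF this, of "\<lambda>(a, a'). real (multicover_betti (r + grid_error TYPE('n) j) (r' + grid_error TYPE('n) j) k k' q a a')" borel]
    show ?thesis unfolding b_def by simp
  qed
  have lim: "lim (\<lambda>j. b j \<mu>) = betti_in \<Lambda> \<mu>" if h: "\<mu> \<in> hard_configs" for \<mu>
  proof (rule limI, rule tendsto_eventually)
    show "\<forall>\<^sub>F j in sequentially. b j \<mu> = betti_in \<Lambda> \<mu>"
      using multicover_betti_grid_round[OF finite_atoms[OF h \<Lambda>] sizes radii, of q]
      by eventually_elim
        (simp add: b_def betti_in_def h S_eq[OF hard_configsD(2)[OF h]] S_eq[OF hard_configsD(3)[OF h]])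
  qed
  have "(\<lambda>\<mu>. if \<mu> \<in> hard_configs then lim (\<lambda>j. b j \<mu>) else 0) \<in> borel_measurable ?N"
    using hard_configs_sets bm by (intro measurable_If_set borel_measurable_lim_metric) auto
  moreover have "(\<lambda>\<mu>. if \<mu> \<in> hard_configs then lim (\<lambda>j. b j \<mu>) else 0) = betti_in \<Lambda>"
    by (rule ext) (simp add: lim betti_in_def[of \<Lambda>])
  ultimately show ?thesis by simp
qed

end

section \<open>The configuration of a point process\<close>

lemma emeasure_configuration:
  "A \<in> sets borel \<Longrightarrow> emeasure (configuration X M \<omega>) A = emeasure (count_space UNIV) {i. (X i \<omega>, M i \<omega>) \<in> A}"
  unfolding configuration_def by (subst emeasure_distr) (auto simp: vimage_def)

lemma configuration_in_space: "configuration X M \<omega> \<in> space configuration_space"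
  by (simp add: space_configuration_space configuration_def)

lemma configuration_shift:
  "configuration (\<lambda>i \<omega>. X i \<omega> + x) M \<omega> = shift_configuration x (configuration X M \<omega>)"
proof (rule measure_eqI)
  fix A assume "A \<in> sets (configuration (\<lambda>i \<omega>. X i \<omega> + x) M \<omega>)"
  then have A: "A \<in> sets borel" by (simp add: configuration_def)
  have A': "(\<lambda>(z, m). (z + x, m)) -` A \<in> sets borel"
    using measurable_sets[OF shift_measurable A, of x] by simp
  show "emeasure (configuration (\<lambda>i \<omega>. X i \<omega> + x) M \<omega>) A
      = emeasure (shift_configuration x (configuration X M \<omega>)) A"
    by (simp add: emeasure_configuration[OF A] emeasure_configuration[OF A']
        emeasure_shift_configuration[OF configuration_in_space A])
qed (simp add: configuration_def sets_shift_configuration)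

lemma emeasure_slice_configuration:
  "B \<in> sets borel \<Longrightarrow> emeasure (slice s (configuration X M \<omega>)) B
    = emeasure (count_space UNIV) {i. X i \<omega> \<in> B \<and> M i \<omega> \<le> s}"
  by (simp add: emeasure_slice[OF configuration_in_space] emeasure_configuration[OF Times_borel])

lemma one_le_emeasure_count_space:
  "1 \<le> emeasure (count_space UNIV) S \<longleftrightarrow> S \<noteq> {}"
proof
  assume "S \<noteq> {}"
  then obtain i where "i \<in> S" by blast
  then have "emeasure (count_space UNIV) {i} \<le> emeasure (count_space UNIV) S" by (intro emeasure_mono) auto
  then show "1 \<le> emeasure (count_space UNIV) S" by simp
qed auto

lemma atoms_slice_configuration:
  "atoms (slice s (configuration X M \<omega>)) = {X i \<omega> | i. M i \<omega> \<le> s}"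
  unfolding atoms_def by (simp add: emeasure_slice_configuration one_le_emeasure_count_space) blast

context marked_point_process
begin

text \<open>
  Masses are numbers of points, hence zero or at least one.
\<close>

lemma hard_atomic_configuration:
  assumes "\<omega> \<in> space \<Omega>"
  shows "hard_atomic (slice s (configuration X M \<omega>))"
  unfolding hard_atomic_def
proof (intro conjI allI impI)
  fix n :: nat
  have "finite {i. X i \<omega> \<in> cball 0 (real n)}" by (rule locally_finite[OF assms]) simp
  then have "finite {i. X i \<omega> \<in> cball 0 (real n) \<and> M i \<omega> \<le> s}" by (rule rev_finite_subset) blast
  then show "emeasure (slice s (configuration X M \<omega>)) (cball 0 (real n)) < \<infinity>"
    by (simp add: emeasure_slice_configuration emeasure_count_space_finite of_nat_less_top del: mem_cball)
next
  fix U :: "(real ^ 'n) set" assume "open U"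
  then have "emeasure (slice s (configuration X M \<omega>)) U
      = emeasure (count_space UNIV) {i. X i \<omega> \<in> U \<and> M i \<omega> \<le> s}"
    by (intro emeasure_slice_configuration) simp
  moreover have "emeasure (count_space UNIV) A = 0 \<or> 1 \<le> emeasure (count_space UNIV) A" for A :: "nat set"
    unfolding one_le_emeasure_count_space by (cases "A = {}") simp_all
  ultimately show "emeasure (slice s (configuration X M \<omega>)) U = 0 \<or> 1 \<le> emeasure (slice s (configuration X M \<omega>)) U"
    by metis
qed simp

lemma configuration_measurable: "configuration X M \<in> measurable \<Omega> configuration_space"
proof (rule measurable_configuration_spaceI)
  fix A :: "((real ^ 'n) \<times> real) set" assume A: "A \<in> sets borel"
  have [measurable]: "(\<lambda>\<omega>. (X i \<omega>, M i \<omega>)) \<in> borel_measurable \<Omega>" for i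
    using location_measurable mark_measurable by (intro borel_measurable_Pair)
  have "emeasure (configuration X M \<omega>) A = (\<Sum>i. indicator A (X i \<omega>, M i \<omega>))" for \<omega>
  proof -
    have "emeasure (configuration X M \<omega>) A = (\<integral>\<^sup>+i. indicator {i. (X i \<omega>, M i \<omega>) \<in> A} i \<partial>count_space UNIV)"
      by (simp add: emeasure_configuration[OF A])
    also have "\<dots> = (\<Sum>i. indicator {i. (X i \<omega>, M i \<omega>) \<in> A} i)" by (rule nn_integral_count_space_nat)
    also have "\<dots> = (\<Sum>i. indicator A (X i \<omega>, M i \<omega>))" by (simp add: indicator_def)
    finally show ?thesis .
  qed
  moreover have "(\<lambda>\<omega>. \<Sum>i. indicator A (X i \<omega>, M i \<omega>) :: ennreal) \<in> borel_measurable \<Omega>"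
    using A by measurable
  ultimately show "(\<lambda>\<omega>. emeasure (configuration X M \<omega>) A) \<in> borel_measurable \<Omega>" by simp
qed (simp add: configuration_def)

text \<open>
  Shifting the points of the process by \<open>x\<close> shifts its counting measure, and
  stationarity equates the laws.
\<close>

lemma process_law_shift:
  assumes "stationary_process \<Omega> X M"
  shows "measure_preserving (process_law \<Omega> X M) (shift_configuration x)"
proof -
  let ?P = "process_law \<Omega> X M"
  have sets: "sets ?P = sets configuration_space" by (simp add: process_law_def)
  have m: "shift_configuration x \<in> measurable ?P ?P"
    using shift_configuration_measurable[of x] by (simp cong: measurable_cong_sets add: sets)
  have "distr ?P ?P (shift_configuration x) = distr ?P configuration_space (shift_configuration x)"
    by (rule distr_cong) (simp_all add: sets)
  also have "\<dots> = distr \<Omega> configuration_space (shift_configuration x \<circ> configuration X M)"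
    unfolding process_law_def by (rule distr_distr[OF shift_configuration_measurable configuration_measurable])
  also have "shift_configuration x \<circ> configuration X M = configuration (\<lambda>i \<omega>. X i \<omega> + x) M"
    by (rule ext) (simp add: configuration_shift)
  also have "distr \<Omega> configuration_space \<dots> = process_law \<Omega> (\<lambda>i \<omega>. X i \<omega> + x) M"
    by (simp add: process_law_def)
  also have "\<dots> = ?P" using assms by (simp add: stationary_process_def)
  finally show ?thesis using m by (simp add: measure_preserving_def)
qed

end

section \<open>Lattice boxes and tiles\<close>

text \<open>
  Lattice vectors are indexed by integer functions, on which boxes can be written as products.
\<close>

definition int_vec :: "('n \<Rightarrow> int) \<Rightarrow> real ^ 'n::finite" where
  "int_vec u = (\<chi> i. of_int (u i))"

text \<open>
  Union bound over the coordinate that lies in \<open>Y\<close>. It shows that borders of boxes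
  are lower dimensional.
\<close>

lemma card_box_with_marked_coordinate:
  fixes A Y :: "int set"
  assumes fin: "finite A"
  shows "card {u \<in> PiE (UNIV :: 'n::finite set) (\<lambda>_. A). \<exists>i. u i \<in> Y}
    \<le> CARD('n) * (card (A \<inter> Y) * card A ^ (CARD('n) - 1))"
proof -
  let ?B = "\<lambda>i. PiE (UNIV :: 'n set) (\<lambda>j. if j = i then A \<inter> Y else A)"
  have finB: "finite (?B i)" for i using fin by (intro finite_PiE) auto
  have cB: "card (?B i) = card (A \<inter> Y) * card A ^ (CARD('n) - 1)" for i :: 'n
  proof -
    have "card (?B i) = (\<Prod>j\<in>UNIV. card (if j = i then A \<inter> Y else A))" by (simp add: card_PiE)
    also have "\<dots> = card (A \<inter> Y) * (\<Prod>j\<in>UNIV - {i}. card (if j = i then A \<inter> Y else A))"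
      by (subst prod.remove[of UNIV i]) auto
    also have "(\<Prod>j\<in>UNIV - {i}. card (if j = i then A \<inter> Y else A)) = (\<Prod>j\<in>UNIV - {i}. card A)"
      by (rule prod.cong) auto
    also have "\<dots> = card A ^ (CARD('n) - 1)" by simp
    finally show ?thesis .
  qed
  have "{u \<in> PiE (UNIV :: 'n set) (\<lambda>_. A). \<exists>i. u i \<in> Y} \<subseteq> (\<Union>i. ?B i)"
    by (auto simp: PiE_def Pi_def)
  then have "card {u \<in> PiE (UNIV :: 'n set) (\<lambda>_. A). \<exists>i. u i \<in> Y} \<le> card (\<Union>i. ?B i)"
    using finB by (intro card_mono) auto
  also have "\<dots> \<le> (\<Sum>i\<in>UNIV. card (?B i))" by (rule card_UN_le) simp
  also have "\<dots> = CARD('n) * (card (A \<inter> Y) * card A ^ (CARD('n) - 1))" by (simp add: cB)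
  finally show ?thesis .
qed

text \<open>
  Half-open, so that distinct tiles are disjoint.
\<close>

definition tile :: "nat \<Rightarrow> ('n \<Rightarrow> nat) \<Rightarrow> (real ^ 'n::finite) set" where
  "tile m z = {x. \<forall>i. real (m * z i) \<le> x $ i \<and> x $ i < real (m * z i) + real m}"

text \<open>
  The lattice cells of the tile at the origin that come within \<open>\<rho>\<close> of its
  border.
\<close>

definition tile_border :: "nat \<Rightarrow> nat \<Rightarrow> ('n::finite \<Rightarrow> int) set" where
  "tile_border \<rho> m = {w \<in> PiE UNIV (\<lambda>_. {0..<int m}). \<exists>i. w i \<in> {..<int \<rho>} \<union> {int m - int \<rho>..}}"

text \<open>
  The lattice cells within \<open>R\<close> of the boundary of the cube of side \<open>n\<close>,
  on both sides of the boundary.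
\<close>

definition shell :: "nat \<Rightarrow> nat \<Rightarrow> ('n::finite \<Rightarrow> int) set" where
  "shell R n = {u \<in> PiE UNIV (\<lambda>_. {- int R..<int n + int R}). \<exists>i. u i \<in> {..<int R} \<union> {int n - int R..}}"

lemma finite_tile_border: "finite (tile_border \<rho> m)"
  unfolding tile_border_def by (rule finite_subset[of _ "PiE UNIV (\<lambda>_. {0..<int m})"]) (auto intro: finite_PiE)

lemma finite_shell: "finite (shell R n)"
  unfolding shell_def by (rule finite_subset[of _ "PiE UNIV (\<lambda>_. {- int R..<int n + int R})"]) (auto intro: finite_PiE)

lemma card_tile_border:
  "card (tile_border \<rho> m :: ('n::finite \<Rightarrow> int) set) \<le> CARD('n) * (2 * \<rho> * m ^ (CARD('n) - 1))"
proof -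
  have "card ({0..<int m} \<inter> ({..<int \<rho>} \<union> {int m - int \<rho>..})) \<le> card ({0..<int \<rho>} \<union> {int m - int \<rho>..<int m})"
    by (rule card_mono) auto
  also have "\<dots> \<le> card {0..<int \<rho>} + card {int m - int \<rho>..<int m}" by (rule card_Un_le)
  finally have c: "card ({0..<int m} \<inter> ({..<int \<rho>} \<union> {int m - int \<rho>..})) \<le> 2 * \<rho>" by simp
  have "card (tile_border \<rho> m :: ('n \<Rightarrow> int) set)
      \<le> CARD('n) * (card ({0..<int m} \<inter> ({..<int \<rho>} \<union> {int m - int \<rho>..})) * card {0..<int m} ^ (CARD('n) - 1))"
    unfolding tile_border_def by (rule card_box_with_marked_coordinate) simp
  also have "\<dots> \<le> CARD('n) * (2 * \<rho> * card {0..<int m} ^ (CARD('n) - 1))"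
    by (intro mult_le_mono c order_refl)
  finally show ?thesis by simp
qed

lemma card_shell:
  "card (shell R n :: ('n::finite \<Rightarrow> int) set) \<le> CARD('n) * (4 * R * (n + 2 * R) ^ (CARD('n) - 1))"
proof -
  let ?A = "{- int R..<int n + int R}"
  have "card (?A \<inter> ({..<int R} \<union> {int n - int R..})) \<le> card ({- int R..<int R} \<union> {int n - int R..<int n + int R})"
    by (rule card_mono) auto
  also have "\<dots> \<le> card {- int R..<int R} + card {int n - int R..<int n + int R}" by (rule card_Un_le)
  finally have c: "card (?A \<inter> ({..<int R} \<union> {int n - int R..})) \<le> 4 * R" by simp
  have A: "card ?A = n + 2 * R" by simp
  have "card (shell R n :: ('n \<Rightarrow> int) set)
      \<le> CARD('n) * (card (?A \<inter> ({..<int R} \<union> {int n - int R..})) * card ?A ^ (CARD('n) - 1))"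
    unfolding shell_def by (rule card_box_with_marked_coordinate) simp
  also have "\<dots> \<le> CARD('n) * (4 * R * (n + 2 * R) ^ (CARD('n) - 1))"
    unfolding A by (intro mult_le_mono c order_refl)
  finally show ?thesis .
qed

lemma shell_mono:
  assumes R: "R \<le> R'"
  shows "shell R n \<subseteq> (shell R' n :: ('a::finite \<Rightarrow> int) set)"
proof -
  show "shell R n \<subseteq> (shell R' n :: ('a \<Rightarrow> int) set)"
  proof
    fix u :: "'a \<Rightarrow> int" assume u: "u \<in> shell R n"
    then obtain i where "u i \<in> {..<int R} \<union> {int n - int R..}" by (auto simp: shell_def)
    then have "u i \<in> {..<int R'} \<union> {int n - int R'..}" using R by auto
    moreover have "u i \<in> {- int R'..<int n + int R'}" for i
    proof -
      have "u i \<in> {- int R..<int n + int R}" using u by (auto simp: shell_def PiE_def Pi_def)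
      then show ?thesis using R by auto
    qed
    ultimately show "u \<in> shell R' n" unfolding shell_def PiE_UNIV_domain by blast
  qed
qed

lemma tile_borel:
  fixes z :: "'n::finite \<Rightarrow> nat"
  shows "tile m z \<in> sets borel"
proof -
  have "{x :: (real, 'n) vec. real (m * z i) \<le> x $ i \<and> x $ i < real (m * z i) + real m} \<in> sets borel" for i
    by measurable
  then have "{x \<in> space (borel :: (real, 'n) vec measure). \<forall>i\<in>UNIV. real (m * z i) \<le> x $ i \<and> x $ i < real (m * z i) + real m} \<in> sets borel"
    by (intro sets.sets_Collect_finite_All) auto
  then show ?thesis by (simp add: tile_def)
qed

lemma tile_bounded: "bounded (tile m z)"
  by (rule bounded_subset[OF bounded_cbox[of "\<chi> i. real (m * z i)" "\<chi> i. real (m * z i) + real m"]])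
     (auto simp: tile_def mem_box_cart less_imp_le)

lemma tile_disjoint:
  assumes "z \<noteq> z'" shows "tile m z \<inter> tile m z' = {}"
proof -
  have key: False if lt: "a < b" and x: "y < real (m * a) + real m" "real (m * b) \<le> y" for a b :: nat and y
  proof -
    have "m * Suc a \<le> m * b" using lt by (intro mult_le_mono2) simp
    then have "real (m * Suc a) \<le> real (m * b)" by (simp only: of_nat_le_iff)
    then show False using x by simp
  qed
  obtain i where i: "z i \<noteq> z' i" using assms by blast
  have False if "x \<in> tile m z" "x \<in> tile m z'" for x
    using that i key[of "z i" "z' i" "x $ i"] key[of "z' i" "z i" "x $ i"]
    unfolding tile_def by (cases "z i < z' i") auto
  then show ?thesis by blast
qed

lemma mem_cube: "x \<in> cube n \<longleftrightarrow> (\<forall>i. 0 \<le> x $ i \<and> x $ i \<le> real n)"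
  by (auto simp: cube_def mem_box_cart)

lemma cube_borel: "cube n \<in> sets borel" and cube_bounded: "bounded (cube n)"
  by (auto simp: cube_def bounded_cbox)

lemma tile_subset_cube:
  assumes z: "z \<in> PiE UNIV (\<lambda>_. {..<n div m})"
  shows "tile m z \<subseteq> cube n"
proof
  fix x assume x: "x \<in> tile m z"
  show "x \<in> cube n"
    unfolding mem_cube
  proof
    fix i
    have "Suc (z i) \<le> n div m" using z by (auto simp: PiE_def Pi_def Suc_le_eq)
    then have "m * Suc (z i) \<le> m * (n div m)" by (rule mult_le_mono2)
    also have "\<dots> \<le> n" by simp
    finally have "real (m * Suc (z i)) \<le> real n" by (simp only: of_nat_le_iff)
    moreover have "real (m * z i) \<le> x $ i" "x $ i < real (m * z i) + real m" using x by (auto simp: tile_def)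
    moreover have "real (m * Suc (z i)) = real (m * z i) + real m" by (simp add: algebra_simps)
    moreover have "0 \<le> real (m * z i)" by simp
    ultimately show "0 \<le> x $ i \<and> x $ i \<le> real n" by linarith
  qed
qed

lemma tile_translate:
  "(\<lambda>y. y + (- int_vec (\<lambda>i. int (m * z i)))) -` tile m (\<lambda>_. 0) = tile m z"
  by (auto simp: tile_def int_vec_def algebra_simps)

lemma window_borel: "window \<rho> u \<in> sets borel" and window_bounded: "bounded (window \<rho> u)"
  by (auto simp: window_def bounded_cbox)

lemma window_translate:
  "(\<lambda>y. y + (- int_vec v)) -` window \<rho> u = window \<rho> (\<lambda>i. u i + v i)"
  by (auto simp: mem_window int_vec_def algebra_simps)

text \<open>
  Transfers the moment condition from the unit cube to windows.
\<close>

lemma window_covered_by_unit_cubes: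
  "window (real \<rho>) u \<subseteq> (\<Union>v\<in>PiE UNIV (\<lambda>i. {u i - int \<rho>..u i + int \<rho>}). (\<lambda>y. y + (- int_vec v)) -` cube 1)"
proof
  fix y assume y: "y \<in> window (real \<rho>) u"
  have "lattice_cell y \<in> PiE UNIV (\<lambda>i. {u i - int \<rho>..u i + int \<rho>})"
    unfolding PiE_UNIV_domain Pi_def lattice_cell_def
  proof (intro CollectI allI impI)
    fix i
    have "of_int (u i) - real \<rho> \<le> y $ i" "y $ i \<le> of_int (u i) + real \<rho>" using y by (auto simp: mem_window)
    then show "\<lfloor>y $ i\<rfloor> \<in> {u i - int \<rho>..u i + int \<rho>}" by (simp add: le_floor_iff) linarith
  qed
  moreover have "y + (- int_vec (lattice_cell y)) \<in> cube 1"
    unfolding mem_cube by (auto simp: int_vec_def lattice_cell_def) linarith+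
  ultimately show "y \<in> (\<Union>v\<in>PiE UNIV (\<lambda>i. {u i - int \<rho>..u i + int \<rho>}). (\<lambda>y. y + (- int_vec v)) -` cube 1)"
    by blast
qed

section \<open>Averages over boxes of shifts\<close>

lemma shift_configuration_funpow:
  assumes "\<mu> \<in> space configuration_space"
  shows "(shift_configuration x ^^ j) \<mu> = shift_configuration (real j *\<^sub>R x) \<mu>"
proof (induction j)
  case 0
  show ?case by (simp add: shift_configuration_0[OF assms])
next
  case (Suc j)
  then show ?case by (simp add: shift_configuration_shift[OF assms] scaleR_left_distrib)
qed

text \<open>
  The translation vector reached when the shifts along the axes in \<open>I\<close> are applied
  \<open>z\<close> times.
\<close>

definition offset :: "nat \<Rightarrow> 'n set \<Rightarrow> ('n \<Rightarrow> nat) \<Rightarrow> real ^ 'n::finite" where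
  "offset m I z = (\<chi> i. if i \<in> I then real (m * z i) else 0)"

text \<open>
  Iterated averages over the shifts along the coordinate axes are averages over a box of the
  lattice of mesh \<open>m\<close>.
\<close>

lemma multi_avg_shift:
  fixes f :: "((real ^ 'n::finite) \<times> real) measure \<Rightarrow> real"
  assumes "distinct is" "\<mu> \<in> space configuration_space"
  shows "multi_avg (map (\<lambda>i. shift_configuration (- (real m *\<^sub>R axis i 1))) is) N f \<mu>
    = (\<Sum>z\<in>PiE (set is) (\<lambda>_. {..<N}). f (shift_configuration (- offset m (set is) z) \<mu>)) / real N ^ length is"
  using assms
proof (induction "is" arbitrary: \<mu>)
  case Nil
  have "offset m {} z = (0 :: real ^ 'n)" for z by (simp add: offset_def vec_eq_iff)
  then show ?case using Nil by (simp add: shift_configuration_0)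
next
  case (Cons i "is")
  let ?I = "set is" and ?T = "shift_configuration (- (real m *\<^sub>R axis i 1)) :: ((real ^ 'n) \<times> real) measure \<Rightarrow> _"
  let ?F = "\<lambda>z \<mu>. f (shift_configuration (- offset m ?I z) \<mu>)"
  have i: "i \<notin> ?I" using Cons.prems by simp
  have orbit: "(?T ^^ j) \<mu> = shift_configuration (- (real (m * j) *\<^sub>R axis i 1)) \<mu>" for j
    using shift_configuration_funpow[OF Cons.prems(2), where x = "- (real m *\<^sub>R axis i 1)" and j = j] by (simp add: mult.commute)
  have IH: "multi_avg (map (\<lambda>i. shift_configuration (- (real m *\<^sub>R axis i 1))) is) N f ((?T ^^ j) \<mu>)
      = (\<Sum>z\<in>PiE ?I (\<lambda>_. {..<N}). ?F z ((?T ^^ j) \<mu>)) / real N ^ length is" for j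
    using Cons.prems unfolding orbit by (intro Cons.IH shift_configuration_space) simp_all
  have "multi_avg (map (\<lambda>i. shift_configuration (- (real m *\<^sub>R axis i 1))) (i # is)) N f \<mu>
      = (\<Sum>j<N. multi_avg (map (\<lambda>i. shift_configuration (- (real m *\<^sub>R axis i 1))) is) N f ((?T ^^ j) \<mu>)) / real N"
    by (simp add: birkhoff_avg_def birkhoff_sum_def)
  also have "\<dots> = (\<Sum>j<N. (\<Sum>z\<in>PiE ?I (\<lambda>_. {..<N}). ?F z ((?T ^^ j) \<mu>)) / real N ^ length is) / real N"
    by (simp only: IH)
  also have "\<dots> = (\<Sum>j<N. \<Sum>z\<in>PiE ?I (\<lambda>_. {..<N}). ?F z ((?T ^^ j) \<mu>)) / real N ^ length (i # is)"
    by (simp add: sum_divide_distrib[symmetric] mult.commute)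
  also have "(\<Sum>j<N. \<Sum>z\<in>PiE ?I (\<lambda>_. {..<N}). ?F z ((?T ^^ j) \<mu>))
      = (\<Sum>(j, z)\<in>{..<N} \<times> PiE ?I (\<lambda>_. {..<N}). f (shift_configuration (- offset m (set (i # is)) (z(i := j))) \<mu>))"
    unfolding sum.cartesian_product
  proof (rule sum.cong[OF refl], clarify)
    fix j z
    have "- offset m ?I z + - (real (m * j) *\<^sub>R axis i 1) = - offset m (set (i # is)) (z(i := j))"
      using i by (auto simp: vec_eq_iff offset_def axis_def)
    then show "?F z ((?T ^^ j) \<mu>) = f (shift_configuration (- offset m (set (i # is)) (z(i := j))) \<mu>)"
      unfolding orbit by (simp only: shift_configuration_shift[OF Cons.prems(2)])
  qed
  also have "\<dots> = (\<Sum>z\<in>PiE (set (i # is)) (\<lambda>_. {..<N}). f (shift_configuration (- offset m (set (i # is)) z) \<mu>))"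
    unfolding list.set PiE_insert_eq using inj_combinator[OF i, of "\<lambda>_. {..<N}"]
    by (subst sum.reindex) (auto simp: case_prod_beta)
  finally show ?case .
qed

lemma dominated_limit_cong:
  assumes "dominated_limit M G g" "\<And>n x. x \<in> space M \<Longrightarrow> G n x = G' n x"
  shows "dominated_limit M G' g"
proof -
  have "G' n \<in> borel_measurable M" for n
    using assms measurable_cong[of M "G n" "G' n" borel] by (auto simp: dominated_limit_def)
  moreover have "AE x in M. (\<lambda>n. G' n x) \<longlonglongrightarrow> g x"
  proof -
    have "AE x in M. (\<lambda>n. G n x) \<longlonglongrightarrow> g x" using assms(1) by (simp add: dominated_limit_def)
    then show ?thesis using AE_space by eventually_elim (simp add: assms(2))
  qed
  moreover obtain h where h: "all_moments M h" "AE x in M. \<forall>n. \<bar>G n x\<bar> \<le> h x"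
    using assms(1) by (auto simp: dominated_limit_def)
  from h(2) have "AE x in M. \<forall>n. \<bar>G' n x\<bar> \<le> h x"
    using AE_space by eventually_elim (simp add: assms(2))
  ultimately show ?thesis using assms(1) h(1) by (auto simp: dominated_limit_def)
qed

text \<open>
  Shifting the configuration by \<open>- v\<close> evaluates \<open>f\<close> at the position
  \<open>v\<close>.
\<close>

definition box_sum :: "nat \<Rightarrow> nat \<Rightarrow> (((real ^ 'n::finite) \<times> real) measure \<Rightarrow> real) \<Rightarrow> ((real ^ 'n::finite) \<times> real) measure \<Rightarrow> real" where
  "box_sum m N f \<mu> = (\<Sum>z\<in>PiE UNIV (\<lambda>_. {..<N}). f (shift_configuration (- int_vec (\<lambda>i. int (m * z i))) \<mu>))"

text \<open>
  The Cauchy criterion for a sequence that is only known to lie close to convergent ones.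
\<close>

lemma convergent_if_approximable:
  fixes a :: "nat \<Rightarrow> real"
  assumes "\<And>e. e > 0 \<Longrightarrow> \<exists>s S t T. (\<forall>n. \<bar>a n - s n\<bar> \<le> t n) \<and> s \<longlonglongrightarrow> S \<and> t \<longlonglongrightarrow> T \<and> T < e"
  shows "convergent a"
proof -
  have "Cauchy a"
    unfolding Cauchy_def
  proof (intro allI impI)
    fix e :: real assume e: "e > 0"
    then obtain s S t T where *: "\<And>n. \<bar>a n - s n\<bar> \<le> t n" "s \<longlonglongrightarrow> S" "t \<longlonglongrightarrow> T" "T < e / 4"
      using assms[of "e / 4"] by auto
    have "\<forall>\<^sub>F n in sequentially. t n < e / 4" by (rule order_tendstoD(2)[OF *(3,4)])
    moreover have "\<forall>\<^sub>F n in sequentially. dist (s n) S < e / 4" using tendstoD[OF *(2), of "e/4"] e by simp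
    ultimately have "\<forall>\<^sub>F n in sequentially. dist (a n) S < e / 2"
    proof eventually_elim
      case (elim n)
      then show ?case using *(1)[of n] by (simp add: dist_real_def abs_if split: if_splits)
    qed
    then obtain M where M: "\<And>n. n \<ge> M \<Longrightarrow> dist (a n) S < e / 2" by (auto simp: eventually_sequentially)
    show "\<exists>M. \<forall>m\<ge>M. \<forall>n\<ge>M. dist (a m) (a n) < e"
    proof (intro exI allI impI)
      fix m n assume "m \<ge> M" "n \<ge> M"
      then show "dist (a m) (a n) < e" using M[of m] M[of n] dist_triangle2[of "a m" "a n" S] by simp
    qed
  qed
  then show ?thesis by (rule Cauchy_convergent)
qed

lemma div_ratio_tendsto:
  assumes m: "m \<ge> (1::nat)"
  shows "(\<lambda>n. real (n div m) / real n) \<longlonglongrightarrow> 1 / real m"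
proof (rule real_tendsto_sandwich)
  have "real (n div m) * real m \<le> real n" for n
    using div_times_less_eq_dividend[of n m] by (simp only: of_nat_mult[symmetric] of_nat_le_iff)
  then show "\<forall>\<^sub>F n in sequentially. real (n div m) / real n \<le> 1 / real m"
    using m by (intro eventually_sequentiallyI[of 1]) (simp add: field_simps)
  have "real n \<le> real (n div m) * real m + real m" for n
  proof -
    have "n \<le> (n div m) * m + m" using div_mult_mod_eq[of n m] mod_less_divisor[of m n] m by linarith
    then show ?thesis by (simp only: of_nat_mult[symmetric] of_nat_add[symmetric] of_nat_le_iff)
  qed
  note le = this
  show "\<forall>\<^sub>F n in sequentially. 1 / real m - 1 / real n \<le> real (n div m) / real n"
  proof (intro eventually_sequentiallyI[of 1])
    fix n :: nat assume n: "n \<ge> 1"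
    have "1 / real m - 1 / real n = (real n - real m) / (real m * real n)"
      using m n by (simp add: field_simps)
    also have "\<dots> \<le> (real (n div m) * real m) / (real m * real n)"
      using le[of n] by (intro divide_right_mono) auto
    also have "\<dots> = real (n div m) / real n" using m by simp
    finally show "1 / real m - 1 / real n \<le> real (n div m) / real n" .
  qed
  have "(\<lambda>n. 1 / real m - 1 / real n) \<longlonglongrightarrow> 1 / real m - 0"
    by (intro tendsto_intros lim_1_over_n)
  then show "(\<lambda>n. 1 / real m - 1 / real n) \<longlonglongrightarrow> 1 / real m" by simp
qed simp

lemma filterlim_div_at_top:
  assumes m: "m \<ge> (1::nat)"
  shows "filterlim (\<lambda>n. n div m) at_top sequentially"
  unfolding filterlim_at_top
proof
  fix Z
  show "\<forall>\<^sub>F n in sequentially. Z \<le> n div m"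
    using m by (intro eventually_sequentiallyI[of "Z * m"]) (simp add: less_eq_div_iff_mult_less_eq)
qed

section \<open>The law of large numbers for stationary ergodic configurations\<close>

text \<open>
  What the law of large numbers uses of a point process, expressed by its law alone. The
  ergodicity assumption concerns events that are exactly invariant under all shifts.
\<close>

locale stationary_ergodic_law = persistence_parameters r r' s s' k k' q + prob_space P
  for r r' s s' k k' q
    and P :: "((real ^ 'n::{finite,linorder}) \<times> real) measure measure" +
  assumes sets_P: "sets P = sets configuration_space"
    and shift_P: "measure_preserving P (shift_configuration x)"
    and ergodic: "A \<in> sets configuration_space \<Longrightarrow>
      (\<And>x. shift_configuration x -` A \<inter> space configuration_space = A) \<Longrightarrow> prob A \<in> {0, 1}"
    and hard_P: "AE \<mu> in P. \<mu> \<in> hard_configs"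
    and moments: "all_moments P (count_in (cube 1))"
begin

lemma space_P: "space P = space configuration_space"
  by (rule sets_eq_imp_space_eq[OF sets_P])

lemma measurable_P: "borel_measurable P = borel_measurable configuration_space"
  by (rule measurable_cong_sets[OF sets_P refl])

lemma count_in_UN:
  assumes V: "finite V" and B: "\<And>v. v \<in> V \<Longrightarrow> bounded (B v)" "\<And>v. v \<in> V \<Longrightarrow> B v \<in> sets borel"
    and W: "W \<subseteq> (\<Union>v\<in>V. B v)"
  shows "count_in W (\<mu> :: ((real, 'n) vec \<times> real) measure) \<le> (\<Sum>v\<in>V. count_in (B v) \<mu>)"
proof (cases "\<mu> \<in> hard_configs")
  case True
  have bW: "bounded W" by (rule bounded_subset[OF _ W]) (use V B in auto)
  have "ennreal (count_in W \<mu>) = emeasure (slice s' \<mu>) W" by (rule count_in_emeasure[OF True bW])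
  also have "\<dots> \<le> emeasure (slice s' \<mu>) (\<Union>v\<in>V. B v)"
    using W V B by (intro emeasure_mono sets.finite_UN) auto
  also have "\<dots> \<le> (\<Sum>v\<in>V. emeasure (slice s' \<mu>) (B v))"
    by (rule emeasure_subadditive_finite) (use V B in auto)
  also have "\<dots> = (\<Sum>v\<in>V. ennreal (count_in (B v) \<mu>))"
    by (rule sum.cong[OF refl]) (simp add: count_in_emeasure[OF True B(1)])
  also have "\<dots> = ennreal (\<Sum>v\<in>V. count_in (B v) \<mu>)" by (simp add: count_in_nonneg)
  finally show ?thesis by (simp add: sum_nonneg count_in_nonneg)
qed (simp add: count_in_def)

lemma window_count_moments: "all_moments P (count_in (window (real \<rho>) u))"
proof -
  let ?V = "PiE UNIV (\<lambda>i. {u i - int \<rho>..u i + int \<rho>})"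
  have fV: "finite ?V" by (intro finite_PiE) auto
  have "all_moments P (\<lambda>\<mu>. \<Sum>v\<in>?V. count_in (cube 1) (shift_configuration (- int_vec v) \<mu>))"
    by (intro all_moments_sum all_moments_measure_preserving[OF shift_P moments])
  then show ?thesis
  proof (rule all_moments_bound)
    show "count_in (window (real \<rho>) u) \<in> borel_measurable P"
      unfolding measurable_P by (rule count_in_measurable[OF window_borel])
    show "AE \<mu> in P. \<bar>count_in (window (real \<rho>) u) \<mu>\<bar>
        \<le> (\<Sum>v\<in>?V. count_in (cube 1) (shift_configuration (- int_vec v) \<mu>))"
    proof (rule AE_I2)
      fix \<mu> assume \<mu>: "\<mu> \<in> space P"
      have "count_in (window (real \<rho>) u) \<mu> \<le> (\<Sum>v\<in>?V. count_in ((\<lambda>y. y + (- int_vec v)) -` cube 1) \<mu>)"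
        by (rule count_in_UN[OF fV _ _ window_covered_by_unit_cubes])
           (rule bounded_translate[OF cube_bounded], rule translate_borel[OF cube_borel])
      also have "\<dots> = (\<Sum>v\<in>?V. count_in (cube 1) (shift_configuration (- int_vec v) \<mu>))"
        using \<mu> by (simp add: count_in_shift[OF _ cube_borel] space_P)
      finally show "\<bar>count_in (window (real \<rho>) u) \<mu>\<bar>
        \<le> (\<Sum>v\<in>?V. count_in (cube 1) (shift_configuration (- int_vec v) \<mu>))"
        by (simp add: count_in_nonneg)
    qed
  qed
qed

text \<open>
  The bound, from the localisation estimate, for the number of simplices lost at the cell
  \<open>u\<close>.
\<close>

definition local_weight :: "nat \<Rightarrow> ('n \<Rightarrow> int) \<Rightarrow> ((real, 'n) vec \<times> real) measure \<Rightarrow> real" where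
  "local_weight \<rho> u \<mu> = 2 * count_in (window (real \<rho>) u) \<mu> ^ (k * (q + 2))"

lemma local_weight_nonneg: "0 \<le> local_weight \<rho> u \<mu>"
  by (simp add: local_weight_def count_in_nonneg)

lemma local_weight_moments: "all_moments P (local_weight \<rho> u)"
  unfolding local_weight_def[abs_def] by (intro all_moments_cmult all_moments_power window_count_moments)

lemma local_weight_shift:
  assumes "\<mu> \<in> space P"
  shows "local_weight \<rho> u (shift_configuration (- int_vec v) \<mu>) = local_weight \<rho> (\<lambda>i. u i + v i) \<mu>"
  unfolding local_weight_def count_in_shift[OF assms[unfolded space_P] window_borel] window_translate ..

text \<open>
  By stationarity the window at \<open>u\<close> is distributed like the window at the origin.
\<close>

lemma local_weight_power_expectation:
  "expectation (\<lambda>\<mu>. local_weight \<rho> u \<mu> ^ e) = expectation (\<lambda>\<mu>. local_weight \<rho> (\<lambda>_. 0) \<mu> ^ e)"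
proof -
  have m: "(\<lambda>\<mu>. local_weight \<rho> (\<lambda>_. 0) \<mu> ^ e) \<in> borel_measurable P"
    by (rule all_momentsD(1)[OF all_moments_power[OF local_weight_moments]])
  have "expectation (\<lambda>\<mu>. local_weight \<rho> (\<lambda>_. 0) \<mu> ^ e)
      = expectation (\<lambda>\<mu>. local_weight \<rho> (\<lambda>_. 0) (shift_configuration (- int_vec u) \<mu>) ^ e)"
    by (rule measure_preserving_integral[OF shift_P m, symmetric])
  also have "\<dots> = expectation (\<lambda>\<mu>. local_weight \<rho> u \<mu> ^ e)"
    by (rule Bochner_Integration.integral_cong) (simp_all add: local_weight_shift)
  finally show ?thesis ..
qed

text \<open>
  The multiparameter ergodic theorem for the shifts along the coordinate axes.
\<close>

lemma box_average_limit:
  assumes f: "all_moments P f"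
  shows "\<exists>g. dominated_limit P (\<lambda>N \<mu>. box_sum m N f \<mu> / real N ^ CARD('n)) g \<and> expectation g = expectation f"
proof -
  obtain cs :: "'n list" where cs: "set cs = UNIV" "distinct cs"
    using finite_distinct_list[of "UNIV :: 'n set"] by auto
  have len: "length cs = CARD('n)" using distinct_card[OF cs(2)] cs(1) by simp
  let ?Ts = "map (\<lambda>i. shift_configuration (- (real m *\<^sub>R axis i 1))) cs :: (((real, 'n) vec \<times> real) measure \<Rightarrow> _) list"
  obtain g where g: "dominated_limit P (\<lambda>N. multi_avg ?Ts N f) g" "expectation g = expectation f"
    using multiparameter_ergodic_theorem[OF _ f, of ?Ts] shift_P by auto
  have off: "offset m (UNIV :: 'n set) z = int_vec (\<lambda>i. int (m * z i))" for z
    by (simp add: offset_def int_vec_def)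
  have "multi_avg ?Ts N f \<mu> = box_sum m N f \<mu> / real N ^ CARD('n)" if "\<mu> \<in> space P" for N \<mu>
    using multi_avg_shift[OF cs(2), of \<mu> m N f] that by (simp only: space_P box_sum_def cs(1) len off)
  then have "dominated_limit P (\<lambda>N \<mu>. box_sum m N f \<mu> / real N ^ CARD('n)) g"
    by (rule dominated_limit_cong[OF g(1)])
  then show ?thesis using g(2) by blast
qed

text \<open>
  Points of a common simplex are at most \<open>2 * r'\<close> apart; the summand one is for the
  side of a lattice cell.
\<close>

definition interaction_range :: nat where
  "interaction_range = nat \<lceil>2 * r' + 1\<rceil>"

lemma interaction_range: "2 * r' + 1 \<le> real interaction_range"
  unfolding interaction_range_def by linarith

definition shell_sum :: "nat \<Rightarrow> nat \<Rightarrow> nat \<Rightarrow> ((real, 'n) vec \<times> real) measure \<Rightarrow> real" where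
  "shell_sum R \<rho> n \<mu> = (\<Sum>u\<in>shell R n. local_weight \<rho> u \<mu>)"

definition border_sum :: "nat \<Rightarrow> ((real, 'n) vec \<times> real) measure \<Rightarrow> real" where
  "border_sum m \<mu> = (\<Sum>w\<in>tile_border interaction_range m. local_weight interaction_range w \<mu>)"

text \<open>
  A cell \<open>u\<close> is written as \<open>m * z + w\<close> with \<open>z\<close> the index
  of its tile and \<open>w\<close> its position in the tile. If it is not in the shell, the tile
  belongs to the subdivision, which covers the cube up to a layer of thickness less than
  \<open>m\<close>. If moreover \<open>w\<close> is not near the border of the tile, the window
  around the cell stays inside the tile.
\<close>

lemma tiling_estimate:
  assumes m: "m \<ge> 1" and \<mu>: "\<mu> \<in> space P"
  shows "\<bar>betti_in (cube n) \<mu> - box_sum m (n div m) (betti_in (tile m (\<lambda>_. 0))) \<mu>\<bar>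
    \<le> box_sum m (n div m) (border_sum m) \<mu> + shell_sum (m + 1) interaction_range n \<mu>"
proof -
  let ?N = "n div m" and ?\<rho> = interaction_range
  let ?J = "PiE UNIV (\<lambda>_::'n. {..<?N})"
  \<comment> \<open>The cells near the border of some tile of the subdivision.\<close>
  define U1 where "U1 = (\<lambda>(z, w) i. int (m * z i) + w i) ` (?J \<times> (tile_border ?\<rho> m :: ('n \<Rightarrow> int) set))"
  let ?U2 = "shell (m + 1) n :: ('n \<Rightarrow> int) set"
  have fJ: "finite ?J" by (intro finite_PiE) auto
  have fU1: "finite U1" unfolding U1_def using fJ finite_tile_border by blast
  have "\<bar>betti_in (cube n) \<mu> - (\<Sum>z\<in>?J. betti_in (tile m z) \<mu>)\<bar>
      \<le> (\<Sum>u\<in>U1 \<union> ?U2. 2 * count_in (window (real ?\<rho>) u) \<mu> ^ (k * (q + 2)))"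
  proof (rule betti_in_localisation[OF cube_bounded cube_borel _ fJ _ _ interaction_range])
    show "finite (U1 \<union> ?U2)" using fU1 finite_shell by blast
    show "tile m z \<subseteq> cube n" if "z \<in> ?J" for z by (rule tile_subset_cube[OF that])
    show "tile m z \<inter> tile m z' = {}" if "z \<noteq> z'" for z z' :: "'n \<Rightarrow> nat" by (rule tile_disjoint[OF that])
    fix x :: "(real, 'n) vec" assume x: "x \<in> cube n" and notU: "lattice_cell x \<notin> U1 \<union> ?U2"
    let ?u = "lattice_cell x"
    have u0: "0 \<le> ?u i" "?u i \<le> int n" for i
    proof -
      have "0 \<le> x $ i" "x $ i \<le> real n" using x by (auto simp: mem_cube)
      then show "0 \<le> ?u i" "?u i \<le> int n" unfolding lattice_cell_def by linarith+
    qed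
    \<comment> \<open>Outside the shell every coordinate is far from \<open>n\<close>, so the tile of the cell is complete.\<close>
    have un: "?u i < int n - int (m + 1)" for i
    proof (rule ccontr)
      assume "\<not> ?u i < int n - int (m + 1)"
      then have "?u i \<in> {..<int (m + 1)} \<union> {int n - int (m + 1)..}" by simp
      moreover have "?u \<in> PiE UNIV (\<lambda>_. {- int (m + 1)..<int n + int (m + 1)})"
      proof -
        have "?u j \<in> {- int (m + 1)..<int n + int (m + 1)}" for j using u0[of j] by simp
        then show ?thesis unfolding PiE_UNIV_domain by blast
      qed
      ultimately have "?u \<in> ?U2" unfolding shell_def by blast
      then show False using notU by blast
    qed
    define z where "z i = nat (?u i div int m)" for i
    define w where "w i = ?u i mod int m" for i
    have uzw: "?u i = int (m * z i) + w i" for i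
      using u0(1)[of i] m by (simp add: z_def w_def pos_imp_zdiv_nonneg_iff)
    have w0: "0 \<le> w i" "w i < int m" for i using m by (simp_all add: w_def)
    have zN: "z i < ?N" for i
    proof -
      have "int (m * z i) < int n - int (m + 1)" using un[of i] uzw[of i] w0(1)[of i] by linarith
      then have "m * z i + m < n" by linarith
      then have "m * Suc (z i) \<le> n" by simp
      then have "Suc (z i) \<le> n div m" using m by (simp add: less_eq_div_iff_mult_less_eq mult.commute)
      then show ?thesis by simp
    qed
    then have zJ: "z \<in> ?J" unfolding PiE_UNIV_domain by blast
    have w\<rho>: "int ?\<rho> \<le> w i" "w i + int ?\<rho> < int m" for i
    proof -
      have "\<not> w i \<in> {..<int ?\<rho>} \<union> {int m - int ?\<rho>..}"
      proof
        assume "w i \<in> {..<int ?\<rho>} \<union> {int m - int ?\<rho>..}"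
        moreover have "w \<in> PiE UNIV (\<lambda>_. {0..<int m})" unfolding PiE_UNIV_domain using w0 by simp
        ultimately have "w \<in> tile_border ?\<rho> m" unfolding tile_border_def by blast
        moreover have "?u = (\<lambda>(z, w) i. int (m * z i) + w i) (z, w)" using uzw by auto
        ultimately have "?u \<in> U1" unfolding U1_def using zJ by blast
        then show False using notU by blast
      qed
      then show "int ?\<rho> \<le> w i" "w i + int ?\<rho> < int m" by auto
    qed
    have "window (real ?\<rho>) ?u \<subseteq> tile m z"
    proof
      fix y assume y: "y \<in> window (real ?\<rho>) ?u"
      show "y \<in> tile m z"
        unfolding tile_def
      proof (intro CollectI allI)
        fix i
        have "of_int (?u i) - real ?\<rho> \<le> y $ i" "y $ i \<le> of_int (?u i) + real ?\<rho>"
          using y by (auto simp: mem_window)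
        moreover have "real_of_int (?u i) = real (m * z i) + of_int (w i)"
          by (simp only: uzw of_int_add of_int_of_nat_eq)
        moreover have "real ?\<rho> \<le> of_int (w i)" using w\<rho>(1)[of i] by linarith
        moreover have "of_int (w i) + real ?\<rho> < real m" using w\<rho>(2)[of i] by linarith
        ultimately show "real (m * z i) \<le> y $ i \<and> y $ i < real (m * z i) + real m" by linarith
      qed
    qed
    then show "\<exists>z\<in>?J. window (real ?\<rho>) ?u \<inter> cube n \<subseteq> tile m z" using zJ by blast
  qed
  also have "(\<Sum>u\<in>U1 \<union> ?U2. 2 * count_in (window (real ?\<rho>) u) \<mu> ^ (k * (q + 2))) = (\<Sum>u\<in>U1 \<union> ?U2. local_weight ?\<rho> u \<mu>)"
    by (simp only: local_weight_def)
  also have "\<dots> \<le> (\<Sum>u\<in>U1. local_weight ?\<rho> u \<mu>) + (\<Sum>u\<in>?U2. local_weight ?\<rho> u \<mu>)"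
    using sum.union_inter[OF fU1 finite_shell, of "\<lambda>u. local_weight ?\<rho> u \<mu>" "m + 1" n]
      sum_nonneg[of "U1 \<inter> ?U2" "\<lambda>u. local_weight ?\<rho> u \<mu>"] local_weight_nonneg by simp
  also have "(\<Sum>u\<in>U1. local_weight ?\<rho> u \<mu>)
      \<le> (\<Sum>(z, w)\<in>?J \<times> tile_border ?\<rho> m. local_weight ?\<rho> (\<lambda>i. int (m * z i) + w i) \<mu>)"
    unfolding U1_def
    using sum_image_le[of "?J \<times> tile_border ?\<rho> m" "\<lambda>u. local_weight ?\<rho> u \<mu>" "\<lambda>(z, w) i. int (m * z i) + w i",
        OF finite_cartesian_product[OF fJ finite_tile_border]] local_weight_nonneg
    by (simp add: o_def case_prod_beta)
  also have "\<dots> = (\<Sum>z\<in>?J. \<Sum>w\<in>tile_border ?\<rho> m. local_weight ?\<rho> (\<lambda>i. int (m * z i) + w i) \<mu>)"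
    by (simp add: sum.cartesian_product)
  also have "\<dots> = box_sum m ?N (border_sum m) \<mu>"
    unfolding box_sum_def border_sum_def by (simp add: local_weight_shift[OF \<mu>] add.commute)
  also have "(\<Sum>z\<in>?J. betti_in (tile m z) \<mu>) = box_sum m ?N (betti_in (tile m (\<lambda>_. 0))) \<mu>"
    unfolding box_sum_def
    by (intro sum.cong refl)
       (simp only: betti_in_shift[OF \<mu>[unfolded space_P] tile_bounded tile_borel] tile_translate)
  finally show ?thesis by (simp add: shell_sum_def)
qed

text \<open>
  The left side compares the shifted cube with a box that contains it with a margin depending on
  \<open>c\<close> only. Using the same box for the shift zero, two applications compare the cube
  with its translate.
\<close>

lemma shifted_cube_estimate:
  assumes \<mu>: "\<mu> \<in> space P" and x: "\<And>i. \<bar>x $ i\<bar> \<le> real c" and R: "interaction_range + c + 1 \<le> R"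
  shows "\<bar>betti_in (cbox (\<chi> i. - (real R - 1)) (\<chi> i. real n + (real R - 1))) \<mu>
      - betti_in (cube n) (shift_configuration x \<mu>)\<bar> \<le> shell_sum R interaction_range n \<mu>"
proof -
  let ?W = "cbox (\<chi> i. - (real R - 1)) (\<chi> i. real n + (real R - 1)) :: (real, 'n) vec set"
  let ?\<Lambda> = "(\<lambda>y. y + x) -` cube n"
  have memW: "y \<in> ?W \<longleftrightarrow> (\<forall>i. - (real R - 1) \<le> y $ i \<and> y $ i \<le> real n + (real R - 1))" for y
    by (simp add: mem_box_cart)
  have mem\<Lambda>: "y \<in> ?\<Lambda> \<longleftrightarrow> (\<forall>i. 0 \<le> y $ i + x $ i \<and> y $ i + x $ i \<le> real n)" for y
    by (simp add: mem_cube)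
  have Rr: "real interaction_range + real c + 1 \<le> real R" using R by (simp only: of_nat_le_iff[symmetric, where 'a = real] of_nat_add of_nat_1)
  have "\<bar>betti_in ?W \<mu> - (\<Sum>j\<in>{()}. betti_in ?\<Lambda> \<mu>)\<bar>
      \<le> (\<Sum>u\<in>shell R n. 2 * count_in (window (real interaction_range) u) \<mu> ^ (k * (q + 2)))"
  proof (rule betti_in_localisation[OF bounded_cbox _ finite_shell _ _ _ interaction_range])
    show "?\<Lambda> \<subseteq> ?W"
    proof
      fix y assume y: "y \<in> ?\<Lambda>"
      show "y \<in> ?W"
        unfolding memW
      proof
        fix i
        have "0 \<le> y $ i + x $ i" "y $ i + x $ i \<le> real n" using y unfolding mem\<Lambda> by blast+
        then show "- (real R - 1) \<le> y $ i \<and> y $ i \<le> real n + (real R - 1)" using x[of i] Rr by linarith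
      qed
    qed
    fix y assume y: "y \<in> ?W" and nu: "lattice_cell y \<notin> shell R n"
    let ?u = "lattice_cell y"
    have "?u i \<in> {- int R..<int n + int R}" for i
    proof -
      have "- (real R - 1) \<le> y $ i" "y $ i \<le> real n + (real R - 1)" using y unfolding memW by blast+
      then show ?thesis unfolding lattice_cell_def atLeastLessThan_iff by linarith
    qed
    then have "?u \<in> PiE UNIV (\<lambda>_. {- int R..<int n + int R})" unfolding PiE_UNIV_domain by blast
    then have "\<not> (\<exists>i. ?u i \<in> {..<int R} \<union> {int n - int R..})"
      using nu unfolding shell_def by blast
    then have "?u i \<notin> {..<int R} \<union> {int n - int R..}" for i by blast
    then have u: "int R \<le> ?u i" "?u i < int n - int R" for i
      unfolding Un_iff lessThan_iff atLeast_iff by (meson not_less)+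
    have "window (real interaction_range) ?u \<subseteq> ?\<Lambda>"
    proof
      fix v assume v: "v \<in> window (real interaction_range) ?u"
      show "v \<in> ?\<Lambda>"
        unfolding mem\<Lambda>
      proof
        fix i
        have "of_int (?u i) - real interaction_range \<le> v $ i" "v $ i \<le> of_int (?u i) + real interaction_range"
          using v by (auto simp: mem_window)
        moreover have "real R \<le> of_int (?u i)" "of_int (?u i) \<le> real n - real R" using u[of i] by linarith+
        ultimately show "0 \<le> v $ i + x $ i \<and> v $ i + x $ i \<le> real n" using x[of i] Rr by linarith
      qed
    qed
    then show "\<exists>j\<in>{()}. window (real interaction_range) ?u \<inter> ?W \<subseteq> ?\<Lambda>" by blast
  qed auto
  then show ?thesis
    using \<mu> by (simp add: shell_sum_def local_weight_def betti_in_shift[OF _ cube_bounded cube_borel] space_P)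
qed

text \<open>
  The localisation estimate without any regions: every simplex is charged to one of its cells.
\<close>

lemma betti_in_le_box_sum:
  assumes \<mu>: "\<mu> \<in> space P" and W: "W \<subseteq> cube n" "W \<in> sets borel"
  shows "\<bar>betti_in W \<mu>\<bar> \<le> box_sum 1 (Suc n) (local_weight interaction_range (\<lambda>_. 0)) \<mu>"
proof -
  let ?J = "PiE UNIV (\<lambda>_::'n. {..<Suc n})"
  define U where "U = (\<lambda>z i. int (z i)) ` ?J"
  have fJ: "finite ?J" by (intro finite_PiE) auto
  have "\<bar>betti_in W \<mu> - (\<Sum>j\<in>({} :: unit set). betti_in W \<mu>)\<bar>
      \<le> (\<Sum>u\<in>U. 2 * count_in (window (real interaction_range) u) \<mu> ^ (k * (q + 2)))"
  proof (rule betti_in_localisation[OF bounded_subset[OF cube_bounded W(1)] W(2) _ _ _ _ interaction_range])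
    show "finite U" unfolding U_def using fJ by simp
    fix x :: "(real, 'n) vec" assume xW: "x \<in> W" and "lattice_cell x \<notin> U"
    have "nat (lattice_cell x i) < Suc n \<and> int (nat (lattice_cell x i)) = lattice_cell x i" for i
    proof -
      have "0 \<le> x $ i" "x $ i \<le> real n" using xW W(1) by (auto simp: mem_cube)
      then have "0 \<le> lattice_cell x i" "lattice_cell x i \<le> int n" unfolding lattice_cell_def by linarith+
      then show ?thesis by simp
    qed
    then have "lattice_cell x \<in> U"
      unfolding U_def PiE_UNIV_domain
      by (intro image_eqI[of _ _ "\<lambda>i. nat (lattice_cell x i)"]) auto
    then show "\<exists>j\<in>({} :: unit set). window (real interaction_range) (lattice_cell x) \<inter> W \<subseteq> W"
      using \<open>lattice_cell x \<notin> U\<close> by blast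
  qed auto
  then have "\<bar>betti_in W \<mu>\<bar> \<le> (\<Sum>u\<in>U. local_weight interaction_range u \<mu>)"
    by (simp add: local_weight_def)
  also have "\<dots> \<le> (\<Sum>z\<in>?J. local_weight interaction_range (\<lambda>i. int (z i)) \<mu>)"
    unfolding U_def
    using sum_image_le[OF fJ, of "\<lambda>u. local_weight interaction_range u \<mu>" "\<lambda>z i. int (z i)"] local_weight_nonneg
    by (simp add: o_def)
  also have "\<dots> = box_sum 1 (Suc n) (local_weight interaction_range (\<lambda>_. 0)) \<mu>"
    unfolding box_sum_def by (simp add: local_weight_shift[OF \<mu>])
  finally show ?thesis .
qed

lemma betti_in_measurable_P:
  "bounded \<Lambda> \<Longrightarrow> \<Lambda> \<in> sets borel \<Longrightarrow> betti_in \<Lambda> \<in> borel_measurable P"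
  unfolding measurable_P by (rule betti_in_measurable)

lemma box_sum_moments:
  assumes "all_moments P f" shows "all_moments P (box_sum m N f)"
  unfolding box_sum_def[abs_def]
  by (intro all_moments_sum all_moments_measure_preserving[OF shift_P assms])

lemma betti_in_moments:
  assumes "W \<subseteq> cube n" "W \<in> sets borel"
  shows "all_moments P (betti_in W)"
proof (rule all_moments_bound)
  show "all_moments P (box_sum 1 (Suc n) (local_weight interaction_range (\<lambda>_. 0)))"
    by (rule box_sum_moments[OF local_weight_moments])
  show "betti_in W \<in> borel_measurable P"
    by (rule betti_in_measurable_P[OF bounded_subset[OF cube_bounded assms(1)] assms(2)])
  show "AE \<mu> in P. \<bar>betti_in W \<mu>\<bar> \<le> box_sum 1 (Suc n) (local_weight interaction_range (\<lambda>_. 0)) \<mu>"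
    by (intro AE_I2 betti_in_le_box_sum assms)
qed

lemma betti_cube_moments: "all_moments P (betti_in (cube n))"
  by (rule betti_in_moments[OF order_refl cube_borel])

lemma betti_tile_moments: "all_moments P (betti_in (tile m (\<lambda>_. 0)))"
  by (rule betti_in_moments[of _ m, OF _ tile_borel]) (auto simp: tile_def mem_cube less_imp_le)

lemma border_sum_moments: "all_moments P (border_sum m)"
  unfolding border_sum_def[abs_def] by (intro all_moments_sum local_weight_moments)

lemma shell_sum_moments: "all_moments P (shell_sum R \<rho> n)"
  unfolding shell_sum_def[abs_def] by (intro all_moments_sum local_weight_moments)

lemma shell_sum_nonneg: "0 \<le> shell_sum R \<rho> n \<mu>"
  unfolding shell_sum_def by (intro sum_nonneg local_weight_nonneg)

lemma local_weight_mono: "\<rho> \<le> \<rho>' \<Longrightarrow> local_weight \<rho> u \<mu> \<le> local_weight \<rho>' u \<mu>"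
proof -
  assume le: "\<rho> \<le> \<rho>'"
  have "window (real \<rho>) u \<subseteq> window (real \<rho>') u"
  proof
    fix y assume "y \<in> window (real \<rho>) u"
    then show "y \<in> window (real \<rho>') u" unfolding mem_window
    proof (intro allI)
      fix i
      assume "\<forall>i. of_int (u i) - real \<rho> \<le> y $ i \<and> y $ i \<le> of_int (u i) + real \<rho>"
      then have "of_int (u i) - real \<rho> \<le> y $ i" "y $ i \<le> of_int (u i) + real \<rho>" by blast+
      moreover have "real \<rho> \<le> real \<rho>'" using le by simp
      ultimately show "of_int (u i) - real \<rho>' \<le> y $ i \<and> y $ i \<le> of_int (u i) + real \<rho>'" by linarith
    qed
  qed
  then show ?thesis
    unfolding local_weight_def
    by (intro mult_left_mono power_mono count_in_mono window_bounded window_borel count_in_nonneg) auto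
qed

lemma shell_sum_mono:
  assumes "R \<le> R'" "\<rho> \<le> \<rho>'"
  shows "shell_sum R \<rho> n \<mu> \<le> shell_sum R' \<rho>' n \<mu>"
proof -
  have "shell_sum R \<rho> n \<mu> \<le> (\<Sum>u\<in>shell R n. local_weight \<rho>' u \<mu>)"
    unfolding shell_sum_def by (intro sum_mono local_weight_mono assms)
  also have "\<dots> \<le> shell_sum R' \<rho>' n \<mu>"
    unfolding shell_sum_def by (intro sum_mono2 finite_shell shell_mono assms local_weight_nonneg)
  finally show ?thesis .
qed

text \<open>
  By Cauchy-Schwarz and stationarity the second moment is at most the square of the number of
  cells of the shell, which is of order \<open>n ^ (CARD('n) - 1)\<close>, times a constant.
\<close>

lemma shell_sum_square_expectation:
  assumes n: "n \<ge> 1"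
  shows "expectation (\<lambda>\<mu>. (shell_sum R \<rho> n \<mu> / real n ^ CARD('n)) ^ 2)
    \<le> (real (CARD('n) * (4 * R * (1 + 2 * R) ^ (CARD('n) - 1)))) ^ 2
        * expectation (\<lambda>\<mu>. local_weight \<rho> (\<lambda>_. 0) \<mu> ^ 2) / real n ^ 2"
proof -
  let ?S = "shell R n :: ('n \<Rightarrow> int) set" and ?d = "CARD('n)"
  let ?c = "real (?d * (4 * R * (1 + 2 * R) ^ (?d - 1)))"
  let ?E = "expectation (\<lambda>\<mu>. local_weight \<rho> (\<lambda>_. 0) \<mu> ^ 2)"
  have E: "0 \<le> ?E" by (rule Bochner_Integration.integral_nonneg) simp
  have "real (card ?S) \<le> real (?d * (4 * R * (n + 2 * R) ^ (?d - 1)))"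
    using card_shell[of R n, where 'n = 'n] by (simp only: of_nat_le_iff)
  also have "\<dots> \<le> real (?d * (4 * R * ((1 + 2 * R) * n) ^ (?d - 1)))"
    using n by (intro of_nat_mono mult_le_mono order_refl power_mono) (simp_all add: algebra_simps)
  also have "\<dots> = ?c * real n ^ (?d - 1)"
    by (simp only: power_mult_distrib of_nat_mult of_nat_power mult_ac)
  finally have cS: "real (card ?S) \<le> ?c * real n ^ (?d - 1)" .
  have int: "integrable P (\<lambda>\<mu>. local_weight \<rho> u \<mu> ^ 2)" for u
    by (rule all_moments_integrable[OF all_moments_power[OF local_weight_moments]])
  have "expectation (\<lambda>\<mu>. shell_sum R \<rho> n \<mu> ^ 2) \<le> expectation (\<lambda>\<mu>. real (card ?S) * (\<Sum>u\<in>?S. local_weight \<rho> u \<mu> ^ 2))"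
  proof (rule integral_mono)
    show "integrable P (\<lambda>\<mu>. shell_sum R \<rho> n \<mu> ^ 2)"
      by (rule all_moments_integrable[OF all_moments_power[OF shell_sum_moments]])
    show "integrable P (\<lambda>\<mu>. real (card ?S) * (\<Sum>u\<in>?S. local_weight \<rho> u \<mu> ^ 2))"
      by (intro integrable_mult_right Bochner_Integration.integrable_sum int)
    show "shell_sum R \<rho> n \<mu> ^ 2 \<le> real (card ?S) * (\<Sum>u\<in>?S. local_weight \<rho> u \<mu> ^ 2)" for \<mu>
      unfolding shell_sum_def using sum_squared_le_sum_of_squares[of "\<lambda>u. local_weight \<rho> u \<mu>" ?S]
      by (simp add: mult.commute)
  qed
  also have "\<dots> = real (card ?S) * (\<Sum>u\<in>?S. expectation (\<lambda>\<mu>. local_weight \<rho> u \<mu> ^ 2))"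
    using int by (simp add: Bochner_Integration.integral_sum)
  also have "\<dots> = real (card ?S) * (\<Sum>u\<in>?S. ?E)"
    by (intro arg_cong[where f = "\<lambda>x. real (card ?S) * x"] sum.cong refl local_weight_power_expectation)
  also have "\<dots> = (real (card ?S)) ^ 2 * ?E" by (simp add: power2_eq_square)
  also have "\<dots> \<le> (?c * real n ^ (?d - 1)) ^ 2 * ?E"
    by (intro mult_right_mono power_mono cS E) simp
  finally have *: "expectation (\<lambda>\<mu>. shell_sum R \<rho> n \<mu> ^ 2) \<le> (?c * real n ^ (?d - 1)) ^ 2 * ?E" .
  have "real n ^ ?d = real n * real n ^ (?d - 1)"
    by (simp add: power_eq_if)
  then have "(?c * real n ^ (?d - 1)) ^ 2 * ?E / (real n ^ ?d) ^ 2 = ?c ^ 2 * ?E / real n ^ 2"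
    using n by (simp add: power_mult_distrib)
  moreover have "expectation (\<lambda>\<mu>. (shell_sum R \<rho> n \<mu> / real n ^ ?d) ^ 2)
      = expectation (\<lambda>\<mu>. shell_sum R \<rho> n \<mu> ^ 2) / (real n ^ ?d) ^ 2"
    by (simp add: power_divide)
  ultimately show ?thesis
    using divide_right_mono[OF *, of "(real n ^ ?d) ^ 2"] by simp
qed

text \<open>
  The expectations of the squares are summable, so the squares are almost surely summable.
\<close>

lemma shell_sum_negligible:
  "AE \<mu> in P. (\<lambda>n. shell_sum R \<rho> n \<mu> / real n ^ CARD('n)) \<longlonglongrightarrow> 0"
proof -
  let ?x = "\<lambda>n \<mu>. (shell_sum R \<rho> n \<mu> / real n ^ CARD('n)) ^ 2"
  let ?C = "(real (CARD('n) * (4 * R * (1 + 2 * R) ^ (CARD('n) - 1)))) ^ 2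
        * expectation (\<lambda>\<mu>. local_weight \<rho> (\<lambda>_. 0) \<mu> ^ 2)"
  have C: "0 \<le> ?C" by (intro mult_nonneg_nonneg Bochner_Integration.integral_nonneg) simp_all
  have mom: "all_moments P (?x n)" for n
  proof -
    have "?x n = (\<lambda>\<mu>. (1 / real n ^ CARD('n)) ^ 2 * shell_sum R \<rho> n \<mu> ^ 2)"
      by (rule ext) (simp add: power_divide)
    then show ?thesis by (simp only:) (intro all_moments_cmult all_moments_power shell_sum_moments)
  qed
  have [measurable]: "?x n \<in> borel_measurable P" for n by (rule all_momentsD(1)[OF mom])
  have le: "(\<integral>\<^sup>+\<mu>. ennreal (?x (Suc n) \<mu>) \<partial>P) \<le> ennreal (?C / real (Suc n) ^ 2)" for n
  proof -
    have "(\<integral>\<^sup>+\<mu>. ennreal (?x (Suc n) \<mu>) \<partial>P) = ennreal (expectation (?x (Suc n)))"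
      by (rule nn_integral_eq_integral[OF all_moments_integrable[OF mom]]) simp
    also have "\<dots> \<le> ennreal (?C / real (Suc n) ^ 2)"
      by (intro ennreal_leI shell_sum_square_expectation) simp
    finally show ?thesis .
  qed
  have "(\<integral>\<^sup>+\<mu>. (\<Sum>n. ennreal (?x (Suc n) \<mu>)) \<partial>P) = (\<Sum>n. \<integral>\<^sup>+\<mu>. ennreal (?x (Suc n) \<mu>) \<partial>P)"
    by (rule nn_integral_suminf) measurable
  also have "\<dots> \<le> (\<Sum>n. ennreal (?C / real (Suc n) ^ 2))" by (intro suminf_le le) auto
  also have "\<dots> < \<infinity>"
  proof -
    have "summable (\<lambda>n. ?C / (real (Suc n))\<^sup>2)"
      using summable_mult[OF inverse_power_summable[of 2, where 'a = real], of ?C]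
      by (subst summable_Suc_iff) (simp add: divide_inverse)
    then show ?thesis using C by (subst suminf_ennreal2) auto
  qed
  finally have fin: "(\<integral>\<^sup>+\<mu>. (\<Sum>n. ennreal (?x (Suc n) \<mu>)) \<partial>P) \<noteq> \<infinity>" by (simp only: less_top infinity_ennreal_def)
  have "(\<lambda>\<mu>. \<Sum>n. ennreal (?x (Suc n) \<mu>)) \<in> borel_measurable P"
    by (rule borel_measurable_suminf_order)
       (rule measurable_compose[OF all_momentsD(1)[OF mom] measurable_ennreal])
  from nn_integral_noteq_infinite[OF this fin] have "AE \<mu> in P. (\<Sum>n. ennreal (?x (Suc n) \<mu>)) \<noteq> \<infinity>" .
  then show ?thesis
  proof eventually_elim
    case (elim \<mu>)
    have "summable (\<lambda>n. ?x (Suc n) \<mu>)"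
      by (rule summable_suminf_not_top) (use elim in auto)
    then have "(\<lambda>n. ?x (Suc n) \<mu>) \<longlonglongrightarrow> 0" by (rule summable_LIMSEQ_zero)
    then have "(\<lambda>n. ?x n \<mu>) \<longlonglongrightarrow> 0" by (rule LIMSEQ_imp_Suc)
    then have "(\<lambda>n. sqrt (?x n \<mu>)) \<longlonglongrightarrow> sqrt 0" by (intro tendsto_real_sqrt)
    then show ?case by (simp add: shell_sum_nonneg)
  qed
qed

definition betti_density :: "nat \<Rightarrow> ((real, 'n) vec \<times> real) measure \<Rightarrow> real" where
  "betti_density n \<mu> = betti_in (cube n) \<mu> / real n ^ CARD('n)"

lemma betti_density_moments: "all_moments P (betti_density n)"
proof -
  have "betti_density n = (\<lambda>\<mu>. (1 / real n ^ CARD('n)) * betti_in (cube n) \<mu>)"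
    by (rule ext) (simp add: betti_density_def)
  then show ?thesis by (simp only:) (rule all_moments_cmult[OF betti_cube_moments])
qed

text \<open>
  The border of a tile has of the order of \<open>m ^ (CARD('n) - 1)\<close> cells.
\<close>

lemma border_sum_expectation_negligible:
  "(\<lambda>m. expectation (border_sum (Suc m)) / real (Suc m) ^ CARD('n)) \<longlonglongrightarrow> 0"
proof (rule real_tendsto_sandwich)
  let ?d = "CARD('n)" and ?\<rho> = interaction_range
  let ?E = "expectation (local_weight ?\<rho> (\<lambda>_. 0))"
  have E: "0 \<le> ?E" by (rule Bochner_Integration.integral_nonneg) (rule local_weight_nonneg)
  have eq: "expectation (border_sum m) = real (card (tile_border ?\<rho> m :: ('n \<Rightarrow> int) set)) * ?E" for m
  proof -
    have "expectation (border_sum m) = (\<Sum>w\<in>tile_border ?\<rho> m. expectation (local_weight ?\<rho> w))"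
      unfolding border_sum_def
      by (rule Bochner_Integration.integral_sum) (rule all_moments_integrable[OF local_weight_moments])
    also have "\<dots> = (\<Sum>w\<in>(tile_border ?\<rho> m :: ('n \<Rightarrow> int) set). ?E)"
    proof (rule sum.cong[OF refl])
      fix w show "expectation (local_weight ?\<rho> w) = ?E"
        using local_weight_power_expectation[of ?\<rho> w 1] by simp
    qed
    finally show ?thesis by simp
  qed
  show "\<forall>\<^sub>F m in sequentially. 0 \<le> expectation (border_sum (Suc m)) / real (Suc m) ^ ?d"
    unfolding eq using E by (intro always_eventually allI divide_nonneg_nonneg mult_nonneg_nonneg) auto
  show "\<forall>\<^sub>F m in sequentially. expectation (border_sum (Suc m)) / real (Suc m) ^ ?d
      \<le> real (?d * (2 * ?\<rho>)) * ?E * inverse (real (Suc m))"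
  proof (intro always_eventually allI)
    fix m
    have "real (card (tile_border ?\<rho> (Suc m) :: ('n \<Rightarrow> int) set)) \<le> real (?d * (2 * ?\<rho> * Suc m ^ (?d - 1)))"
      using card_tile_border[of ?\<rho> "Suc m", where 'n = 'n] by (simp only: of_nat_le_iff)
    then have "expectation (border_sum (Suc m)) / real (Suc m) ^ ?d
        \<le> real (?d * (2 * ?\<rho> * Suc m ^ (?d - 1))) * ?E / real (Suc m) ^ ?d"
      unfolding eq by (intro divide_right_mono mult_right_mono E) auto
    also have "\<dots> = real (?d * (2 * ?\<rho> * Suc m ^ (?d - 1))) * ?E / (real (Suc m) * real (Suc m) ^ (?d - 1))"
      by (simp add: power_eq_if)
    also have "\<dots> = real (?d * (2 * ?\<rho>)) * ?E * inverse (real (Suc m))"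
      by (simp add: divide_inverse del: of_nat_Suc)
    finally show "expectation (border_sum (Suc m)) / real (Suc m) ^ ?d
        \<le> real (?d * (2 * ?\<rho>)) * ?E * inverse (real (Suc m))" .
  qed
  have "(\<lambda>m. real (?d * (2 * ?\<rho>)) * ?E * inverse (real (Suc m))) \<longlonglongrightarrow> real (?d * (2 * ?\<rho>)) * ?E * 0"
    by (intro tendsto_intros LIMSEQ_inverse_real_of_nat)
  then show "(\<lambda>m. real (?d * (2 * ?\<rho>)) * ?E * inverse (real (Suc m))) \<longlonglongrightarrow> 0" by simp
qed simp

lemma box_sum_div_limit:
  assumes m: "m \<ge> 1" and lim: "(\<lambda>N. box_sum m N f \<mu> / real N ^ CARD('n)) \<longlonglongrightarrow> (L :: real)"
  shows "(\<lambda>n. box_sum m (n div m) f (\<mu> :: ((real, 'n) vec \<times> real) measure) / real n ^ CARD('n)) \<longlonglongrightarrow> L / real m ^ CARD('n)"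
proof -
  let ?d = "CARD('n)"
  have "(\<lambda>n. box_sum m (n div m) f \<mu> / real (n div m) ^ ?d) \<longlonglongrightarrow> L"
    by (rule filterlim_compose[OF lim filterlim_div_at_top[OF m]])
  then have "(\<lambda>n. (real (n div m) / real n) ^ ?d * (box_sum m (n div m) f \<mu> / real (n div m) ^ ?d))
      \<longlonglongrightarrow> (1 / real m) ^ ?d * L"
    by (intro tendsto_mult tendsto_power div_ratio_tendsto[OF m])
  moreover have "(real (n div m) / real n) ^ ?d * (box_sum m (n div m) f \<mu> / real (n div m) ^ ?d)
      = box_sum m (n div m) f \<mu> / real n ^ ?d" for n
  proof (cases "n div m = 0")
    case True
    have "PiE (UNIV :: 'n set) (\<lambda>_. {..<0::nat}) = {}" by (auto simp: PiE_def Pi_def)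
    then have "box_sum m 0 f \<mu> = 0" by (simp add: box_sum_def)
    then show ?thesis by (simp add: True)
  next
    case False
    then show ?thesis by (simp add: power_divide)
  qed
  ultimately show ?thesis by (simp add: power_divide)
qed

text \<open>
  By the tiling estimate the densities stay, in the limit, within the limit \<open>b m\<close> of
  the border averages of a convergent sequence, and \<open>b m\<close> per unit volume is almost
  surely small for suitable \<open>m\<close>.
\<close>

lemma betti_density_convergent: "AE \<mu> in P. convergent (\<lambda>n. betti_density n \<mu>)"
proof -
  let ?d = "CARD('n)" and ?\<rho> = interaction_range
  have "\<forall>m. \<exists>F. dominated_limit P (\<lambda>N \<mu>. box_sum (Suc m) N (betti_in (tile (Suc m) (\<lambda>_. 0))) \<mu> / real N ^ ?d) F"
    using box_average_limit[OF betti_tile_moments] by blast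
  from choice[OF this] obtain F where
    "\<forall>m. dominated_limit P (\<lambda>N \<mu>. box_sum (Suc m) N (betti_in (tile (Suc m) (\<lambda>_. 0))) \<mu> / real N ^ ?d) (F m)"
    by (rule exE)
  note F = this[rule_format]
  have "\<forall>m. \<exists>b. dominated_limit P (\<lambda>N \<mu>. box_sum (Suc m) N (border_sum (Suc m)) \<mu> / real N ^ ?d) b
      \<and> expectation b = expectation (border_sum (Suc m))"
    using box_average_limit[OF border_sum_moments] by blast
  from choice[OF this] obtain b where
    "\<forall>m. dominated_limit P (\<lambda>N \<mu>. box_sum (Suc m) N (border_sum (Suc m)) \<mu> / real N ^ ?d) (b m)
      \<and> expectation (b m) = expectation (border_sum (Suc m))"
    by (rule exE)
  note b = this[rule_format, THEN conjunct1] this[rule_format, THEN conjunct2]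
  have Flim: "AE \<mu> in P. \<forall>m. (\<lambda>N. box_sum (Suc m) N (betti_in (tile (Suc m) (\<lambda>_. 0))) \<mu> / real N ^ ?d) \<longlonglongrightarrow> F m \<mu>"
    unfolding AE_all_countable using F by (simp add: dominated_limit_def)
  have blim: "AE \<mu> in P. \<forall>m. (\<lambda>N. box_sum (Suc m) N (border_sum (Suc m)) \<mu> / real N ^ ?d) \<longlonglongrightarrow> b m \<mu>"
    unfolding AE_all_countable using b(1) by (simp add: dominated_limit_def)
  have small: "AE \<mu> in P. \<forall>e>0. \<forall>N. \<exists>m\<ge>N. b m \<mu> / real (Suc m) ^ ?d < e"
  proof (rule AE_arbitrarily_small)
    show "integrable P (\<lambda>\<mu>. b m \<mu> / real (Suc m) ^ ?d)" for m
      using b(1)[of m] by (intro integrable_divide) (auto simp: dominated_limit_def intro: all_moments_integrable)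
    show "AE \<mu> in P. 0 \<le> b m \<mu> / real (Suc m) ^ ?d" for m
      using blim
    proof eventually_elim
      case (elim \<mu>)
      have "0 \<le> box_sum (Suc m) N (border_sum (Suc m)) \<mu> / real N ^ ?d" for N
        unfolding box_sum_def border_sum_def by (intro divide_nonneg_nonneg sum_nonneg local_weight_nonneg) simp
      then have "0 \<le> b m \<mu>" using LIMSEQ_le_const[OF elim[rule_format, of m]] by blast
      then show ?case by simp
    qed
    show "(\<lambda>m. expectation (\<lambda>\<mu>. b m \<mu> / real (Suc m) ^ ?d)) \<longlonglongrightarrow> 0"
      using border_sum_expectation_negligible b(2) by simp
  qed
  have shells: "AE \<mu> in P. \<forall>R. (\<lambda>n. shell_sum R ?\<rho> n \<mu> / real n ^ ?d) \<longlonglongrightarrow> 0"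
    unfolding AE_all_countable using shell_sum_negligible by blast
  show ?thesis
    using Flim blim small shells AE_space
  proof eventually_elim
    case (elim \<mu>)
    show ?case
    proof (rule convergent_if_approximable)
      fix e :: real assume "e > 0"
      then obtain m where m: "b m \<mu> / real (Suc m) ^ ?d < e" using elim(3) by blast
      let ?s = "\<lambda>n. box_sum (Suc m) (n div Suc m) (betti_in (tile (Suc m) (\<lambda>_. 0))) \<mu> / real n ^ ?d"
      let ?t = "\<lambda>n. box_sum (Suc m) (n div Suc m) (border_sum (Suc m)) \<mu> / real n ^ ?d
          + shell_sum (Suc m + 1) ?\<rho> n \<mu> / real n ^ ?d"
      show "\<exists>s S t T. (\<forall>n. \<bar>betti_density n \<mu> - s n\<bar> \<le> t n) \<and> s \<longlonglongrightarrow> S \<and> t \<longlonglongrightarrow> T \<and> T < e"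
      proof (intro exI conjI allI)
        fix n
        have "\<bar>betti_density n \<mu> - ?s n\<bar>
            = \<bar>betti_in (cube n) \<mu> - box_sum (Suc m) (n div Suc m) (betti_in (tile (Suc m) (\<lambda>_. 0))) \<mu>\<bar> / real n ^ ?d"
          by (simp add: betti_density_def diff_divide_distrib[symmetric])
        also have "\<dots> \<le> (box_sum (Suc m) (n div Suc m) (border_sum (Suc m)) \<mu> + shell_sum (Suc m + 1) ?\<rho> n \<mu>) / real n ^ ?d"
          by (intro divide_right_mono tiling_estimate elim(5)) simp_all
        also have "\<dots> = ?t n" by (rule add_divide_distrib)
        finally show "\<bar>betti_density n \<mu> - ?s n\<bar> \<le> ?t n" .
        show "?s \<longlonglongrightarrow> F m \<mu> / real (Suc m) ^ ?d"
          by (rule box_sum_div_limit[OF _ elim(1)[rule_format]]) simp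
        show "?t \<longlonglongrightarrow> b m \<mu> / real (Suc m) ^ ?d + 0"
          by (intro tendsto_add box_sum_div_limit[OF _ elim(2)[rule_format]] elim(4)[rule_format]) simp
        show "b m \<mu> / real (Suc m) ^ ?d + 0 < e" using m by simp
      qed
    qed
  qed
qed

text \<open>
  The local weights over the cells of the cube dominate, and their averages have a majorant by the
  ergodic theorem; the factor accounts for the \<open>n + 1\<close> lattice points along a side of
  length \<open>n\<close>.
\<close>

lemma betti_density_dominated: "\<exists>h. all_moments P h \<and> (AE \<mu> in P. \<forall>n. \<bar>betti_density n \<mu>\<bar> \<le> h \<mu>)"
proof -
  let ?d = "CARD('n)" and ?w = "local_weight interaction_range (\<lambda>_. 0)"
  obtain g where "dominated_limit P (\<lambda>N \<mu>. box_sum 1 N ?w \<mu> / real N ^ ?d) g"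
    using box_average_limit[OF local_weight_moments] by blast
  then obtain h where h: "all_moments P h" "AE \<mu> in P. \<forall>N. \<bar>box_sum 1 N ?w \<mu> / real N ^ ?d\<bar> \<le> h \<mu>"
    by (auto simp: dominated_limit_def)
  have "AE \<mu> in P. \<forall>n. \<bar>betti_density n \<mu>\<bar> \<le> 2 ^ ?d * h \<mu>"
    using h(2) AE_space
  proof eventually_elim
    case (elim \<mu>)
    show ?case
    proof
      fix n
      have h0: "0 \<le> h \<mu>" using elim(1)[rule_format, of 0] by (meson abs_ge_zero order_trans)
      show "\<bar>betti_density n \<mu>\<bar> \<le> 2 ^ ?d * h \<mu>"
      proof (cases "n = 0")
        case True
        then show ?thesis using h0 by (simp add: betti_density_def power_0_left)
      next
        case False
        have "\<bar>betti_density n \<mu>\<bar> = \<bar>betti_in (cube n) \<mu>\<bar> / real n ^ ?d" by (simp add: betti_density_def)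
        also have "\<dots> \<le> box_sum 1 (Suc n) ?w \<mu> / real n ^ ?d"
          by (intro divide_right_mono betti_in_le_box_sum elim(2) order_refl cube_borel) simp
        also have "\<dots> = (real (Suc n) / real n) ^ ?d * (box_sum 1 (Suc n) ?w \<mu> / real (Suc n) ^ ?d)"
          by (simp add: power_divide del: of_nat_Suc)
        also have "\<dots> \<le> 2 ^ ?d * h \<mu>"
        proof (rule mult_mono)
          show "(real (Suc n) / real n) ^ ?d \<le> 2 ^ ?d"
            using False by (intro power_mono) (auto simp: field_simps)
          show "box_sum 1 (Suc n) ?w \<mu> / real (Suc n) ^ ?d \<le> h \<mu>"
            using elim(1)[rule_format, of "Suc n"] by (rule abs_le_D1)
          show "0 \<le> box_sum 1 (Suc n) ?w \<mu> / real (Suc n) ^ ?d"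
            unfolding box_sum_def by (intro divide_nonneg_nonneg sum_nonneg local_weight_nonneg) simp
        qed simp
        finally show ?thesis .
      qed
    qed
  qed
  then show ?thesis using all_moments_cmult[OF h(1), of "2 ^ ?d"] by blast
qed

text \<open>
  The full measure event on which limits behave well under shifts. Shells of all widths are
  included since a shift makes them wider.
\<close>

definition regular_configs :: "((real, 'n) vec \<times> real) measure set" where
  "regular_configs = {\<mu> \<in> space P. convergent (\<lambda>n. betti_density n \<mu>) \<and>
     (\<forall>R. (\<lambda>n. shell_sum R R n \<mu> / real n ^ CARD('n)) \<longlonglongrightarrow> 0)}"

definition limit_density :: "((real, 'n) vec \<times> real) measure \<Rightarrow> real" where
  "limit_density \<mu> = lim (\<lambda>n. betti_density n \<mu>)"

lemma limit_density_measurable: "limit_density \<in> borel_measurable P"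
  unfolding limit_density_def[abs_def]
  by (rule borel_measurable_lim_metric) (rule all_momentsD(1)[OF betti_density_moments])

lemma tendsto_zero_iff_Cauchy_lim: "(u :: nat \<Rightarrow> real) \<longlonglongrightarrow> 0 \<longleftrightarrow> Cauchy u \<and> lim u = 0"
  by (metis LIMSEQ_imp_Cauchy limI Cauchy_convergent_iff convergent_LIMSEQ_iff)

lemma regular_configs_sets: "regular_configs \<in> sets P"
proof -
  have [measurable]: "betti_density n \<in> borel_measurable P" for n
    by (rule all_momentsD(1)[OF betti_density_moments])
  have [measurable]: "shell_sum R R n \<in> borel_measurable P" for R n
    by (rule all_momentsD(1)[OF shell_sum_moments])
  have b: "{\<mu> \<in> space P. Cauchy (\<lambda>n. betti_density n \<mu>)} \<in> sets P"
    by (rule sets_Collect_Cauchy) measurable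
  have c: "{\<mu> \<in> space P. Cauchy (\<lambda>n. shell_sum R R n \<mu> / real n ^ CARD('n))} \<in> sets P" for R
    by (rule sets_Collect_Cauchy) measurable
  have [measurable]: "(\<lambda>\<mu>. lim (\<lambda>n. shell_sum R R n \<mu> / real n ^ CARD('n))) \<in> borel_measurable P" for R
    by (rule borel_measurable_lim_metric) measurable
  have l: "{\<mu> \<in> space P. lim (\<lambda>n. shell_sum R R n \<mu> / real n ^ CARD('n)) = 0} \<in> sets P" for R
    by measurable
  have eq: "regular_configs = {\<mu> \<in> space P. Cauchy (\<lambda>n. betti_density n \<mu>)} \<inter>
      (\<Inter>R. {\<mu> \<in> space P. Cauchy (\<lambda>n. shell_sum R R n \<mu> / real n ^ CARD('n))} \<inter>
        {\<mu> \<in> space P. lim (\<lambda>n. shell_sum R R n \<mu> / real n ^ CARD('n)) = 0})"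
    unfolding regular_configs_def tendsto_zero_iff_Cauchy_lim Cauchy_convergent_iff[symmetric] by blast
  show ?thesis
    unfolding eq by (intro sets.Int[OF b] sets.countable_INT image_subsetI sets.Int c l) simp
qed

lemma AE_regular: "AE \<mu> in P. \<mu> \<in> regular_configs"
proof -
  have "AE \<mu> in P. \<forall>R. (\<lambda>n. shell_sum R R n \<mu> / real n ^ CARD('n)) \<longlonglongrightarrow> 0"
    unfolding AE_all_countable using shell_sum_negligible by blast
  then show ?thesis
    using betti_density_convergent AE_space by eventually_elim (simp add: regular_configs_def)
qed

lemma vector_bound: "\<exists>c::nat. \<forall>i. \<bar>(x :: (real, 'n) vec) $ i\<bar> \<le> real c"
proof (intro exI allI)
  fix i
  show "\<bar>x $ i\<bar> \<le> real (nat \<lceil>norm x\<rceil>)" using component_le_norm_cart[of x i] by linarith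
qed

lemma local_weight_shift_le:
  assumes \<mu>: "\<mu> \<in> space P" and c: "\<And>i. \<bar>x $ i\<bar> \<le> real c"
  shows "local_weight \<rho> u (shift_configuration x \<mu>) \<le> local_weight (\<rho> + c) u \<mu>"
proof -
  have "(\<lambda>y. y + x) -` window (real \<rho>) u \<subseteq> window (real (\<rho> + c)) u"
  proof
    fix y assume y: "y \<in> (\<lambda>y. y + x) -` window (real \<rho>) u"
    show "y \<in> window (real (\<rho> + c)) u"
      unfolding mem_window
    proof
      fix i
      have "of_int (u i) - real \<rho> \<le> y $ i + x $ i" "y $ i + x $ i \<le> of_int (u i) + real \<rho>"
        using y by (auto simp: mem_window)
      then show "of_int (u i) - real (\<rho> + c) \<le> y $ i \<and> y $ i \<le> of_int (u i) + real (\<rho> + c)"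
        using c[of i] unfolding of_nat_add by linarith
    qed
  qed
  then show ?thesis
    unfolding local_weight_def count_in_shift[OF \<mu>[unfolded space_P] window_borel]
    by (intro mult_left_mono power_mono count_in_mono window_bounded window_borel count_in_nonneg) auto
qed

text \<open>
  Both the cube and its translate are compared with a common larger box. The shells of the shifted
  configuration are bounded by wider shells of the original one.
\<close>

lemma regular_configs_shift:
  assumes \<mu>: "\<mu> \<in> regular_configs"
  shows "shift_configuration x \<mu> \<in> regular_configs \<and> limit_density (shift_configuration x \<mu>) = limit_density \<mu>"
proof -
  let ?d = "CARD('n)" and ?\<rho> = interaction_range and ?\<mu>' = "shift_configuration x \<mu>"
  have sp: "\<mu> \<in> space P" and conv: "convergent (\<lambda>n. betti_density n \<mu>)"
    and shells: "\<And>R. (\<lambda>n. shell_sum R R n \<mu> / real n ^ ?d) \<longlonglongrightarrow> 0"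
    using \<mu> by (auto simp: regular_configs_def)
  have sp': "?\<mu>' \<in> space P" using shift_configuration_space[of \<mu> x] sp by (simp add: space_P)
  obtain c :: nat where c: "\<And>i. \<bar>x $ i\<bar> \<le> real c" using vector_bound[of x] by blast
  \<comment> \<open>Wide enough for the shift and the interaction range.\<close>
  define R where "R = ?\<rho> + c + 1"
  have est: "norm (betti_density n ?\<mu>' - betti_density n \<mu>) \<le> 2 * (shell_sum R R n \<mu> / real n ^ ?d)" for n
  proof -
    let ?W = "cbox (\<chi> i. - (real R - 1)) (\<chi> i. real n + (real R - 1)) :: (real, 'n) vec set"
    have 1: "\<bar>betti_in ?W \<mu> - betti_in (cube n) ?\<mu>'\<bar> \<le> shell_sum R ?\<rho> n \<mu>"
      by (rule shifted_cube_estimate[OF sp c]) (simp add: R_def)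
    have "\<bar>betti_in ?W \<mu> - betti_in (cube n) (shift_configuration 0 \<mu>)\<bar> \<le> shell_sum R ?\<rho> n \<mu>"
      by (rule shifted_cube_estimate[OF sp, of _ c]) (simp_all add: R_def)
    then have 2: "\<bar>betti_in ?W \<mu> - betti_in (cube n) \<mu>\<bar> \<le> shell_sum R ?\<rho> n \<mu>"
      using sp by (simp add: shift_configuration_0 space_P)
    have "shell_sum R ?\<rho> n \<mu> \<le> shell_sum R R n \<mu>" by (rule shell_sum_mono) (simp_all add: R_def)
    then have "\<bar>betti_in (cube n) ?\<mu>' - betti_in (cube n) \<mu>\<bar> \<le> 2 * shell_sum R R n \<mu>"
      using 1 2 by linarith
    then have "\<bar>betti_in (cube n) ?\<mu>' - betti_in (cube n) \<mu>\<bar> / real n ^ ?d \<le> 2 * shell_sum R R n \<mu> / real n ^ ?d"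
      by (rule divide_right_mono) simp
    then show ?thesis by (simp add: betti_density_def diff_divide_distrib[symmetric])
  qed
  have "(\<lambda>n. 2 * (shell_sum R R n \<mu> / real n ^ ?d)) \<longlonglongrightarrow> 0"
    using tendsto_mult[OF tendsto_const shells[of R], of 2] by simp
  then have "(\<lambda>n. betti_density n ?\<mu>' - betti_density n \<mu>) \<longlonglongrightarrow> 0"
    by (rule Lim_null_comparison[OF always_eventually[OF allI[OF est]]])
  from tendsto_add[OF this conv[unfolded convergent_LIMSEQ_iff]]
  have lim: "(\<lambda>n. betti_density n ?\<mu>') \<longlonglongrightarrow> limit_density \<mu>" by (simp add: limit_density_def)
  have "(\<lambda>n. shell_sum R R n ?\<mu>' / real n ^ ?d) \<longlonglongrightarrow> 0" for R
  proof (rule Lim_null_comparison[OF always_eventually shells[of "R + c"]], rule allI)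
    fix n
    have "shell_sum R R n ?\<mu>' \<le> shell_sum R (R + c) n \<mu>"
      unfolding shell_sum_def by (intro sum_mono local_weight_shift_le[OF sp c])
    also have "\<dots> \<le> shell_sum (R + c) (R + c) n \<mu>" by (rule shell_sum_mono) simp_all
    finally show "norm (shell_sum R R n ?\<mu>' / real n ^ ?d) \<le> shell_sum (R + c) (R + c) n \<mu> / real n ^ ?d"
      by (simp add: shell_sum_nonneg divide_right_mono)
  qed
  then show ?thesis
    using sp' lim by (auto simp: regular_configs_def convergent_def limit_density_def[of ?\<mu>'] intro: limI)
qed

text \<open>
  Ergodicity is applied to the event that the limit is at most its mean, within
  \<open>regular_configs\<close> to make the event exactly invariant. Whether its probability is
  zero or one, the limit lies almost surely on one side of its mean and thus equals it.
\<close>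

theorem betti_density_law_of_large_numbers:
  "\<exists>\<beta>. (\<lambda>n. expectation (betti_density n)) \<longlonglongrightarrow> \<beta> \<and> (AE \<mu> in P. (\<lambda>n. betti_density n \<mu>) \<longlonglongrightarrow> \<beta>)"
proof -
  have lim: "AE \<mu> in P. (\<lambda>n. betti_density n \<mu>) \<longlonglongrightarrow> limit_density \<mu>"
    using betti_density_convergent by eventually_elim (simp add: limit_density_def convergent_LIMSEQ_iff)
  obtain h where h: "all_moments P h" "AE \<mu> in P. \<forall>n. \<bar>betti_density n \<mu>\<bar> \<le> h \<mu>"
    using betti_density_dominated by blast
  have "AE \<mu> in P. \<bar>limit_density \<mu>\<bar> \<le> h \<mu>"
    using lim h(2)
  proof eventually_elim
    case (elim \<mu>)
    then show ?case by (intro LIMSEQ_le_const2[OF tendsto_rabs[OF elim(1)]]) auto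
  qed
  then have L: "all_moments P limit_density"
    by (rule all_moments_bound[OF h(1) limit_density_measurable])
  have "dominated_limit P betti_density limit_density"
    unfolding dominated_limit_def using L h lim all_momentsD(1)[OF betti_density_moments] by blast
  from dominated_limit_integral[OF this]
  have exp: "(\<lambda>n. expectation (betti_density n)) \<longlonglongrightarrow> expectation limit_density" .
  let ?c = "expectation limit_density"
  \<comment> \<open>The intersection with \<open>regular_configs\<close> makes the event invariant without exceptional null sets.\<close>
  define A where "A = {\<mu> \<in> space P. limit_density \<mu> \<le> ?c} \<inter> regular_configs"
  have "{\<mu> \<in> space P. limit_density \<mu> \<le> ?c} \<in> sets P" using limit_density_measurable by measurable
  then have A: "A \<in> sets P" unfolding A_def using regular_configs_sets by (rule sets.Int)
  have inv: "shift_configuration x \<mu> \<in> A" if "\<mu> \<in> A" for x \<mu>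
    using that regular_configs_shift[of \<mu> x] by (auto simp: A_def regular_configs_def)
  have "shift_configuration x -` A \<inter> space configuration_space = A" for x
  proof (intro subset_antisym subsetI)
    fix \<mu> assume "\<mu> \<in> shift_configuration x -` A \<inter> space configuration_space"
    then have \<mu>: "\<mu> \<in> space configuration_space" "shift_configuration x \<mu> \<in> A" by auto
    have "shift_configuration (- x) (shift_configuration x \<mu>) \<in> A" by (rule inv[OF \<mu>(2)])
    then show "\<mu> \<in> A" by (simp add: shift_configuration_shift[OF \<mu>(1)] shift_configuration_0[OF \<mu>(1)])
  next
    fix \<mu> assume \<mu>: "\<mu> \<in> A"
    then have "\<mu> \<in> space configuration_space" using sets.sets_into_space[OF A] by (auto simp: space_P)
    then show "\<mu> \<in> shift_configuration x -` A \<inter> space configuration_space" using inv[OF \<mu>] by simp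
  qed
  then have "prob A \<in> {0, 1}" using A by (intro ergodic) (simp_all add: sets_P)
  then consider "prob A = 0" | "prob A = 1" by blast
  then have const: "AE \<mu> in P. limit_density \<mu> = ?c"
  proof cases
    case 1
    then have "AE \<mu> in P. \<mu> \<notin> A" using A by (subst (asm) prob_eq_0) auto
    then have ge: "AE \<mu> in P. 0 \<le> limit_density \<mu> - ?c"
      using AE_regular AE_space by eventually_elim (auto simp: A_def)
    have "expectation (\<lambda>\<mu>. limit_density \<mu> - ?c) = 0"
      using all_moments_integrable[OF L] by (simp add: prob_space)
    then have "AE \<mu> in P. limit_density \<mu> - ?c = 0"
      using integral_nonneg_eq_0_iff_AE[OF _ ge] all_moments_integrable[OF L] by simp
    then show ?thesis by eventually_elim simp
  next
    case 2
    then have "AE \<mu> in P. \<mu> \<in> A" using A by (subst (asm) prob_eq_1) auto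
    then have ge: "AE \<mu> in P. 0 \<le> ?c - limit_density \<mu>"
      by eventually_elim (auto simp: A_def)
    have "expectation (\<lambda>\<mu>. ?c - limit_density \<mu>) = 0"
      using all_moments_integrable[OF L] by (simp add: prob_space)
    then have "AE \<mu> in P. ?c - limit_density \<mu> = 0"
      using integral_nonneg_eq_0_iff_AE[OF _ ge] all_moments_integrable[OF L] by simp
    then show ?thesis by eventually_elim simp
  qed
  have "AE \<mu> in P. (\<lambda>n. betti_density n \<mu>) \<longlonglongrightarrow> ?c"
    using lim const by eventually_elim simp
  with exp show ?thesis by blast
qed

end

section \<open>Persistent Betti numbers of the process\<close>

context marked_point_process
begin

text \<open>
  The number of points of a bounded mark is at most the number of all points.
\<close>

lemma count_moments:
  assumes pp: "persistence_parameters r r' s s' k k'"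
    and mom: "\<And>p::nat. p \<ge> 1 \<Longrightarrow> (\<integral>\<^sup>+ \<omega>. point_count X (cube 1) \<omega> ^ p \<partial>\<Omega>) < \<infinity>"
  shows "all_moments (process_law \<Omega> X M) (persistence_parameters.count_in s s' (cube 1))"
proof -
  interpret pp: persistence_parameters r r' s s' k k' q for q by (rule pp)
  let ?P = "process_law \<Omega> X M" and ?c = "pp.count_in (cube 1 :: (real ^ 'n) set)"
  have cm: "?c \<in> borel_measurable configuration_space" by (rule pp.count_in_measurable[OF cube_borel])
  have sets: "sets ?P = sets configuration_space" by (simp add: process_law_def)
  have cm': "?c \<in> borel_measurable ?P" using cm by (simp add: measurable_cong_sets[OF sets refl])
  have le: "ennreal (?c (configuration X M \<omega>)) \<le> point_count X (cube 1) \<omega>" if \<omega>: "\<omega> \<in> space \<Omega>" for \<omega>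
  proof -
    have h: "configuration X M \<omega> \<in> pp.hard_configs"
      unfolding pp.hard_configs_def
      by (intro CollectI conjI hard_atomic_configuration[OF \<omega>] configuration_in_space)
    have "ennreal (?c (configuration X M \<omega>)) = emeasure (count_space UNIV) {i. X i \<omega> \<in> cube 1 \<and> M i \<omega> \<le> s'}"
      by (simp add: pp.count_in_emeasure[OF h cube_bounded] emeasure_slice_configuration[OF cube_borel])
    also have "\<dots> \<le> point_count X (cube 1) \<omega>"
      unfolding point_count_def by (intro emeasure_mono) auto
    finally show ?thesis .
  qed
  show ?thesis
    unfolding all_moments_def
  proof (intro conjI allI cm')
    fix p :: nat
    show "integrable ?P (\<lambda>\<mu>. \<bar>?c \<mu>\<bar> ^ p)"
    proof (cases "p = 0")
      case True
      have "prob_space ?P" unfolding process_law_def by (rule prob_space_distr[OF configuration_measurable])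
      then interpret P: prob_space ?P .
      show ?thesis using True by simp
    next
      case False
      have "(\<integral>\<^sup>+\<mu>. ennreal (norm (\<bar>?c \<mu>\<bar> ^ p)) \<partial>?P) = (\<integral>\<^sup>+\<omega>. ennreal (norm (\<bar>?c (configuration X M \<omega>)\<bar> ^ p)) \<partial>\<Omega>)"
        unfolding process_law_def using cm by (intro nn_integral_distr[OF configuration_measurable]) measurable
      also have "\<dots> \<le> (\<integral>\<^sup>+ \<omega>. point_count X (cube 1) \<omega> ^ p \<partial>\<Omega>)"
      proof (rule nn_integral_mono)
        fix \<omega> assume "\<omega> \<in> space \<Omega>"
        then have "ennreal (?c (configuration X M \<omega>)) ^ p \<le> point_count X (cube 1) \<omega> ^ p"
          by (intro power_mono le zero_le)
        then show "ennreal (norm (\<bar>?c (configuration X M \<omega>)\<bar> ^ p)) \<le> point_count X (cube 1) \<omega> ^ p"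
          by (simp add: pp.count_in_nonneg ennreal_power)
      qed
      also have "\<dots> < \<infinity>" using False by (intro mom) simp
      finally have "(\<integral>\<^sup>+\<mu>. ennreal (norm (\<bar>?c \<mu>\<bar> ^ p)) \<partial>?P) < \<infinity>" .
      then show ?thesis using cm' by (intro integrableI_bounded) auto
    qed
  qed
qed

end

theorem theorem3p1:
  fixes \<Omega> :: "'w measure"
    and X :: "nat \<Rightarrow> 'w \<Rightarrow> real ^ 'n::{finite,linorder}"
    and M :: "nat \<Rightarrow> 'w \<Rightarrow> real"
    and T q :: nat
    and b d :: filtration_index
  assumes "T \<ge> 1"
    and "marked_point_process \<Omega> T X M"
    and "stationary_process \<Omega> X M"
    and "0 < intensity \<Omega> X" and "intensity \<Omega> X < \<infinity>"
    and "q \<le> CARD('n)"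
    and "b \<in> filtration_indices T" and "d \<in> filtration_indices T" and "index_le b d"
    and "ergodic_process \<Omega> X M"
    and "\<forall>p::nat\<ge>1. (\<integral>\<^sup>+ \<omega>. point_count X (cube 1) \<omega> ^ p \<partial>\<Omega>) < \<infinity>"
  shows "(\<forall>n\<ge>1. integrable \<Omega> (\<lambda>\<omega>. real (persistent_betti X M q b d n \<omega>))) \<and>
    (\<exists>\<beta>::real.
      (\<lambda>n. (\<integral>\<omega>. real (persistent_betti X M q b d n \<omega>) \<partial>\<Omega>) / real n ^ CARD('n)) \<longlonglongrightarrow> \<beta> \<and>
      (AE \<omega> in \<Omega>. (\<lambda>n. real (persistent_betti X M q b d n \<omega>) / real n ^ CARD('n)) \<longlonglongrightarrow> \<beta>))"
proof -
  obtain r s k where b: "b = (r, s, k)" by (cases b) auto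
  obtain r' s' k' where d: "d = (r', s', k')" by (cases d) auto
  interpret marked_point_process \<Omega> T X M by (rule assms(2))
  have pars: "r \<le> r'" "s \<le> s'" "1 \<le> k'" "k' \<le> k"
    using assms(8,9) by (auto simp: b d index_le_def filtration_indices_def)
  have pp: "persistence_parameters r r' s s' k k'"
    using pars by (simp add: persistence_parameters_def)
  let ?P = "process_law \<Omega> X M" and ?\<Phi> = "configuration X M"
  have sets: "sets ?P = sets configuration_space" by (simp add: process_law_def)
  interpret pp: persistence_parameters r r' s s' k k' q by (rule pp)
  have hard: "?\<Phi> \<omega> \<in> pp.hard_configs" if "\<omega> \<in> space \<Omega>" for \<omega>
    unfolding pp.hard_configs_def
    by (intro CollectI conjI hard_atomic_configuration[OF that] configuration_in_space)
  interpret law: stationary_ergodic_law r r' s s' k k' q ?P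
  proof (intro stationary_ergodic_law.intro stationary_ergodic_law_axioms.intro pp)
    show "prob_space ?P" unfolding process_law_def by (rule prob_space_distr[OF configuration_measurable])
    show "sets ?P = sets configuration_space" by (rule sets)
    show "measure_preserving ?P (shift_configuration x)" for x by (rule process_law_shift[OF assms(3)])
    show "measure ?P A \<in> {0, 1}" if "A \<in> sets configuration_space"
      "\<And>x. shift_configuration x -` A \<inter> space configuration_space = A" for A
      using assms(10) that unfolding ergodic_process_def by blast
    have "{\<mu> \<in> space configuration_space. \<mu> \<in> pp.hard_configs} = (pp.hard_configs :: ((real, 'n) vec \<times> real) measure set)"
      using pp.hard_configsD(1) by (intro subset_antisym subsetI CollectI conjI) simp_all
    then have "{\<mu> \<in> space configuration_space. \<mu> \<in> (pp.hard_configs :: ((real, 'n) vec \<times> real) measure set)} \<in> sets configuration_space"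
      by (simp only: pp.hard_configs_sets)
    then show "AE \<mu> in ?P. \<mu> \<in> pp.hard_configs"
      unfolding process_law_def by (subst AE_distr_iff[OF configuration_measurable]) (auto intro: AE_I2 hard)
    show "all_moments ?P (pp.count_in (cube 1))"
      using assms(11) by (intro count_moments[OF pp]) blast
  qed
  have eq: "real (persistent_betti X M q b d n \<omega>) = pp.betti_in (cube n) (?\<Phi> \<omega>)" if "\<omega> \<in> space \<Omega>" for n \<omega>
  proof -
    have "{X i \<omega> | i. X i \<omega> \<in> cube n \<and> M i \<omega> \<le> t} = atoms (slice t (?\<Phi> \<omega>)) \<inter> cube n" for t
      unfolding atoms_slice_configuration by blast
    then show ?thesis
      by (simp add: persistent_betti_def filtration_complex_def b d pp.betti_in_def hard[OF that]
          multicover_betti_def)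
  qed
  have bm: "pp.betti_in (cube n) \<in> borel_measurable (configuration_space :: ((real, 'n) vec \<times> real) measure measure)" for n
    by (rule pp.betti_in_measurable[OF cube_bounded cube_borel])
  have int: "integrable \<Omega> (\<lambda>\<omega>. real (persistent_betti X M q b d n \<omega>))" for n
  proof -
    have "integrable ?P (pp.betti_in (cube n))"
      by (rule all_moments_integrable[OF law.betti_cube_moments])
    then have "integrable \<Omega> (\<lambda>\<omega>. pp.betti_in (cube n) (?\<Phi> \<omega>))"
      unfolding process_law_def by (rule integrable_distr[OF configuration_measurable])
    then show ?thesis by (rule Bochner_Integration.integrable_cong[THEN iffD1, rotated 2]) (simp_all add: eq)
  qed
  have exp: "(\<integral>\<omega>. real (persistent_betti X M q b d n \<omega>) \<partial>\<Omega>) / real n ^ CARD('n)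
      = (\<integral>\<mu>. law.betti_density n \<mu> \<partial>?P)" for n
  proof -
    have "(\<integral>\<omega>. real (persistent_betti X M q b d n \<omega>) \<partial>\<Omega>) = (\<integral>\<omega>. pp.betti_in (cube n) (?\<Phi> \<omega>) \<partial>\<Omega>)"
      by (rule Bochner_Integration.integral_cong) (simp_all add: eq)
    also have "\<dots> = (\<integral>\<mu>. pp.betti_in (cube n) \<mu> \<partial>?P)"
      unfolding process_law_def by (rule integral_distr[OF configuration_measurable bm, symmetric])
    finally show ?thesis by (simp add: law.betti_density_def)
  qed
  obtain \<beta> where \<beta>: "(\<lambda>n. \<integral>\<mu>. law.betti_density n \<mu> \<partial>?P) \<longlonglongrightarrow> \<beta>"
      "AE \<mu> in ?P. (\<lambda>n. law.betti_density n \<mu>) \<longlonglongrightarrow> \<beta>"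
    using law.betti_density_law_of_large_numbers by blast
  have "AE \<omega> in \<Omega>. (\<lambda>n. law.betti_density n (?\<Phi> \<omega>)) \<longlonglongrightarrow> \<beta>"
    by (rule AE_distrD[OF configuration_measurable]) (subst process_law_def[symmetric], rule \<beta>(2))
  then have "AE \<omega> in \<Omega>. (\<lambda>n. real (persistent_betti X M q b d n \<omega>) / real n ^ CARD('n)) \<longlonglongrightarrow> \<beta>"
    using AE_space by eventually_elim (simp add: eq law.betti_density_def)
  then show ?thesis using int \<beta>(1) unfolding exp by blast
qed

end
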